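(* Let $N\ge 1$ and $m\ge 1$ be integers, let $1<p<\infty$, and let $K\subset\mathbb{R}^N$ be a bounded, convex, symmetric set containing the origin and with nonempty interior. Let $(\rho_\varepsilon)_{\varepsilon>0}$ be a family of (measurable) functions $\rho_\varepsilon:[0,\infty)\to[0,\infty)$ such that $$\int_0^\infty r^{N-1}\rho_\varepsilon(r)\,dr=1\ \text{ for all }\varepsilon,\qquad \lim_{\varepsilon\to0}\int_\delta^\infty r^{N-1}\rho_\varepsilon(r)\,dr=0\ \text{ for all }\delta>0.$$ Let $f\in W^{m,p}(\mathbb{R}^N)$. Then $$\lim_{\varepsilon\to0}\int_{\mathbb{R}^N}\int_{\mathbb{R}^N}\frac{|R_{m-1} f(x,y)|^p}{\|x-y\|_K^{mp}}\,\rho_\varepsilon(\|x-y\|_K)\,dx\,dy=\frac{N+mp}{(m!)^p}\int_{\mathbb{R}^N}\int_K|D^m f(x)(y,\dots,y)|^p\,dy\,dx.$$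
   Context: Symmetric means $K=-K$. $\|\cdot\|_K$ is the norm on $\mathbb{R}^N$ with unit ball $K$: $\|x\|_K=\inf\{\lambda>0: x/\lambda\in K\}$. $W^{m,p}(\mathbb{R}^N)$ is the usual Sobolev space. For $\sigma=(\sigma_1,\dots,\sigma_N)\in\mathbb{R}^N$ and a.e. $x$, $$D^m f(x)(\sigma,\dots,\sigma)=\sum_{1\le i_1,\dots,i_m\le N}\sigma_{i_1}\cdots\sigma_{i_m}\frac{\partial^m f}{\partial x_{i_1}\cdots\partial x_{i_m}}(x)$$ (weak derivatives). The Taylor remainder is $$R_{m-1}f(x,y)=f(x)-T_y^{m-1}f(x),\qquad T_y^{m-1}f(x)=\sum_{|\alpha|\le m-1}D^\alpha f(y)\frac{(x-y)^\alpha}{\alpha!},$$ with multi-indices $\alpha$ and weak derivatives $D^\alpha f$ (so it is defined for a.e. $(x,y)$). *)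

theory Defs
  imports "HOL-Analysis.Analysis"
begin

text \<open>A multi-index on \<open>\<real>\<^sup>N\<close>, \<open>N = CARD('n)\<close>, is a function \<open>\<alpha> :: 'n \<Rightarrow> nat\<close>.\<close>

definition mi_size :: "('n::finite \<Rightarrow> nat) \<Rightarrow> nat"
  where "mi_size \<alpha> = (\<Sum>i\<in>UNIV. \<alpha> i)"

definition mi_fact :: "('n::finite \<Rightarrow> nat) \<Rightarrow> real"
  where "mi_fact \<alpha> = (\<Prod>i\<in>UNIV. fact (\<alpha> i))"

definition mi_power :: "real ^ 'n \<Rightarrow> ('n::finite \<Rightarrow> nat) \<Rightarrow> real"
  where "mi_power x \<alpha> = (\<Prod>i\<in>UNIV. (x $ i) ^ \<alpha> i)"

definition partial_deriv :: "'n::finite \<Rightarrow> (real ^ 'n \<Rightarrow> real) \<Rightarrow> real ^ 'n \<Rightarrow> real"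
  where "partial_deriv i \<phi> x = deriv (\<lambda>t. \<phi> (x + t *\<^sub>R axis i 1)) 0"

text \<open>Infinitely differentiable: every iterated partial derivative (including \<open>\<phi>\<close> itself) is
  differentiable, hence also continuous.\<close>

definition smooth :: "(real ^ 'n::finite \<Rightarrow> real) \<Rightarrow> bool"
  where "smooth \<phi> \<longleftrightarrow> (\<forall>is x. foldr partial_deriv is \<phi> differentiable (at x))"

definition test_function :: "(real ^ 'n::finite \<Rightarrow> real) \<Rightarrow> bool"
  where "test_function \<phi> \<longleftrightarrow> smooth \<phi> \<and> compact (closure {x. \<phi> x \<noteq> 0})"

text \<open>\<open>D\<^sup>\<alpha>\<phi>\<close> in the classical sense. The list fixes an order in which the \<open>mi_size \<alpha>\<close> partial
  derivatives are taken (coordinate \<open>i\<close> occurs \<open>\<alpha> i\<close> times); it is only applied to smooth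
  functions, for which the order does not matter.\<close>

definition mixed_partial :: "('n::finite \<Rightarrow> nat) \<Rightarrow> (real ^ 'n \<Rightarrow> real) \<Rightarrow> real ^ 'n \<Rightarrow> real"
  where "mixed_partial \<alpha> \<phi> = foldr partial_deriv (SOME is. count_list is = \<alpha>) \<phi>"

definition locally_integrable :: "(real ^ 'n::finite \<Rightarrow> real) \<Rightarrow> bool"
  where "locally_integrable f \<longleftrightarrow> (\<forall>C. compact C \<longrightarrow> set_integrable lebesgue C f)"

definition has_weak_deriv ::
    "('n::finite \<Rightarrow> nat) \<Rightarrow> (real ^ 'n \<Rightarrow> real) \<Rightarrow> (real ^ 'n \<Rightarrow> real) \<Rightarrow> bool"
  where "has_weak_deriv \<alpha> f g \<longleftrightarrow>
    locally_integrable f \<and> locally_integrable g \<and>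
    (\<forall>\<phi>. test_function \<phi> \<longrightarrow>
      (LINT x|lebesgue. f x * mixed_partial \<alpha> \<phi> x) =
        (- 1) ^ mi_size \<alpha> * (LINT x|lebesgue. g x * \<phi> x))"

text \<open>Some representative of the weak derivative; it is unique up to a null set whenever it exists.\<close>

definition weak_deriv ::
    "('n::finite \<Rightarrow> nat) \<Rightarrow> (real ^ 'n \<Rightarrow> real) \<Rightarrow> real ^ 'n \<Rightarrow> real"
  where "weak_deriv \<alpha> f = (SOME g. has_weak_deriv \<alpha> f g)"

definition Lp_space :: "real \<Rightarrow> (real ^ 'n::finite \<Rightarrow> real) set"
  where "Lp_space p =
    {f. f \<in> borel_measurable lebesgue \<and> integrable lebesgue (\<lambda>x. \<bar>f x\<bar> powr p)}"

definition sobolev_space :: "nat \<Rightarrow> real \<Rightarrow> (real ^ 'n::finite \<Rightarrow> real) set"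
  where "sobolev_space m p =
    {f \<in> Lp_space p. \<forall>\<alpha>. mi_size \<alpha> \<le> m \<longrightarrow> (\<exists>g \<in> Lp_space p. has_weak_deriv \<alpha> f g)}"

text \<open>\<open>D\<^sup>m f(x)(\<sigma>,\<dots>,\<sigma>)\<close>: the tuple \<open>(i\<^sub>1,\<dots>,i\<^sub>m)\<close> is the list \<open>is\<close>, and \<open>count_list is\<close> is the
  multi-index of \<open>\<partial>\<^sup>m/\<partial>x\<^bsub>i\<^sub>1\<^esub>\<dots>\<partial>x\<^bsub>i\<^sub>m\<^esub>\<close>.\<close>

definition weak_Dm :: "nat \<Rightarrow> (real ^ 'n::finite \<Rightarrow> real) \<Rightarrow> real ^ 'n \<Rightarrow> real ^ 'n \<Rightarrow> real"
  where "weak_Dm m f x \<sigma> =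
    (\<Sum>is | length is = m. (\<Prod>k<m. \<sigma> $ (is ! k)) * weak_deriv (count_list is) f x)"

definition taylor_poly :: "nat \<Rightarrow> (real ^ 'n::finite \<Rightarrow> real) \<Rightarrow> real ^ 'n \<Rightarrow> real ^ 'n \<Rightarrow> real"
  where "taylor_poly k f y x =
    (\<Sum>\<alpha> | mi_size \<alpha> \<le> k. weak_deriv \<alpha> f y * mi_power (x - y) \<alpha> / mi_fact \<alpha>)"

definition taylor_remainder ::
    "nat \<Rightarrow> (real ^ 'n::finite \<Rightarrow> real) \<Rightarrow> real ^ 'n \<Rightarrow> real ^ 'n \<Rightarrow> real"
  where "taylor_remainder k f x y = f x - taylor_poly k f y x"

definition norm_of :: "(real ^ 'n::finite) set \<Rightarrow> real ^ 'n \<Rightarrow> real"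
  where "norm_of K x = Inf {t. t > 0 \<and> x /\<^sub>R t \<in> K}"

text \<open>The index sets of the sums above are finite and every multi-index is listed by some tuple,
  so neither the sums nor the choice in \<open>mixed_partial\<close> degenerate.\<close>

lemma finite_mi_size_le: "finite {\<alpha> :: 'n::finite \<Rightarrow> nat. mi_size \<alpha> \<le> k}"
proof (rule finite_subset)
  show "{\<alpha> :: 'n \<Rightarrow> nat. mi_size \<alpha> \<le> k} \<subseteq> Pi\<^sub>E UNIV (\<lambda>_. {..k})"
    unfolding mi_size_def
    by (auto intro: order_trans[OF member_le_sum[of _ UNIV]])
qed (auto intro: finite_PiE)

lemma finite_tuples: "finite {is :: 'n::finite list. length is = m}"
  using finite_lists_length_eq[of "UNIV :: 'n set" m] by simp

lemma ex_count_list_eq: "\<exists>is. count_list is = (\<alpha> :: 'n::finite \<Rightarrow> nat)"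
proof -
  have "\<exists>is. \<forall>i. count_list is i = (if i \<in> A then \<alpha> i else 0)" for A :: "'n set"
  proof (induction A rule: finite_induct[OF finite])
    case 1
    show ?case by (intro exI[of _ "[]"]) simp
  next
    case (2 a A)
    then obtain xs where xs: "\<forall>i. count_list xs i = (if i \<in> A then \<alpha> i else 0)" by blast
    have r: "count_list (replicate n a) i = (if i = a then n else 0)" for n i
      by (induction n) auto
    show ?case
      using 2 by (intro exI[of _ "replicate (\<alpha> a) a @ xs"]) (auto simp: xs r)
  qed
  from this[of UNIV] show ?thesis by auto
qed

end

theory Submission
  imports Defs "HOL-Combinatorics.Multiset_Permutations"
begin

text \<open>Write \<open>R(h, y)\<close> for the Taylor remainder of \<open>f\<close> at \<open>y + h\<close> expanded around \<open>y\<close>, and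
\<open>D(h, y)\<close> for \<open>D\<^sup>m f(y)(h,\<dots>,h)\<close>. After the substitution \<open>x = y + h\<close> the double integral is the
integral over \<open>h\<close> of \<open>\<rho>\<^sub>\<epsilon>(\<parallel>h\<parallel>) \<parallel>h\<parallel>\<^bsup>-mp\<^esup>\<close> times the p-th power of the p-norm of \<open>R(h, \<cdot>)\<close>. The
weight concentrates at \<open>h = 0\<close>, where \<open>R(h, \<cdot>)\<close> is close to \<open>D(h, \<cdot>) / m!\<close>; and with \<open>R\<close>
replaced by \<open>D / m!\<close> the integrand is a radial weight times a function that is homogeneous of
degree 0, so that its integral does not depend on \<open>\<epsilon>\<close> at all.

The closeness of \<open>R\<close> and \<open>D / m!\<close> rests on Taylor's formula with integral remainder, which holds for
each fixed \<open>h\<close> and almost every \<open>y\<close> (\<open>remainder_representation\<close>). It is proved by duality: the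
difference of its two sides is integrated against a test function \<open>\<phi>\<close>, all derivatives and translations
are moved to \<open>\<phi>\<close>, and what is left is Taylor's formula for \<open>\<phi>\<close>. Tensor products of one-dimensional
bumps suffice as test functions (\<open>AE_zero_if_tensor_tests_vanish\<close>), and for them mixed partial
derivatives are explicit and visibly independent of the order of differentiation. Subtracting
\<open>D(h, y) / m!\<close> from the formula and applying Jensen's inequality bounds the error by \<open>\<parallel>h\<parallel>\<^bsup>mp\<^esup>\<close>
times a modulus (\<open>taylor_error_le\<close>) that measures how far translation by \<open>t h\<close>, \<open>0 \<le> t \<le> 1\<close>, moves
the derivatives of order \<open>m\<close> in the p-th mean. This modulus is bounded and tends to 0 with \<open>h\<close> because
translations are continuous in the mean (\<open>Lp_shift_tendsto_0\<close>).

The gauge of \<open>K\<close> admits polar coordinates for functions \<open>F\<close> homogeneous of degree 0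
(\<open>polar_integral\<close>): the mass of \<open>F\<close> in the gauge ball of radius \<open>r\<close> is \<open>r\<^sup>N\<close> times its mass in the
unit ball, and this determines the image of the measure \<open>F(h) dh\<close> under the gauge. It evaluates the
integral of the leading term; applied once more to the profile \<open>r\<^bsup>mp\<^esup>\<close> on the unit interval it
identifies the value with the right-hand side, which is where \<open>N + mp\<close> comes from
(\<open>sphere_mean_eq\<close>).

Finally, for every \<open>\<eta> > 0\<close> there is \<open>C\<close> with \<open>\<bar>a\<bar>\<^sup>p \<le> (1 + \<eta>) \<bar>b\<bar>\<^sup>p + C \<bar>a - b\<bar>\<^sup>p\<close>
(\<open>powr_perturbation\<close>). Used in both directions this makes the energy of \<open>R\<close> and that of \<open>D / m!\<close> agree
up to a factor \<open>1 + \<eta>\<close> and an error that tends to 0 (\<open>energy_comparison\<close>,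
\<open>error_energy_tendsto_0\<close>).\<close>

section \<open>Smooth bump functions on the line\<close>

text \<open>The functions \<open>P(1/t) e\<^bsup>-1/t\<^esup>\<close>, extended by 0 to the left: the polynomial factor makes this
class closed under differentiation.\<close>

definition flat_exp :: "real poly \<Rightarrow> real \<Rightarrow> real"
  where "flat_exp P t = (if t > 0 then poly P (1 / t) * exp (- (1 / t)) else 0)"

lemma poly_times_exp_minus_tendsto_0:
  fixes P :: "real poly"
  shows "((\<lambda>s. poly P s * exp (- s)) \<longlongrightarrow> 0) at_top"
proof -
  have "((\<lambda>s. \<Sum>i\<le>degree P. coeff P i * (s ^ i / exp s)) \<longlongrightarrow> (\<Sum>i\<le>degree P. coeff P i * 0)) at_top"
    by (intro tendsto_sum tendsto_mult tendsto_const tendsto_power_div_exp_0)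
  moreover have "poly P s * exp (- s) = (\<Sum>i\<le>degree P. coeff P i * (s ^ i / exp s))" for s
    by (simp add: poly_altdef sum_distrib_right exp_minus divide_inverse mult.assoc)
  ultimately show ?thesis by simp
qed

text \<open>With \<open>s = 1/t\<close> the derivative of \<open>P(s) e\<^bsup>-s\<^esup>\<close> in \<open>t\<close> is
\<open>s\<^sup>2 (P - P')(s) e\<^bsup>-s\<^esup>\<close>. At 0 the difference quotient is \<open>s P(s) e\<^bsup>-s\<^esup>\<close>, which vanishes as
\<open>s\<close> grows.\<close>

lemma flat_exp_has_derivative:
  "(flat_exp P has_real_derivative flat_exp (pCons 0 (pCons 0 (P - pderiv P))) t) (at t)"
proof -
  consider "t > 0" | "t < 0" | "t = 0" by linarith
  then show ?thesis
  proof cases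
    case 1
    have "((\<lambda>t. poly P (1 / t) * exp (- (1 / t))) has_real_derivative
        flat_exp (pCons 0 (pCons 0 (P - pderiv P))) t) (at t)"
      using 1 by (auto intro!: derivative_eq_intros DERIV_chain'[OF _ poly_DERIV]
          simp: flat_exp_def field_simps)
    then show ?thesis
      by (rule has_field_derivative_transform_within_open[where S = "{0<..}"])
         (use 1 in \<open>auto simp: flat_exp_def\<close>)
  next
    case 2
    have "((\<lambda>t. 0) has_real_derivative flat_exp (pCons 0 (pCons 0 (P - pderiv P))) t) (at t)"
      using 2 by (simp add: flat_exp_def)
    then show ?thesis
      by (rule has_field_derivative_transform_within_open[where S = "{..<0}"])
         (use 2 in \<open>auto simp: flat_exp_def\<close>)
  next
    case 3
    have "((\<lambda>h. poly (pCons 0 P) (inverse h) * exp (- (inverse h))) \<longlongrightarrow> 0) (at_right 0)"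
      by (rule filterlim_compose[OF poly_times_exp_minus_tendsto_0 filterlim_inverse_at_top_right])
    then have "((\<lambda>h. flat_exp P h / h) \<longlongrightarrow> 0) (at_right 0)"
      by (rule Lim_transform_eventually)
         (auto simp: flat_exp_def field_simps eventually_at_filter)
    moreover have "((\<lambda>h. flat_exp P h / h) \<longlongrightarrow> 0) (at_left 0)"
      by (rule Lim_transform_eventually[OF tendsto_const])
         (auto simp: flat_exp_def eventually_at_filter)
    ultimately have "((\<lambda>h. flat_exp P h / h) \<longlongrightarrow> 0) (at 0)"
      by (simp add: filterlim_split_at)
    then show ?thesis
      using 3 by (simp add: has_field_derivative_iff flat_exp_def)
  qed
qed

definition smooth1 :: "(real \<Rightarrow> real) \<Rightarrow> bool"
  where "smooth1 u \<longleftrightarrow> (\<forall>k t. (deriv ^^ k) u field_differentiable at t)"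

text \<open>The algebra generated by affine reparametrisations of the functions above. Closure under
differentiation passes from the generators to the algebra by the sum and product rules, which makes
all its members smooth at once.\<close>

inductive_set flat_algebra :: "(real \<Rightarrow> real) set"
  where
    flat: "(\<lambda>t. flat_exp P (c * t + d)) \<in> flat_algebra"
  | const: "(\<lambda>_. c) \<in> flat_algebra"
  | add: "u \<in> flat_algebra \<Longrightarrow> v \<in> flat_algebra \<Longrightarrow> (\<lambda>t. u t + v t) \<in> flat_algebra"
  | mult: "u \<in> flat_algebra \<Longrightarrow> v \<in> flat_algebra \<Longrightarrow> (\<lambda>t. u t * v t) \<in> flat_algebra"

lemma flat_algebra_derivative:
  "u \<in> flat_algebra \<Longrightarrow> \<exists>u'\<in>flat_algebra. \<forall>t. (u has_real_derivative u' t) (at t)"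
proof (induction rule: flat_algebra.induct)
  case (flat P c d)
  let ?Q = "pCons 0 (pCons 0 (P - pderiv P))"
  have "((\<lambda>t. flat_exp P (c * t + d)) has_real_derivative flat_exp ?Q (c * t + d) * c) (at t)" for t
    by (rule DERIV_chain2[OF flat_exp_has_derivative]) (auto intro!: derivative_eq_intros)
  then show ?case
    by (intro bexI[of _ "\<lambda>t. flat_exp ?Q (c * t + d) * c"] flat_algebra.intros) auto
next
  case (const c)
  show ?case
    by (intro bexI[of _ "\<lambda>_. 0"] flat_algebra.intros) auto
next
  case (add u v)
  then obtain u' v' where "u' \<in> flat_algebra" "\<forall>t. (u has_real_derivative u' t) (at t)"
    "v' \<in> flat_algebra" "\<forall>t. (v has_real_derivative v' t) (at t)" by blast
  then show ?case
    by (intro bexI[of _ "\<lambda>t. u' t + v' t"] flat_algebra.intros) (auto intro!: derivative_intros)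
next
  case (mult u v)
  then obtain u' v' where "u' \<in> flat_algebra" "\<forall>t. (u has_real_derivative u' t) (at t)"
    "v' \<in> flat_algebra" "\<forall>t. (v has_real_derivative v' t) (at t)" by blast
  with mult.hyps show ?case
    by (intro bexI[of _ "\<lambda>t. u' t * v t + v' t * u t"] flat_algebra.intros) 
       (auto intro!: derivative_eq_intros)
qed

lemma flat_algebra_imp_smooth1:
  assumes "u \<in> flat_algebra"
  shows "smooth1 u"
proof -
  have "(deriv ^^ k) u \<in> flat_algebra" for k
  proof (induction k)
    case (Suc k)
    then obtain u' where u': "u' \<in> flat_algebra"
      "\<forall>t. ((deriv ^^ k) u has_real_derivative u' t) (at t)"
      using flat_algebra_derivative by blast
    then have "deriv ((deriv ^^ k) u) = u'" by (auto intro: DERIV_imp_deriv)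
    with u' show ?case by simp
  qed (use assms in simp)
  then show ?thesis
    unfolding smooth1_def field_differentiable_def using flat_algebra_derivative by blast
qed

text \<open>As \<open>n\<close> grows, the bumps increase to the indicator of the interval between \<open>a\<close> and \<open>b\<close>
without ever leaving it.\<close>

definition bump :: "nat \<Rightarrow> real \<Rightarrow> real \<Rightarrow> real \<Rightarrow> real"
  where "bump n a b t = flat_exp 1 (real n * (t - a)) * flat_exp 1 (real n * (b - t))"

lemma smooth1_bump: "smooth1 (bump n a b)"
proof -
  have "(\<lambda>t. flat_exp 1 (real n * t + (- real n * a)) * flat_exp 1 ((- real n) * t + real n * b))
      \<in> flat_algebra"
    by (intro flat_algebra.intros)
  moreover have "bump n a b =
      (\<lambda>t. flat_exp 1 (real n * t + (- real n * a)) * flat_exp 1 ((- real n) * t + real n * b))"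
    by (auto simp: bump_def fun_eq_iff algebra_simps)
  ultimately show ?thesis by (simp add: flat_algebra_imp_smooth1)
qed

lemma bump_eq_0: "t \<notin> {a<..<b} \<Longrightarrow> bump n a b t = 0"
  by (auto simp: bump_def flat_exp_def zero_less_mult_iff)

lemma bump_nonneg: "0 \<le> bump n a b t" and bump_le_1: "bump n a b t \<le> 1"
proof -
  have *: "0 \<le> flat_exp 1 s \<and> flat_exp 1 s \<le> 1" for s by (auto simp: flat_exp_def)
  show "0 \<le> bump n a b t" "bump n a b t \<le> 1"
    using *[of "real n * (t - a)"] *[of "real n * (b - t)"]
    by (auto simp: bump_def intro!: mult_le_one)
qed

lemma bump_tendsto_indicator: "(\<lambda>n. bump n a b t) \<longlonglongrightarrow> indicator {a<..<b} t"
proof (cases "t \<in> {a<..<b}")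
  case True
  have *: "(\<lambda>n. flat_exp 1 (real n * s)) \<longlonglongrightarrow> 1" if "s > 0" for s
  proof -
    have "(\<lambda>n. exp (- (1 / (real n * s)))) \<longlonglongrightarrow> exp (- 0)"
      using that by (intro tendsto_intros tendsto_divide_0[OF tendsto_const] filterlim_at_top_imp_at_infinity filterlim_tendsto_pos_mult_at_top[OF _ _ filterlim_real_sequentially, of _ s, simplified mult.commute]) auto
    then have "(\<lambda>n. exp (- (1 / (real n * s)))) \<longlonglongrightarrow> 1" by simp
    then show ?thesis
      by (rule Lim_transform_eventually)
         (use that in \<open>auto simp: flat_exp_def intro!: eventually_sequentiallyI[of 1]\<close>)
  qed
  show ?thesis
    using True tendsto_mult[OF *[of "t - a"] *[of "b - t"]] by (simp add: bump_def)
qed (simp add: bump_eq_0)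

section \<open>Tensor products of one-dimensional smooth functions\<close>

definition tensor :: "('n::finite \<Rightarrow> real \<Rightarrow> real) \<Rightarrow> real ^ 'n \<Rightarrow> real"
  where "tensor u x = (\<Prod>i\<in>UNIV. u i (x $ i))"

text \<open>The iterated partial derivative of \<open>tensor u\<close> in which coordinate \<open>i\<close> occurs \<open>\<alpha> i\<close> times.
It only depends on these multiplicities, which is why the partial derivatives of a tensor product
commute.\<close>

definition tensor_deriv :: "('n::finite \<Rightarrow> nat) \<Rightarrow> ('n \<Rightarrow> real \<Rightarrow> real) \<Rightarrow> real ^ 'n \<Rightarrow> real"
  where "tensor_deriv \<alpha> u = tensor (\<lambda>i. (deriv ^^ \<alpha> i) (u i))"

lemma tensor_deriv_has_derivative:
  fixes u :: "'n::finite \<Rightarrow> real \<Rightarrow> real"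
  assumes "\<And>i. smooth1 (u i)"
  shows "(tensor_deriv \<alpha> u has_derivative
           (\<lambda>v. \<Sum>i\<in>UNIV. v $ i * tensor_deriv (\<alpha>(i := Suc (\<alpha> i))) u x)) (at x)"
proof -
  have d: "((\<lambda>x. (deriv ^^ \<alpha> i) (u i) (x $ i)) has_derivative
      (\<lambda>v. (deriv ^^ Suc (\<alpha> i)) (u i) (x $ i) * v $ i)) (at x)" for i and x :: "real ^ 'n"
  proof -
    have "((deriv ^^ \<alpha> i) (u i) has_real_derivative deriv ((deriv ^^ \<alpha> i) (u i)) (x $ i)) (at (x $ i))"
      using assms[of i] by (simp add: smooth1_def DERIV_deriv_iff_field_differentiable)
    then have "((deriv ^^ \<alpha> i) (u i) has_derivative (*) (deriv ((deriv ^^ \<alpha> i) (u i)) (x $ i))) (at (x $ i))"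
      by (simp add: has_field_derivative_def)
    then show ?thesis
      using has_derivative_compose[OF bounded_linear_imp_has_derivative[OF bounded_linear_vec_nth]]
      by fastforce
  qed
  have "tensor_deriv (\<alpha>(i := Suc (\<alpha> i))) u x =
      (deriv ^^ Suc (\<alpha> i)) (u i) (x $ i) * (\<Prod>j\<in>UNIV - {i}. (deriv ^^ \<alpha> j) (u j) (x $ j))" for i
    unfolding tensor_deriv_def tensor_def
    by (subst prod.remove[of _ i]) (auto intro!: prod.cong)
  then show ?thesis
    unfolding tensor_deriv_def[of \<alpha>] tensor_def[abs_def]
    by (intro has_derivative_eq_rhs[OF has_derivative_prod[OF d]])
       (simp add: mult_ac fun_eq_iff)
qed

lemma partial_deriv_tensor_deriv:
  assumes "\<And>i. smooth1 (u i)"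
  shows "partial_deriv i (tensor_deriv \<alpha> u) = tensor_deriv (\<alpha>(i := Suc (\<alpha> i))) u"
proof
  fix x :: "real ^ 'a"
  let ?D = "\<lambda>i. tensor_deriv (\<alpha>(i := Suc (\<alpha> i))) u x"
  have "((\<lambda>t. tensor_deriv \<alpha> u (x + t *\<^sub>R axis i 1)) has_derivative
      (\<lambda>t. \<Sum>j\<in>UNIV. (t *\<^sub>R axis i 1) $ j * ?D j)) (at 0)"
    by (rule has_derivative_compose[of "\<lambda>t. x + t *\<^sub>R axis i 1" "\<lambda>t. t *\<^sub>R axis i 1"])
       (auto intro!: derivative_eq_intros has_derivative_eq_rhs[OF tensor_deriv_has_derivative] assms
          simp: fun_upd_def)
  also have "(\<lambda>t. \<Sum>j\<in>UNIV. (t *\<^sub>R axis i 1) $ j * ?D j) = (*) (?D i)"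
    by (auto simp: fun_eq_iff axis_def if_distrib if_distribR mult_ac cong: if_cong)
  finally show "partial_deriv i (tensor_deriv \<alpha> u) x = ?D i"
    unfolding partial_deriv_def by (intro DERIV_imp_deriv) (simp add: has_field_derivative_def)
qed

text \<open>Each partial derivative acts on one factor only; hence the order of differentiation is
forgotten and only the number of occurrences of each coordinate remains.\<close>

lemma foldr_partial_deriv_tensor:
  assumes "\<And>i. smooth1 (u i)"
  shows "foldr partial_deriv is (tensor u) = tensor_deriv (count_list is) u"
proof (induction "is")
  case Nil
  show ?case by (simp add: tensor_deriv_def)
next
  case (Cons a xs)
  have "count_list (a # xs) = (count_list xs)(a := Suc (count_list xs a))"
    by (auto simp: fun_eq_iff)
  with Cons show ?case 
    by (simp add: partial_deriv_tensor_deriv[OF assms] del: count_list.simps fun_upd_apply)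
qed

text \<open>The list chosen inside \<open>mixed_partial\<close> enters only through its occurrence counts, by the
previous lemma.\<close>

lemma mixed_partial_tensor:
  assumes "\<And>i. smooth1 (u i)"
  shows "mixed_partial \<alpha> (tensor u) = tensor_deriv \<alpha> u"
  unfolding mixed_partial_def foldr_partial_deriv_tensor[OF assms]
  by (simp add: someI_ex[OF ex_count_list_eq])

lemma smooth_tensor:
  assumes "\<And>i. smooth1 (u i)"
  shows "smooth (tensor u)"
  unfolding smooth_def foldr_partial_deriv_tensor[OF assms] differentiable_def
  using tensor_deriv_has_derivative[of u, OF assms] by blast

lemma continuous_on_tensor_deriv:
  assumes "\<And>i. smooth1 (u i)"
  shows "continuous_on S (tensor_deriv \<alpha> u)"
  by (meson assms continuous_at_imp_continuous_on has_derivative_continuous tensor_deriv_has_derivative)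

text \<open>Every factor is supported in the corresponding side of one box, so that derivatives of all
orders vanish outside that box.\<close>

definition tensor_test :: "('n::finite \<Rightarrow> real \<Rightarrow> real) \<Rightarrow> real ^ 'n \<Rightarrow> real ^ 'n \<Rightarrow> bool"
  where "tensor_test u a b \<longleftrightarrow>
    (\<forall>i. smooth1 (u i)) \<and> (\<forall>i t. t \<notin> {a $ i..b $ i} \<longrightarrow> u i t = 0)"

lemma deriv_iter_eq_0:
  fixes u :: "real \<Rightarrow> real"
  assumes "\<And>t. t \<notin> {a..b} \<Longrightarrow> u t = 0" and "t \<notin> {a..b}"
  shows "(deriv ^^ k) u t = 0"
  using assms(2)
proof (induction k arbitrary: t)
  case (Suc k)
  have "((deriv ^^ k) u has_real_derivative 0) (at t)"
    by (rule has_field_derivative_transform_within_open[where f = "\<lambda>_. 0" and S = "- {a..b}"])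
       (use Suc in auto)
  then show ?case by (simp add: DERIV_imp_deriv)
qed (use assms in simp)

lemma tensor_deriv_eq_0:
  assumes "tensor_test u a b" "x \<notin> cbox a b"
  shows "tensor_deriv \<alpha> u x = 0"
proof -
  obtain i where "x $ i \<notin> {a $ i..b $ i}"
    using assms(2) by (auto simp: mem_box_cart)
  with assms(1) have "(deriv ^^ \<alpha> i) (u i) (x $ i) = 0"
    by (intro deriv_iter_eq_0[of "a $ i" "b $ i"]) (auto simp: tensor_test_def)
  then show ?thesis
    unfolding tensor_deriv_def tensor_def by (intro prod_zero) auto
qed

lemma tensor_deriv_0: "tensor_deriv (\<lambda>_. 0) u = tensor u"
  by (simp add: tensor_deriv_def)

lemma tensor_test_imp_test_function:
  assumes "tensor_test u a b"
  shows "test_function (tensor u)"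
proof -
  have "{x. tensor u x \<noteq> 0} \<subseteq> cbox a b"
    using tensor_deriv_eq_0[OF assms, of _ "\<lambda>_. 0"] by (auto simp: tensor_deriv_0)
  then have "bounded {x. tensor u x \<noteq> 0}"
    using bounded_cbox bounded_subset by blast
  then show ?thesis
    using assms by (auto simp: test_function_def tensor_test_def intro: smooth_tensor)
qed

lemma deriv_iter_shift:
  fixes u :: "real \<Rightarrow> real"
  assumes "smooth1 u"
  shows "(deriv ^^ k) (\<lambda>t. u (t - c)) = (\<lambda>t. (deriv ^^ k) u (t - c))"
proof (induction k)
  case (Suc k)
  have "((\<lambda>t. (deriv ^^ k) u (t - c)) has_real_derivative deriv ((deriv ^^ k) u) (t - c)) (at t)" for t
    using assms DERIV_chain2[of "(deriv ^^ k) u" _ "\<lambda>t. t - c" t 1 UNIV]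
    by (force simp: smooth1_def DERIV_deriv_iff_field_differentiable[symmetric]
        intro: derivative_eq_intros)
  then show ?case by (auto simp: Suc intro: DERIV_imp_deriv)
qed simp

lemma tensor_test_shift:
  assumes "tensor_test u a b"
  shows "tensor_test (\<lambda>i t. u i (t - v $ i)) (a + v) (b + v)"
    and "tensor_deriv \<alpha> (\<lambda>i t. u i (t - v $ i)) x = tensor_deriv \<alpha> u (x - v)"
proof -
  have s: "smooth1 (u i)" for i using assms by (auto simp: tensor_test_def)
  have "(\<lambda>t. (deriv ^^ k) (u i) (t - c)) field_differentiable at t" for i k c t
  proof -
    have "((\<lambda>t. (deriv ^^ k) (u i) (t - c)) has_real_derivative deriv ((deriv ^^ k) (u i)) (t - c)) (at t)"
      using s[of i] DERIV_chain2[of "(deriv ^^ k) (u i)" _ "\<lambda>t. t - c" t 1 UNIV]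
      by (force simp: smooth1_def DERIV_deriv_iff_field_differentiable[symmetric]
          intro: derivative_eq_intros)
    then show ?thesis by (auto simp: field_differentiable_def)
  qed
  then have "smooth1 (\<lambda>t. u i (t - c))" for i c
    by (auto simp: smooth1_def deriv_iter_shift[OF s])
  then show "tensor_test (\<lambda>i t. u i (t - v $ i)) (a + v) (b + v)"
    using assms by (auto simp: tensor_test_def)
  show "tensor_deriv \<alpha> (\<lambda>i t. u i (t - v $ i)) x = tensor_deriv \<alpha> u (x - v)"
    unfolding tensor_deriv_def tensor_def deriv_iter_shift[OF s] by simp
qed

section \<open>Uniqueness of functions tested against tensor products\<close>

text \<open>Local integrability of a Borel function with respect to \<open>lborel\<close>. The joint measurability
needed for Fubini's theorem is automatic for Borel functions, but not for functions that are only
measurable with respect to the completed measure.\<close>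

definition loc_int :: "(real ^ 'n::finite \<Rightarrow> real) \<Rightarrow> bool"
  where "loc_int g \<longleftrightarrow> g \<in> borel_measurable borel \<and>
    (\<forall>a b. integrable lborel (\<lambda>x. indicator (cbox a b) x * g x))"

lemma loc_int_borel: "loc_int g \<Longrightarrow> g \<in> borel_measurable borel"
  by (simp add: loc_int_def)

lemma loc_int_mult_integrable:
  fixes g :: "real ^ 'n::finite \<Rightarrow> real"
  assumes "loc_int g" and [measurable]: "\<psi> \<in> borel_measurable borel"
    and "\<And>x. \<bar>\<psi> x\<bar> \<le> C" "\<And>x. x \<notin> cbox a b \<Longrightarrow> \<psi> x = 0"
  shows "integrable lborel (\<lambda>x. g x * \<psi> x)"
proof (rule Bochner_Integration.integrable_bound)
  show "integrable lborel (\<lambda>x. C * (indicator (cbox a b) x * g x))"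
    using assms(1) by (simp add: loc_int_def)
  show "AE x in lborel. norm (g x * \<psi> x) \<le> norm (C * (indicator (cbox a b) x * g x))"
  proof (intro AE_I2)
    fix x
    have "C \<ge> 0" using assms(3)[of x] by linarith
    then show "norm (g x * \<psi> x) \<le> norm (C * (indicator (cbox a b) x * g x))"
      using assms(3)[of x] assms(4)[of x]
      by (cases "x \<in> cbox a b") (auto simp: abs_mult mult.commute intro: mult_mono)
  qed
qed (use loc_int_borel[OF assms(1)] in measurable)

lemma tensor_bump_tendsto_indicator:
  "(\<lambda>n. tensor (\<lambda>i. bump n (a $ i) (b $ i)) x) \<longlonglongrightarrow> indicator (box a b) x"
proof -
  have "indicator (box a b) x = (\<Prod>i\<in>UNIV. indicator {a $ i<..<b $ i} (x $ i) :: real)"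
    by (cases "x \<in> box a b") (auto simp: mem_box_cart indicator_def intro!: prod_zero[symmetric])
  moreover have "(\<lambda>n. \<Prod>i\<in>UNIV. bump n (a $ i) (b $ i) (x $ i))
      \<longlonglongrightarrow> (\<Prod>i\<in>UNIV. indicator {a $ i<..<b $ i} (x $ i))"
    by (intro tendsto_prod bump_tendsto_indicator)
  ultimately show ?thesis by (simp add: tensor_def)
qed

lemma tensor_test_bump: "tensor_test (\<lambda>i. bump n (a $ i) (b $ i)) a b"
  by (auto simp: tensor_test_def smooth1_bump intro: bump_eq_0)

lemma tensor_bump_bounds: "\<bar>tensor (\<lambda>i. bump n (a $ i) (b $ i)) x\<bar> \<le> indicator (cbox a b) x"
proof (cases "x \<in> cbox a b")
  case True
  have "0 \<le> tensor (\<lambda>i. bump n (a $ i) (b $ i)) x" "tensor (\<lambda>i. bump n (a $ i) (b $ i)) x \<le> 1"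
    unfolding tensor_def by (auto intro!: prod_nonneg prod_le_1 bump_nonneg bump_le_1)
  with True show ?thesis by simp
next
  case False
  then show ?thesis
    using tensor_deriv_eq_0[OF tensor_test_bump, of x a b "\<lambda>_. 0" n] by (simp add: tensor_deriv_0)
qed

lemma tensor_deriv_borel:
  assumes "tensor_test u a b"
  shows "tensor_deriv \<alpha> u \<in> borel_measurable borel"
  using assms by (intro borel_measurable_continuous_onI continuous_on_tensor_deriv)
    (auto simp: tensor_test_def)

lemma enn2real_inj_finite: "x \<noteq> \<infinity> \<Longrightarrow> y \<noteq> \<infinity> \<Longrightarrow> enn2real x = enn2real y \<Longrightarrow> x = y"
  by (metis ennreal_enn2real infinity_ennreal_def less_top)

text \<open>Tensor products of bumps converge boundedly to indicators of boxes, so \<open>g\<close> has integral 0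
over every box. The measures with densities \<open>g\<^sup>+\<close> and \<open>g\<^sup>-\<close> therefore agree on boxes, a generator
of the Borel sets that is closed under intersection, and so their densities agree.\<close>

lemma AE_zero_if_tensor_tests_vanish:
  fixes g :: "real ^ 'n::finite \<Rightarrow> real"
  assumes g: "loc_int g"
    and test: "\<And>u a b. tensor_test u a b \<Longrightarrow> (\<integral>x. g x * tensor u x \<partial>lborel) = 0"
  shows "AE x in lborel. g x = 0"
proof -
  note [measurable] = loc_int_borel[OF g]
  have int: "integrable lborel (\<lambda>x. indicator (box a b) x * g x)" for a b
    by (rule Bochner_Integration.integrable_bound[where f="\<lambda>x. indicator (cbox a b) x * g x"])
       (use g box_subset_cbox[of a b] in \<open>auto simp: loc_int_def indicator_def\<close>)
  have box: "(\<integral>x. indicator (box a b) x * g x \<partial>lborel) = 0" for a b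
  proof (rule LIMSEQ_unique)
    let ?\<phi> = "\<lambda>n. tensor (\<lambda>i. bump n (a $ i) (b $ i))"
    show "(\<lambda>n. \<integral>x. g x * ?\<phi> n x \<partial>lborel) \<longlonglongrightarrow> (\<integral>x. indicator (box a b) x * g x \<partial>lborel)"
    proof (rule integral_dominated_convergence)
      show "integrable lborel (\<lambda>x. \<bar>indicator (cbox a b) x * g x\<bar>)"
        using g by (auto simp: loc_int_def)
      show "AE x in lborel. (\<lambda>n. g x * ?\<phi> n x) \<longlonglongrightarrow> indicator (box a b) x * g x"
        by (subst mult.commute) (intro AE_I2 tendsto_mult tendsto_const tensor_bump_tendsto_indicator)
      show "AE x in lborel. norm (g x * ?\<phi> n x) \<le> \<bar>indicator (cbox a b) x * g x\<bar>" for n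
      proof (intro AE_I2)
        fix x
        show "norm (g x * ?\<phi> n x) \<le> \<bar>indicator (cbox a b) x * g x\<bar>"
          using mult_right_mono[OF tensor_bump_bounds[of n a b x], of "\<bar>g x\<bar>"]
          by (simp add: abs_mult mult.commute)
      qed
      have [measurable]: "?\<phi> n \<in> borel_measurable borel" for n
        using tensor_deriv_borel[OF tensor_test_bump, of "\<lambda>_. 0" n a b] by (simp add: tensor_deriv_0)
      show "(\<lambda>x. g x * ?\<phi> n x) \<in> borel_measurable lborel" for n by measurable
    qed measurable
    show "(\<lambda>n. \<integral>x. g x * ?\<phi> n x \<partial>lborel) \<longlonglongrightarrow> 0"
      using test[OF tensor_test_bump] by simp
  qed
  have em: "emeasure (density lborel (\<lambda>x. ennreal (s * g x))) (box a b)
      = (\<integral>\<^sup>+x. ennreal (s * (indicator (box a b) x * g x)) \<partial>lborel)" for s a b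
    by (subst emeasure_density) (auto intro!: nn_integral_cong simp: indicator_def)
  have "density lborel (\<lambda>x. ennreal (1 * g x)) = density lborel (\<lambda>x. ennreal (- 1 * g x))"
  proof (rule measure_eqI_generator_eq[where E = "range (\<lambda>(a, b). box a b)" and \<Omega> = UNIV
        and A = "\<lambda>n. box (- (real n *\<^sub>R One)) (real n *\<^sub>R One)"])
    show "Int_stable (range (\<lambda>(a, b). box a b :: (real ^ 'n) set))"
      by (auto simp: Int_stable_def box_Int_box)
    fix X assume "X \<in> range (\<lambda>(a, b). box a b :: (real ^ 'n) set)"
    then obtain a b where X: "X = box a b" by auto
    let ?P = "\<integral>\<^sup>+x. ennreal (1 * (indicator (box a b) x * g x)) \<partial>lborel"
    let ?N = "\<integral>\<^sup>+x. ennreal (- 1 * (indicator (box a b) x * g x)) \<partial>lborel"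
    have "?P \<noteq> \<infinity>" "?N \<noteq> \<infinity>" using int[of a b] by (auto simp: real_integrable_def)
    moreover have "enn2real ?P = enn2real ?N"
      using box[of a b] real_lebesgue_integral_def[OF int[of a b]] by simp
    ultimately have "?P = ?N"
      by (intro enn2real_inj_finite)
    then show "emeasure (density lborel (\<lambda>x. ennreal (1 * g x))) X =
        emeasure (density lborel (\<lambda>x. ennreal (- 1 * g x))) X"
      unfolding X em .
  next
    show "(\<Union>n. box (- (real n *\<^sub>R One)) (real n *\<^sub>R One :: real ^ 'n)) = UNIV"
      by (rule UN_box_eq_UNIV)
    show "emeasure (density lborel (\<lambda>x. ennreal (1 * g x))) (box (- (real n *\<^sub>R One)) (real n *\<^sub>R One)) \<noteq> \<infinity>" for n
      unfolding em using int by (auto simp: real_integrable_def)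
  qed (auto simp: borel_eq_box)
  then have "AE x in lborel. ennreal (1 * g x) = ennreal (- 1 * g x)"
    by (intro sigma_finite_measure.density_unique[OF sigma_finite_lborel]) auto
  then show ?thesis
  proof eventually_elim
    case (elim x)
    then show ?case
      by (cases "g x \<ge> 0") (auto simp: ennreal_neg)
  qed
qed

section \<open>Translations, and Taylor's formula for tensor products\<close>

lemma integral_translate:
  fixes F :: "real ^ 'n::finite \<Rightarrow> real"
  assumes [measurable]: "F \<in> borel_measurable borel"
  shows "(\<integral>y. F (y + v) \<partial>lborel) = (\<integral>y. F y \<partial>lborel)"
  by (subst (2) lborel_distr_plus[of v, symmetric], subst integral_distr) (auto simp: add.commute)

lemma integrable_translate:
  fixes F :: "real ^ 'n::finite \<Rightarrow> real"
  assumes [measurable]: "F \<in> borel_measurable borel"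
  shows "integrable lborel (\<lambda>y. F (y + v)) \<longleftrightarrow> integrable lborel F"
  by (subst (2) lborel_distr_plus[of v, symmetric], subst integrable_distr_eq) (auto simp: add.commute)

lemma nn_integral_translate:
  fixes F :: "real ^ 'n::finite \<Rightarrow> ennreal"
  assumes [measurable]: "F \<in> borel_measurable borel"
  shows "(\<integral>\<^sup>+y. F (y + v) \<partial>lborel) = (\<integral>\<^sup>+y. F y \<partial>lborel)"
  by (subst (2) lborel_distr_plus[of v, symmetric], subst nn_integral_distr) (auto simp: add.commute)

text \<open>For \<open>g \<alpha> = D\<^sup>\<alpha> f\<close> this is \<open>D\<^sup>k f(y)(h,\<dots>,h)\<close>, written as a sum over tuples of coordinates.
Compared with a sum over multi-indices, one differentiation in direction \<open>h\<close> simply lengthens the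
tuples by one entry and no multinomial coefficients appear.\<close>

definition dir_form :: "(('n::finite \<Rightarrow> nat) \<Rightarrow> real ^ 'n \<Rightarrow> real) \<Rightarrow> nat \<Rightarrow> real ^ 'n \<Rightarrow> real ^ 'n \<Rightarrow> real"
  where "dir_form g k y h =
    (\<Sum>is | length is = k. (\<Prod>j<k. h $ (is ! j)) * g (count_list is) y)"

text \<open>The step \<open>k \<rightarrow> k + 1\<close> of the directional derivative.\<close>

lemma sum_lists_Suc:
  fixes F :: "'n::finite list \<Rightarrow> 'b::comm_monoid_add"
  shows "(\<Sum>is | length is = Suc k. F is) = (\<Sum>is | length is = k. \<Sum>i\<in>UNIV. F (i # is))"
proof -
  have "{is :: 'n list. length is = Suc k} = (\<lambda>(i, is). i # is) ` (UNIV \<times> {is. length is = k})"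
    by (auto simp: length_Suc_conv image_iff)
  then have "(\<Sum>is | length is = Suc k. F is) = (\<Sum>(i, is)\<in>UNIV \<times> {is. length is = k}. F (i # is))"
    by (simp add: sum.reindex inj_on_def case_prod_unfold)
  also have "\<dots> = (\<Sum>i\<in>UNIV. \<Sum>is | length is = k. F (i # is))"
    by (simp add: sum.cartesian_product)
  finally show ?thesis by (subst sum.swap)
qed

lemma mi_size_count_list: "mi_size (count_list is) = length is"
proof (induction "is")
  case (Cons a xs)
  have "count_list (a # xs) = (\<lambda>i. count_list xs i + (if i = a then 1 else 0))" by auto
  then show ?case using Cons by (simp add: mi_size_def sum.distrib del: count_list.simps)
qed (simp add: mi_size_def)

lemma dir_form_scale: "dir_form g k y (c *\<^sub>R h) = c ^ k * dir_form g k y h"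
  unfolding dir_form_def sum_distrib_left
  by (intro sum.cong) (auto simp: prod.distrib)

text \<open>The one-dimensional Taylor formula for \<open>t \<mapsto> tensor u (y + t v)\<close>, whose j-th derivative is
\<open>dir_form\<close> of order \<open>j\<close> by the chain rule.\<close>

lemma tensor_taylor:
  fixes v :: "real ^ 'n::finite"
  assumes u: "tensor_test u a b" and "k > 0"
  shows "tensor u (y + v) = (\<Sum>j<k. 1 / fact j * dir_form (\<lambda>\<alpha>. tensor_deriv \<alpha> u) j y v)
     + (\<integral>t. (indicator {0..1} t * (1 - t) ^ (k - 1) / fact (k - 1)) *
          dir_form (\<lambda>\<alpha>. tensor_deriv \<alpha> u) k (y + t *\<^sub>R v) v \<partial>lborel)"
proof -
  let ?D = "\<lambda>\<alpha>. tensor_deriv \<alpha> u"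
  have s: "smooth1 (u i)" for i using u by (simp add: tensor_test_def)
  define F where "F j t = dir_form ?D j (y + t *\<^sub>R v) v" for j t
  have "(F j has_vector_derivative F (Suc j) t) (at t within {0..1})" for j t
  proof -
    have *: "((\<lambda>t. ?D \<alpha> (y + t *\<^sub>R v)) has_vector_derivative
        (\<Sum>i\<in>UNIV. v $ i * ?D (\<alpha>(i := Suc (\<alpha> i))) (y + t *\<^sub>R v))) (at t within {0..1})" for \<alpha>
    proof -
      have "((\<lambda>t. y + t *\<^sub>R v) has_derivative (\<lambda>s. s *\<^sub>R v)) (at t within {0..1})"
        by (auto intro!: derivative_eq_intros)
      from has_derivative_compose[OF this tensor_deriv_has_derivative[OF s]]
      show ?thesis
        by (simp add: has_vector_derivative_def sum_distrib_left mult.assoc)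
    qed
    have "(F j has_vector_derivative (\<Sum>is | length is = j. (\<Prod>l<j. v $ (is ! l)) *
        (\<Sum>i\<in>UNIV. v $ i * ?D ((count_list is)(i := Suc (count_list is i))) (y + t *\<^sub>R v)))) (at t within {0..1})"
      unfolding F_def dir_form_def
      by (intro has_vector_derivative_sum has_vector_derivative_mult_right *)
    also have "(\<Sum>is | length is = j. (\<Prod>l<j. v $ (is ! l)) *
        (\<Sum>i\<in>UNIV. v $ i * ?D ((count_list is)(i := Suc (count_list is i))) (y + t *\<^sub>R v))) = F (Suc j) t"
    proof -
      have "count_list (i # is) = (count_list is)(i := Suc (count_list is i))" for i :: 'n and "is"
        by auto
      then show ?thesis
        unfolding F_def dir_form_def sum_lists_Suc prod.lessThan_Suc_shift
        by (simp add: sum_distrib_left mult_ac del: count_list.simps fun_upd_apply)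
    qed
    finally show ?thesis .
  qed
  note deriv = this
  let ?i = "\<lambda>t. ((1 - t) ^ (k - 1) / fact (k - 1)) *\<^sub>R F k t"
  have "F 0 1 = (\<Sum>i<k. ((1 - 0) ^ i / fact i) *\<^sub>R F i 0) + integral {0..1} ?i"
    by (rule Taylor_integral) (use deriv \<open>k > 0\<close> in auto)
  also have "integral {0..1} ?i = (\<integral>t. indicator {0..1} t *\<^sub>R ?i t \<partial>lborel)"
  proof -
    have "continuous_on {0..1} (F k)"
      using deriv by (meson continuous_on_vector_derivative)
    then have "set_integrable lborel {0..1} ?i"
      by (intro borel_integrable_atLeastAtMost' continuous_intros) auto
    then show ?thesis
      by (simp add: set_borel_integral_eq_integral(2)[symmetric] set_lebesgue_integral_def)
  qed
  also have "F 0 1 = tensor u (y + v)"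
    by (simp add: F_def dir_form_def tensor_deriv_def)
  finally show ?thesis
    by (simp add: F_def mult.assoc)
qed

section \<open>Integrability of a function over its translates along a segment\<close>

text \<open>As \<open>t\<close> runs through the unit interval, the supports of the translates of \<open>\<psi>\<close> stay in one box,
so the integrand is dominated by a product of an integrable function of \<open>t\<close> and one of \<open>y\<close>.\<close>

lemma integrable_translates_right:
  fixes q \<psi> :: "real ^ 'n::finite \<Rightarrow> real"
  assumes q: "loc_int q" and [measurable]: "\<psi> \<in> borel_measurable borel" "w \<in> borel_measurable borel"
    and \<psi>: "\<And>x. \<bar>\<psi> x\<bar> \<le> C" "\<And>x. x \<notin> cbox a b \<Longrightarrow> \<psi> x = 0"
    and w: "\<And>t::real. \<bar>w t\<bar> \<le> indicator {0..1} t"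
  shows "integrable (lborel \<Otimes>\<^sub>M lborel) (\<lambda>(t, y). w t * (q y * \<psi> (y - t *\<^sub>R h)))"
proof -
  note [measurable] = loc_int_borel[OF q]
  have "compact ((\<lambda>(z, t). z + t *\<^sub>R h) ` (cbox a b \<times> {0..1}))"
    by (intro compact_continuous_image compact_Times)
       (auto intro!: continuous_intros simp: case_prod_unfold)
  then obtain c where c: "(\<lambda>(z, t). z + t *\<^sub>R h) ` (cbox a b \<times> {0..1}) \<subseteq> cbox (- c) c"
    using bounded_subset_cbox_symmetric compact_imp_bounded by meson
  have C: "C \<ge> 0" using \<psi>(1)[of 0] by linarith
  have le: "\<bar>w t * (q y * \<psi> (y - t *\<^sub>R h))\<bar> \<le> indicator {0..1} t * (C * \<bar>indicator (cbox (- c) c) y * q y\<bar>)" for t y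
  proof (cases "t \<in> {0..1} \<and> y - t *\<^sub>R h \<in> cbox a b")
    case True
    then have "y \<in> cbox (- c) c"
      using c by (force simp: image_subset_iff)
    moreover have "\<bar>w t\<bar> * (\<bar>q y\<bar> * \<bar>\<psi> (y - t *\<^sub>R h)\<bar>) \<le> 1 * (\<bar>q y\<bar> * C)"
      using w[of t] True by (intro mult_mono \<psi>) auto
    ultimately show ?thesis
      using True by (simp add: abs_mult mult_ac)
  next
    case False
    then have "w t * \<psi> (y - t *\<^sub>R h) = 0"
      using w[of t] \<psi>(2)[of "y - t *\<^sub>R h"] by (auto simp: indicator_def split: if_splits)
    then show ?thesis using C by auto
  qed
  have fin: "integrable lborel (\<lambda>y. C * \<bar>indicator (cbox (- c) c) y * q y\<bar>)"
    using q by (auto simp: loc_int_def)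
  show ?thesis
  proof (rule Bochner_Integration.integrable_bound)
    show "integrable (lborel \<Otimes>\<^sub>M lborel)
      (\<lambda>(t::real, y). indicator {0..1} t * (C * \<bar>indicator (cbox (- c) c) y * q y\<bar>))"
    proof (rule lborel_pair.Fubini_integrable)
      show "integrable lborel (\<lambda>t::real. \<integral>y. norm (case (t, y) of (t, y) \<Rightarrow>
          indicator {0..1} t * (C * \<bar>indicator (cbox (- c) c) y * q y\<bar>)) \<partial>lborel)"
        using C by (simp add: abs_mult)
      show "AE t::real in lborel. integrable lborel (\<lambda>y. case (t, y) of (t, y) \<Rightarrow>
          indicator {0..1} t * (C * \<bar>indicator (cbox (- c) c) y * q y\<bar>))"
        using fin by simp
    qed measurable
    show "AE x in lborel \<Otimes>\<^sub>M lborel. norm (case x of (t, y) \<Rightarrow> w t * (q y * \<psi> (y - t *\<^sub>R h)))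
      \<le> norm (case x of (t::real, y) \<Rightarrow> indicator {0..1} t * (C * \<bar>indicator (cbox (- c) c) y * q y\<bar>))"
      using le C by (auto simp: abs_mult)
  qed measurable
qed

text \<open>For each \<open>t\<close> the translation can be moved from \<open>\<psi>\<close> to \<open>q\<close> without changing the integral in
\<open>y\<close>, which reduces this to the previous lemma.\<close>

lemma integrable_translates_left:
  fixes q \<psi> :: "real ^ 'n::finite \<Rightarrow> real"
  assumes q: "loc_int q" and [measurable]: "\<psi> \<in> borel_measurable borel" "w \<in> borel_measurable borel"
    and \<psi>: "\<And>x. \<bar>\<psi> x\<bar> \<le> C" "\<And>x. x \<notin> cbox a b \<Longrightarrow> \<psi> x = 0"
    and w: "\<And>t::real. \<bar>w t\<bar> \<le> indicator {0..1} t"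
  shows "integrable (lborel \<Otimes>\<^sub>M lborel) (\<lambda>(t, y). w t * (q (y + t *\<^sub>R h) * \<psi> y))"
proof (rule lborel_pair.Fubini_integrable)
  note [measurable] = loc_int_borel[OF q]
  have R: "integrable (lborel \<Otimes>\<^sub>M lborel) (\<lambda>(t, y). w t * (q y * \<psi> (y - t *\<^sub>R h)))"
    using \<psi> w by (rule integrable_translates_right[OF q assms(2,3)])
  have "(\<integral>y. norm (w t * (q (y + t *\<^sub>R h) * \<psi> y)) \<partial>lborel) =
      (\<integral>y. norm (w t * (q y * \<psi> (y - t *\<^sub>R h))) \<partial>lborel)" for t
    using integral_translate[of "\<lambda>y. norm (w t * (q y * \<psi> (y - t *\<^sub>R h)))" "t *\<^sub>R h"] by simp
  then show "integrable lborel (\<lambda>t. \<integral>y. norm (case (t, y) of (t, y) \<Rightarrow> w t * (q (y + t *\<^sub>R h) * \<psi> y)) \<partial>lborel)"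
    using lborel_pair.integrable_fst'[OF integrable_norm[OF R]] by simp
  show "AE t in lborel. integrable lborel (\<lambda>y. case (t, y) of (t, y) \<Rightarrow> w t * (q (y + t *\<^sub>R h) * \<psi> y))"
    using lborel_pair.AE_integrable_fst'[OF R]
  proof eventually_elim
    case (elim t)
    then show ?case
      using integrable_translate[of "\<lambda>y. w t * (q y * \<psi> (y - t *\<^sub>R h))" "t *\<^sub>R h"] by simp
  qed
qed (use loc_int_borel[OF q] in measurable)

section \<open>Taylor remainder of a weakly differentiable function\<close>

lemma mi_size_0: "mi_size (\<lambda>_. 0) = 0"
  by (simp add: mi_size_def)

lemma loc_int_add: "loc_int q \<Longrightarrow> loc_int r \<Longrightarrow> loc_int (\<lambda>y. q y + r y)"
  by (auto simp: loc_int_def distrib_left)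

lemma loc_int_cmult: "loc_int q \<Longrightarrow> loc_int (\<lambda>y. c * q y)"
  by (auto simp: loc_int_def mult.left_commute[of _ c])

lemma loc_int_sum: "(\<And>i. i \<in> I \<Longrightarrow> loc_int (q i)) \<Longrightarrow> loc_int (\<lambda>y. \<Sum>i\<in>I. q i y)"
  by (auto simp: loc_int_def sum_distrib_left intro!: borel_measurable_sum)

lemma tensor_deriv_bounded:
  assumes "tensor_test u a b"
  obtains C where "\<And>x. \<bar>tensor_deriv \<alpha> u x\<bar> \<le> C"
proof -
  have "compact (tensor_deriv \<alpha> u ` cbox a b)"
    using assms by (intro compact_continuous_image continuous_on_tensor_deriv) (auto simp: tensor_test_def)
  then obtain B where B: "\<forall>y\<in>tensor_deriv \<alpha> u ` cbox a b. norm y \<le> B"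
    using compact_imp_bounded bounded_iff by metis
  show thesis
  proof
    fix x
    show "\<bar>tensor_deriv \<alpha> u x\<bar> \<le> \<bar>B\<bar>"
      using B tensor_deriv_eq_0[OF assms, of x \<alpha>] by (cases "x \<in> cbox a b") force+
  qed
qed

lemma integrable_tensor_deriv:
  assumes "loc_int q" "tensor_test u a b"
  shows "integrable lborel (\<lambda>y. q y * tensor_deriv \<alpha> u y)"
proof -
  obtain C where "\<And>x. \<bar>tensor_deriv \<alpha> u x\<bar> \<le> C" using tensor_deriv_bounded[OF assms(2)] by blast
  with assms show ?thesis
    by (intro loc_int_mult_integrable[where a=a and b=b and C=C] tensor_deriv_borel[OF assms(2)] tensor_deriv_eq_0[OF assms(2)])
qed

lemma loc_int_translate:
  assumes "loc_int q"
  shows "loc_int (\<lambda>y. q (y + v))"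
  unfolding loc_int_def
proof (intro conjI allI)
  note [measurable] = loc_int_borel[OF assms]
  show "(\<lambda>y. q (y + v)) \<in> borel_measurable borel" by measurable
  fix a b :: "real ^ 'a"
  have "indicator (cbox a b) y = (indicator (cbox (a + v) (b + v)) (y + v) :: real)" for y
    by (auto simp: indicator_def mem_box_cart)
  then show "integrable lborel (\<lambda>x. indicator (cbox a b) x * q (x + v))"
    using integrable_translate[of "\<lambda>x. indicator (cbox (a + v) (b + v)) x * q x" v] assms
    by (simp add: loc_int_def)
qed

text \<open>The family \<open>g\<close> consists of Borel representatives of the weak derivatives \<open>D\<^sup>\<alpha> f\<close>, and the function
\<open>f\<close> itself is the member \<open>g (\<lambda>_. 0)\<close>.\<close>

locale weak_derivatives =
  fixes m :: nat and g :: "('n::finite \<Rightarrow> nat) \<Rightarrow> real ^ 'n \<Rightarrow> real"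
  assumes loc_int_g: "mi_size \<alpha> \<le> m \<Longrightarrow> loc_int (g \<alpha>)"
    and weak: "mi_size \<alpha> \<le> m \<Longrightarrow> tensor_test u a b \<Longrightarrow>
      (\<integral>x. g (\<lambda>_. 0) x * tensor_deriv \<alpha> u x \<partial>lborel) =
        (- 1) ^ mi_size \<alpha> * (\<integral>x. g \<alpha> x * tensor u x \<partial>lborel)"
begin

lemma loc_int_dir_form: "k \<le> m \<Longrightarrow> loc_int (\<lambda>y. dir_form g k y h)"
  unfolding dir_form_def
  by (intro loc_int_sum loc_int_cmult loc_int_g) (simp add: mi_size_count_list)

text \<open>A translate of a tensor test function is again one, so translations pass through the
definition of the weak derivative.\<close>

lemma weak_translate:
  assumes "mi_size \<alpha> \<le> m" and u: "tensor_test u a b"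
  shows "(\<integral>y. g (\<lambda>_. 0) y * tensor_deriv \<alpha> u (y - v) \<partial>lborel) =
    (- 1) ^ mi_size \<alpha> * (\<integral>y. g \<alpha> (y + v) * tensor u y \<partial>lborel)"
proof -
  have [measurable]: "g \<alpha> \<in> borel_measurable borel" "tensor u \<in> borel_measurable borel"
    using loc_int_borel[OF loc_int_g[OF assms(1)]] tensor_deriv_borel[OF u, of "\<lambda>_. 0"]
    by (auto simp: tensor_deriv_0)
  let ?u = "\<lambda>i t. u i (t - v $ i)"
  have "(\<integral>y. g (\<lambda>_. 0) y * tensor_deriv \<alpha> u (y - v) \<partial>lborel) =
      (\<integral>y. g (\<lambda>_. 0) y * tensor_deriv \<alpha> ?u y \<partial>lborel)"
    by (simp add: tensor_test_shift(2)[OF u])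
  also have "\<dots> = (- 1) ^ mi_size \<alpha> * (\<integral>y. g \<alpha> y * tensor ?u y \<partial>lborel)"
    by (rule weak[OF assms(1) tensor_test_shift(1)[OF u]])
  also have "(\<integral>y. g \<alpha> y * tensor ?u y \<partial>lborel) = (\<integral>y. g \<alpha> y * tensor u (y - v) \<partial>lborel)"
    using tensor_test_shift(2)[OF u, of "\<lambda>_. 0" v] by (simp add: tensor_deriv_0)
  also have "\<dots> = (\<integral>y. g \<alpha> (y + v) * tensor u y \<partial>lborel)"
    using integral_translate[of "\<lambda>y. g \<alpha> y * tensor u (y - v)" v] by simp
  finally show ?thesis .
qed

lemma weak_dir_form:
  assumes "k \<le> m" and u: "tensor_test u a b"
  shows "integrable lborel (\<lambda>y. g (\<lambda>_. 0) y * dir_form (\<lambda>\<alpha>. tensor_deriv \<alpha> u) k (y - v) h)"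
    and "(\<integral>y. g (\<lambda>_. 0) y * dir_form (\<lambda>\<alpha>. tensor_deriv \<alpha> u) k (y - v) h \<partial>lborel) =
    (- 1) ^ k * (\<integral>y. dir_form g k (y + v) h * tensor u y \<partial>lborel)"
proof -
  let ?c = "\<lambda>is. \<Prod>j<k. h $ (is ! j)"
  have i1: "integrable lborel (\<lambda>y. g (\<lambda>_. 0) y * tensor_deriv \<alpha> u (y - v))" for \<alpha>
    using integrable_tensor_deriv[OF loc_int_g tensor_test_shift(1)[OF u], of "\<lambda>_. 0" \<alpha> v]
      tensor_test_shift(2)[OF u] by (simp add: mi_size_0)
  have i2: "integrable lborel (\<lambda>y. g (count_list is) (y + v) * tensor u y)" if "length is = k" for "is"
    using integrable_tensor_deriv[OF loc_int_translate[OF loc_int_g] u, of "count_list is" v "\<lambda>_. 0"] that assms(1)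
    by (simp add: mi_size_count_list tensor_deriv_0)
  have eq: "(\<lambda>y. g (\<lambda>_. 0) y * dir_form (\<lambda>\<alpha>. tensor_deriv \<alpha> u) k (y - v) h) =
    (\<lambda>y. \<Sum>is | length is = k. ?c is * (g (\<lambda>_. 0) y * tensor_deriv (count_list is) u (y - v)))"
    by (simp add: dir_form_def sum_distrib_left mult_ac)
  show "integrable lborel (\<lambda>y. g (\<lambda>_. 0) y * dir_form (\<lambda>\<alpha>. tensor_deriv \<alpha> u) k (y - v) h)"
    unfolding eq by (intro Bochner_Integration.integrable_sum integrable_mult_right i1)
  have "(\<integral>y. g (\<lambda>_. 0) y * dir_form (\<lambda>\<alpha>. tensor_deriv \<alpha> u) k (y - v) h \<partial>lborel) =
      (\<Sum>is | length is = k. ?c is * (\<integral>y. g (\<lambda>_. 0) y * tensor_deriv (count_list is) u (y - v) \<partial>lborel))"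
    unfolding eq by (subst Bochner_Integration.integral_sum) (auto intro!: integrable_mult_right i1)
  also have "\<dots> = (\<Sum>is | length is = k. ?c is * ((- 1) ^ k * (\<integral>y. g (count_list is) (y + v) * tensor u y \<partial>lborel)))"
    using assms(1) by (intro sum.cong refl) (auto simp: weak_translate[OF _ u] mi_size_count_list)
  also have "\<dots> = (- 1) ^ k * (\<integral>y. (\<Sum>is | length is = k. ?c is * (g (count_list is) (y + v) * tensor u y)) \<partial>lborel)"
    by (subst Bochner_Integration.integral_sum)
       (auto intro!: integrable_mult_right i2 sum.cong simp: sum_distrib_left)
  also have "(\<lambda>y. \<Sum>is | length is = k. ?c is * (g (count_list is) (y + v) * tensor u y)) =
      (\<lambda>y. dir_form g k (y + v) h * tensor u y)"
    by (simp add: dir_form_def sum_distrib_left mult_ac)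
  finally show "(\<integral>y. g (\<lambda>_. 0) y * dir_form (\<lambda>\<alpha>. tensor_deriv \<alpha> u) k (y - v) h \<partial>lborel) =
    (- 1) ^ k * (\<integral>y. dir_form g k (y + v) h * tensor u y \<partial>lborel)" .
qed

end

lemma loc_int_average:
  fixes q :: "real ^ 'n::finite \<Rightarrow> real"
  assumes q: "loc_int q" and [measurable]: "w \<in> borel_measurable borel"
    and w: "\<And>t::real. \<bar>w t\<bar> \<le> indicator {0..1} t"
  shows "loc_int (\<lambda>y. \<integral>t. w t * q (y + t *\<^sub>R h) \<partial>lborel)"
  unfolding loc_int_def
proof (intro conjI allI)
  note [measurable] = loc_int_borel[OF q]
  show "(\<lambda>y. \<integral>t. w t * q (y + t *\<^sub>R h) \<partial>lborel) \<in> borel_measurable borel" by measurable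
  fix a b :: "real ^ 'n"
  have "integrable (lborel \<Otimes>\<^sub>M lborel) (\<lambda>(t, y). w t * (q (y + t *\<^sub>R h) * indicator (cbox a b) y))"
    by (rule integrable_translates_left[OF q _ _ _ _ w, where C = 1 and a = a and b = b]) auto
  from lborel_pair.integrable_snd[OF this]
  show "integrable lborel (\<lambda>x. indicator (cbox a b) x * (\<integral>t. w t * q (x + t *\<^sub>R h) \<partial>lborel))"
    by (simp add: mult_ac flip: integral_mult_right_zero)
qed

text \<open>The kernel of the integral form of the remainder of order \<open>k\<close>.\<close>

definition taylor_weight :: "nat \<Rightarrow> real \<Rightarrow> real"
  where "taylor_weight k t = indicator {0..1} t * (1 - t) ^ (k - 1) / fact (k - 1)"

lemma taylor_weight_borel [measurable]: "taylor_weight k \<in> borel_measurable borel"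
  unfolding taylor_weight_def by measurable

lemma taylor_weight_bound: "\<bar>taylor_weight k t\<bar> \<le> indicator {0..1} t"
proof -
  have "(1 - t) ^ (k - 1) / fact (k - 1) \<le> 1 / 1" if "t \<in> {0..1}"
    using that by (intro frac_le power_le_one) auto
  then show ?thesis by (auto simp: taylor_weight_def indicator_def abs_mult)
qed

context weak_derivatives
begin

definition remainder :: "real ^ 'n \<Rightarrow> real ^ 'n \<Rightarrow> real"
  where "remainder h y = g (\<lambda>_. 0) (y + h) - (\<Sum>j<m. 1 / fact j * dir_form g j y h)"

lemma remainder_representation:
  assumes "m > 0"
  shows "AE y in lborel. remainder h y = (\<integral>t. taylor_weight m t * dir_form g m (y + t *\<^sub>R h) h \<partial>lborel)"
proof -
  let ?w = "taylor_weight m"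
  let ?f = "g (\<lambda>_. 0)"
  let ?avg = "\<lambda>y. \<integral>t. ?w t * dir_form g m (y + t *\<^sub>R h) h \<partial>lborel"
  define r where "r y = remainder h y - ?avg y" for y
  note lm = loc_int_dir_form[of _ h]
  have l0: "loc_int ?f" by (rule loc_int_g) (simp add: mi_size_0)
  have lavg: "loc_int ?avg"
    by (rule loc_int_average) (use lm taylor_weight_bound in auto)
  have r_eq: "r = (\<lambda>y. (?f (y + h) + (\<Sum>j<m. (- 1 / fact j) * dir_form g j y h)) + (- 1) * ?avg y)"
    by (auto simp: r_def remainder_def fun_eq_iff sum_negf)
  have "loc_int r"
    unfolding r_eq using lm
    by (intro loc_int_add loc_int_cmult loc_int_sum loc_int_translate lavg l0) auto
  moreover have "(\<integral>y. r y * tensor u y \<partial>lborel) = 0" if u: "tensor_test u a b" for u a b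
  proof -
    let ?\<phi> = "tensor u"
    let ?D = "\<lambda>\<alpha>. tensor_deriv \<alpha> u"
    let ?S = "\<Sum>j<m. 1 / fact j * (\<integral>y. dir_form g j y h * ?\<phi> y \<partial>lborel)"
    have int_\<phi>: "integrable lborel (\<lambda>y. q y * ?\<phi> y)" if "loc_int q" for q
      using integrable_tensor_deriv[OF that u, of "\<lambda>_. 0"] by (simp add: tensor_deriv_0)
    have [measurable]: "?D \<alpha> \<in> borel_measurable borel" "?\<phi> \<in> borel_measurable borel" for \<alpha>
      using tensor_deriv_borel[OF u] tensor_deriv_borel[OF u, of "\<lambda>_. 0"] by (auto simp: tensor_deriv_0)
    let ?\<psi> = "\<lambda>y. dir_form ?D m y h"
    obtain C where C: "\<And>y. \<bar>?\<psi> y\<bar> \<le> C"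
    proof -
      have "\<exists>C. \<forall>x. \<bar>?D \<alpha> x\<bar> \<le> C" for \<alpha> using tensor_deriv_bounded[OF u] by metis
      then obtain B where B: "\<And>\<alpha> x. \<bar>?D \<alpha> x\<bar> \<le> B \<alpha>" by metis
      show thesis
        by (rule that, unfold dir_form_def, rule order_trans[OF sum_abs], rule sum_mono,
            unfold abs_mult, rule mult_left_mono[OF B]) simp
    qed
    have \<psi>0: "?\<psi> y = 0" if "y \<notin> cbox a b" for y
      using tensor_deriv_eq_0[OF u that] by (simp add: dir_form_def)
    have [measurable]: "?\<psi> \<in> borel_measurable borel"
      unfolding dir_form_def by measurable
    obtain C' where C': "\<And>y. \<bar>?\<phi> y\<bar> \<le> C'"
      using tensor_deriv_bounded[OF u, of "\<lambda>_. 0"] by (auto simp: tensor_deriv_0)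
    have \<phi>0: "?\<phi> y = 0" if "y \<notin> cbox a b" for y
      using tensor_deriv_eq_0[OF u that, of "\<lambda>_. 0"] by (simp add: tensor_deriv_0)
    have I1: "integrable (lborel \<Otimes>\<^sub>M lborel) (\<lambda>(t, y). ?w t * (?f y * ?\<psi> (y - t *\<^sub>R h)))"
      using C \<psi>0 taylor_weight_bound by (rule integrable_translates_right[OF l0, rotated 2]) measurable
    have I2: "integrable (lborel \<Otimes>\<^sub>M lborel) (\<lambda>(t, y). ?w t * (dir_form g m (y + t *\<^sub>R h) h * ?\<phi> y))"
      using C' \<phi>0 taylor_weight_bound by (rule integrable_translates_left[OF lm[OF order_refl], rotated 2]) measurable
    have taylor: "?f y * ?\<phi> (y - h) = (\<Sum>j<m. (1 / fact j * (- 1) ^ j) * (?f y * dir_form ?D j (y - 0) h))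
        + (- 1) ^ m * (\<integral>t. ?w t * (?f y * ?\<psi> (y - t *\<^sub>R h)) \<partial>lborel)" for y
    proof -
      have neg: "dir_form ?D j z (- h) = (- 1) ^ j * dir_form ?D j z h" for j z
        using dir_form_scale[of ?D j z "- 1" h] by simp
      have "?\<phi> (y + - h) = (\<Sum>j<m. 1 / fact j * dir_form ?D j y (- h))
          + (\<integral>t. ?w t * dir_form ?D m (y + t *\<^sub>R (- h)) (- h) \<partial>lborel)"
        using tensor_taylor[OF u assms, of y "- h"] by (simp add: taylor_weight_def)
      also have "(\<lambda>t. ?w t * dir_form ?D m (y + t *\<^sub>R (- h)) (- h)) = (\<lambda>t. (- 1) ^ m * (?w t * ?\<psi> (y - t *\<^sub>R h)))"
        by (auto simp: neg fun_eq_iff)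
      finally show ?thesis
        by (simp add: neg distrib_left sum_distrib_left mult_ac flip: integral_mult_right_zero)
    qed
    \<comment> \<open>The translation by \<open>h\<close> moves to the test function, is expanded there, and each term of the
      expansion is moved back; Fubini's theorem is used once on either side.\<close>
    have "(\<integral>y. ?f (y + h) * ?\<phi> y \<partial>lborel) = (\<integral>y. ?f y * ?\<phi> (y - h) \<partial>lborel)"
      using weak_translate[OF _ u, of "\<lambda>_. 0" h] by (simp add: mi_size_0 tensor_deriv_0)
    also have "\<dots> = (\<Sum>j<m. (1 / fact j * (- 1) ^ j) * (\<integral>y. ?f y * dir_form ?D j (y - 0) h \<partial>lborel))
        + (- 1) ^ m * (\<integral>y. (\<integral>t. ?w t * (?f y * ?\<psi> (y - t *\<^sub>R h)) \<partial>lborel) \<partial>lborel)"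
    proof -
      have i: "integrable lborel (\<lambda>y. ?f y * dir_form ?D j (y - 0) h)" if "j < m" for j
        using that by (intro weak_dir_form(1)[OF _ u]) auto
      then have s: "integrable lborel (\<lambda>y. \<Sum>j<m. (1 / fact j * (- 1) ^ j) * (?f y * dir_form ?D j (y - 0) h))"
        by (intro Bochner_Integration.integrable_sum integrable_mult_right) auto
      have av: "integrable lborel (\<lambda>y. (- 1) ^ m * (\<integral>t. ?w t * (?f y * ?\<psi> (y - t *\<^sub>R h)) \<partial>lborel))"
        by (intro integrable_mult_right lborel_pair.integrable_snd[OF I1])
      have "(\<integral>y. ?f y * ?\<phi> (y - h) \<partial>lborel) =
          (\<integral>y. (\<Sum>j<m. (1 / fact j * (- 1) ^ j) * (?f y * dir_form ?D j (y - 0) h)) \<partial>lborel)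
          + (\<integral>y. (- 1) ^ m * (\<integral>t. ?w t * (?f y * ?\<psi> (y - t *\<^sub>R h)) \<partial>lborel) \<partial>lborel)"
        unfolding taylor by (rule Bochner_Integration.integral_add[OF s av])
      also have "(\<integral>y. (\<Sum>j<m. (1 / fact j * (- 1) ^ j) * (?f y * dir_form ?D j (y - 0) h)) \<partial>lborel)
          = (\<Sum>j<m. \<integral>y. (1 / fact j * (- 1) ^ j) * (?f y * dir_form ?D j (y - 0) h) \<partial>lborel)"
        using i by (intro Bochner_Integration.integral_sum integrable_mult_right) auto
      finally show ?thesis
        by (simp only: integral_mult_right_zero)
    qed
    also have "(\<Sum>j<m. (1 / fact j * (- 1) ^ j) * (\<integral>y. ?f y * dir_form ?D j (y - 0) h \<partial>lborel)) = ?S"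
      by (intro sum.cong refl, subst weak_dir_form(2)[OF _ u]) (auto simp: power_mult_distrib[symmetric])
    also have "(\<integral>y. (\<integral>t. ?w t * (?f y * ?\<psi> (y - t *\<^sub>R h)) \<partial>lborel) \<partial>lborel)
        = (\<integral>t. (\<integral>y. ?w t * (?f y * ?\<psi> (y - t *\<^sub>R h)) \<partial>lborel) \<partial>lborel)"
      by (rule lborel_pair.Fubini_integral[OF I1])
    also have "\<dots> = (\<integral>t. (\<integral>y. (- 1) ^ m * (?w t * (dir_form g m (y + t *\<^sub>R h) h * ?\<phi> y)) \<partial>lborel) \<partial>lborel)"
      by (simp only: integral_mult_right_zero weak_dir_form(2)[OF order_refl u] mult.left_commute)
    also have "\<dots> = (- 1) ^ m * (\<integral>t. (\<integral>y. ?w t * (dir_form g m (y + t *\<^sub>R h) h * ?\<phi> y) \<partial>lborel) \<partial>lborel)"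
      by (simp only: integral_mult_right_zero)
    also have "(\<integral>t. (\<integral>y. ?w t * (dir_form g m (y + t *\<^sub>R h) h * ?\<phi> y) \<partial>lborel) \<partial>lborel)
        = (\<integral>y. (\<integral>t. ?w t * (dir_form g m (y + t *\<^sub>R h) h * ?\<phi> y) \<partial>lborel) \<partial>lborel)"
      by (rule lborel_pair.Fubini_integral[OF I2, symmetric])
    also have "\<dots> = (\<integral>y. ?avg y * ?\<phi> y \<partial>lborel)"
      by (simp only: mult.assoc[symmetric] integral_mult_left_zero)
    finally have A: "(\<integral>y. ?f (y + h) * ?\<phi> y \<partial>lborel) = ?S + (\<integral>y. ?avg y * ?\<phi> y \<partial>lborel)"
      by (simp add: power_mult_distrib[symmetric] mult.assoc[symmetric])
    have "(\<lambda>y. r y * ?\<phi> y) = (\<lambda>y. ?f (y + h) * ?\<phi> y - (\<Sum>j<m. 1 / fact j * (dir_form g j y h * ?\<phi> y)) - ?avg y * ?\<phi> y)"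
      by (simp add: r_def remainder_def algebra_simps sum_distrib_left)
    moreover have "integrable lborel (\<lambda>y. \<Sum>j<m. 1 / fact j * (dir_form g j y h * ?\<phi> y))"
      using lm by (intro Bochner_Integration.integrable_sum integrable_mult_right int_\<phi>) auto
    moreover have "integrable lborel (\<lambda>y. ?f (y + h) * ?\<phi> y)" and "integrable lborel (\<lambda>y. ?avg y * ?\<phi> y)"
      by (intro int_\<phi> loc_int_translate l0 lavg)+
    moreover have "(\<integral>y. (\<Sum>j<m. 1 / fact j * (dir_form g j y h * ?\<phi> y)) \<partial>lborel) =
        (\<Sum>j<m. \<integral>y. 1 / fact j * (dir_form g j y h * ?\<phi> y) \<partial>lborel)"
      using lm by (intro Bochner_Integration.integral_sum integrable_mult_right int_\<phi>) auto
    ultimately have "(\<integral>y. r y * ?\<phi> y \<partial>lborel) = (\<integral>y. ?f (y + h) * ?\<phi> y \<partial>lborel) - ?S - (\<integral>y. ?avg y * ?\<phi> y \<partial>lborel)"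
      by (simp only: Bochner_Integration.integral_diff Bochner_Integration.integrable_diff
          integral_mult_right_zero)
    with A show ?thesis by simp
  qed
  ultimately have "AE y in lborel. r y = 0"
    by (rule AE_zero_if_tensor_tests_vanish)
  then show ?thesis by eventually_elim (simp add: r_def)
qed

end

section \<open>Continuity of translations in the mean\<close>

definition L1_shift :: "(real ^ 'n::finite \<Rightarrow> real) \<Rightarrow> real ^ 'n \<Rightarrow> ennreal"
  where "L1_shift u v = (\<integral>\<^sup>+y. ennreal \<bar>u (y + v) - u y\<bar> \<partial>lborel)"

lemma L1_shift_triangle:
  assumes [measurable]: "u \<in> borel_measurable borel" "w \<in> borel_measurable borel"
  shows "L1_shift u v \<le> L1_shift w v + 2 * (\<integral>\<^sup>+y. ennreal \<bar>u y - w y\<bar> \<partial>lborel)"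
proof -
  have "L1_shift u v \<le> (\<integral>\<^sup>+y. ennreal \<bar>w (y + v) - w y\<bar> + (ennreal \<bar>u (y + v) - w (y + v)\<bar> + ennreal \<bar>u y - w y\<bar>) \<partial>lborel)"
    unfolding L1_shift_def by (intro nn_integral_mono) (auto simp flip: ennreal_plus)
  also have "\<dots> = L1_shift w v + ((\<integral>\<^sup>+y. ennreal \<bar>u (y + v) - w (y + v)\<bar> \<partial>lborel) + (\<integral>\<^sup>+y. ennreal \<bar>u y - w y\<bar> \<partial>lborel))"
    unfolding L1_shift_def by (simp add: nn_integral_add)
  also have "(\<integral>\<^sup>+y. ennreal \<bar>u (y + v) - w (y + v)\<bar> \<partial>lborel) = (\<integral>\<^sup>+y. ennreal \<bar>u y - w y\<bar> \<partial>lborel)"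
    by (rule nn_integral_translate[of "\<lambda>y. ennreal \<bar>u y - w y\<bar>"]) measurable
  finally show ?thesis by (simp add: mult_2)
qed

lemma ennreal_pos_approx:
  assumes "0 < (a::ennreal)"
  shows "\<exists>e>0. ennreal e < a"
proof -
  obtain b where b: "0 < b" "b < a" using dense[OF assms] by auto
  then have "b = ennreal (enn2real b)" by (metis ennreal_enn2real less_top order.strict_trans2 top_greatest)
  with b show ?thesis by (intro exI[of _ "enn2real b"]) (auto simp: enn2real_positive_iff intro: less_le_trans)
qed

lemma tendsto_0_ennreal_approx:
  fixes F :: "'a \<Rightarrow> ennreal"
  assumes "\<And>e::real. e > 0 \<Longrightarrow> \<exists>G. (G \<longlongrightarrow> 0) A \<and> (\<forall>\<^sub>F x in A. F x \<le> G x + ennreal e)"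
  shows "(F \<longlongrightarrow> 0) A"
proof (rule order_tendstoI)
  fix a :: ennreal assume "0 < a"
  then obtain e where e: "0 < e" "ennreal e < a"
    using ennreal_pos_approx[OF \<open>0 < a\<close>] by blast
  obtain G where G: "(G \<longlongrightarrow> 0) A" "\<forall>\<^sub>F x in A. F x \<le> G x + ennreal (e / 2)"
    using assms[of "e / 2"] e by auto
  have "eventually (\<lambda>x. G x < ennreal (e / 2)) A"
    using G(1) e by (intro order_tendstoD(2)[OF G(1)]) auto
  then show "eventually (\<lambda>x. F x < a) A"
    using G(2)
  proof eventually_elim
    case (elim x)
    have "F x \<le> ennreal (e / 2) + ennreal (e / 2)"
      using elim by (meson add_right_mono less_imp_le order_trans)
    also have "\<dots> = ennreal e" using e by (simp flip: ennreal_plus)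
    finally show ?case using e(2) by (rule le_less_trans)
  qed
qed simp

lemma ennreal_add_right_cancelD:
  fixes a b c :: ennreal
  assumes "a + c = b + c" "c \<noteq> top"
  shows "a = b"
  using assms ennreal_add_left_cancel[of c a b] by (simp add: add.commute)

text \<open>The functions \<open>1\<^sub>U\<close> and \<open>1\<^sub>U(\<cdot> + v)\<close> have the same finite integral, so their distance is twice
the integral of the positive part of \<open>1\<^sub>U - 1\<^sub>U(\<cdot> + v)\<close>. That part is dominated by \<open>1\<^sub>U\<close> and tends to 0
pointwise as \<open>v \<rightarrow> 0\<close>, because \<open>U\<close> is open.\<close>

lemma L1_shift_open:
  fixes U :: "(real ^ 'n::finite) set"
  assumes U: "open U" "emeasure lborel U < \<infinity>"
  shows "(L1_shift (indicator U) \<longlongrightarrow> 0) (at 0)"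
  unfolding tendsto_at_iff_sequentially comp_def
proof (intro allI impI)
  fix X :: "nat \<Rightarrow> real ^ 'n" assume X: "X \<longlonglongrightarrow> 0"
  have [measurable]: "U \<in> sets borel" using U by auto
  let ?d = "\<lambda>n y. (if y \<in> U \<and> y + X n \<notin> U then 1 else 0) :: ennreal"
  have shift: "L1_shift (indicator U) (X n) = 2 * (\<integral>\<^sup>+y. ?d n y \<partial>lborel)" for n
  proof -
    let ?e = "\<lambda>y. (if y \<notin> U \<and> y + X n \<in> U then 1 else 0) :: ennreal"
    let ?i = "\<lambda>y. (if y \<in> U \<and> y + X n \<in> U then 1 else 0) :: ennreal"
    have "(\<integral>\<^sup>+y. ?d n y \<partial>lborel) + (\<integral>\<^sup>+y. ?i y \<partial>lborel) = (\<integral>\<^sup>+y. indicator U y \<partial>lborel)"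
    proof -
      have "?d n y + ?i y = indicator U y" for y
        by (simp add: indicator_def)
      then show ?thesis by (subst nn_integral_add[symmetric]) (simp_all only:, measurable)
    qed
    also have "\<dots> = (\<integral>\<^sup>+y. indicator U (y + X n) \<partial>lborel)"
      by (rule nn_integral_translate[symmetric]) measurable
    also have "\<dots> = (\<integral>\<^sup>+y. ?e y \<partial>lborel) + (\<integral>\<^sup>+y. ?i y \<partial>lborel)"
      by (subst nn_integral_add[symmetric]) (auto simp: indicator_def intro!: nn_integral_cong)
    finally have "(\<integral>\<^sup>+y. ?d n y \<partial>lborel) + (\<integral>\<^sup>+y. ?i y \<partial>lborel) = (\<integral>\<^sup>+y. ?e y \<partial>lborel) + (\<integral>\<^sup>+y. ?i y \<partial>lborel)" .
    moreover have "(\<integral>\<^sup>+y. ?i y \<partial>lborel) \<noteq> top"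
    proof -
      have "(\<integral>\<^sup>+y. ?i y \<partial>lborel) \<le> (\<integral>\<^sup>+y. indicator U y \<partial>lborel)"
        by (intro nn_integral_mono) (auto simp: indicator_def)
      then show ?thesis using U(2) by (auto simp: top_unique)
    qed
    ultimately have "(\<integral>\<^sup>+y. ?d n y \<partial>lborel) = (\<integral>\<^sup>+y. ?e y \<partial>lborel)"
      by (rule ennreal_add_right_cancelD)
    moreover have "L1_shift (indicator U) (X n) = (\<integral>\<^sup>+y. ?d n y \<partial>lborel) + (\<integral>\<^sup>+y. ?e y \<partial>lborel)"
      unfolding L1_shift_def
      by (subst nn_integral_add[symmetric]) (auto simp: indicator_def intro!: nn_integral_cong)
    ultimately show ?thesis by (simp add: mult_2)
  qed
  have "(\<lambda>n. \<integral>\<^sup>+y. ?d n y \<partial>lborel) \<longlonglongrightarrow> (\<integral>\<^sup>+y. 0 \<partial>(lborel :: (real ^ 'n) measure))"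
  proof (rule nn_integral_dominated_convergence[where w = "indicator U"])
    show "AE y in lborel. (\<lambda>n. ?d n y) \<longlonglongrightarrow> 0"
    proof (intro AE_I2 tendsto_eventually)
      fix y
      show "eventually (\<lambda>n. ?d n y = 0) sequentially"
      proof (cases "y \<in> U")
        case True
        have "(\<lambda>n. y + X n) \<longlonglongrightarrow> y + 0" by (intro tendsto_intros X)
        then have "eventually (\<lambda>n. y + X n \<in> U) sequentially"
          using True U(1) by (intro topological_tendstoD) auto
        then show ?thesis by eventually_elim simp
      qed simp
    qed
  next
    show "(\<integral>\<^sup>+y. indicator U y \<partial>lborel) < \<infinity>" using U(2) by simp
  qed (auto simp: indicator_def)
  then have "(\<lambda>n. 2 * (\<integral>\<^sup>+y. ?d n y \<partial>lborel)) \<longlonglongrightarrow> 2 * 0"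
    by (intro tendsto_mult_ennreal tendsto_const) auto
  then show "(\<lambda>n. L1_shift (indicator U) (X n)) \<longlonglongrightarrow> 0"
    by (simp add: shift)
qed

text \<open>The class of functions with this property is closed under approximation in the mean, by
\<open>L1_shift_triangle\<close>. Outer regularity passes from open sets to Borel sets, and the induction
principle for integrable functions does the rest.\<close>

lemma L1_shift_tendsto_0:
  fixes u :: "real ^ 'n::finite \<Rightarrow> real"
  assumes "integrable lborel u"
  shows "(L1_shift u \<longlongrightarrow> 0) (at 0)"
  using assms
proof (induction rule: integrable_induct)
  case (base A c)
  have [measurable]: "A \<in> sets borel" using base by simp
  show ?case
  proof (rule tendsto_0_ennreal_approx)
    fix e :: real assume "e > 0"
    define d where "d = e / (2 * (\<bar>c\<bar> + 1))"
    have d: "d > 0" using \<open>e > 0\<close> by (auto simp: d_def)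
    obtain U where U: "open U" "A \<subseteq> U" "emeasure lborel (U - A) < ennreal d"
      using outer_regular_lborel[of A d] base d by auto
    have [measurable]: "U \<in> sets borel" using U by auto
    have "emeasure lborel U \<le> emeasure lborel (U - A) + emeasure lborel A"
      by (rule order_trans[OF _ emeasure_subadditive]) (auto intro!: emeasure_mono)
    also have "\<dots> < \<infinity>" using U(3) base(2) by (auto intro: less_trans)
    finally have fin: "emeasure lborel U < \<infinity>" .
    let ?w = "\<lambda>y. indicator U y * c"
    have w: "L1_shift ?w v = ennreal \<bar>c\<bar> * L1_shift (indicator U) v" for v
      unfolding L1_shift_def
      by (subst nn_integral_cmult[symmetric])
         (auto intro!: nn_integral_cong
           simp: abs_mult mult.commute simp flip: ennreal_mult left_diff_distrib right_diff_distrib)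
    have "((\<lambda>v. ennreal \<bar>c\<bar> * L1_shift (indicator U) v) \<longlongrightarrow> ennreal \<bar>c\<bar> * 0) (at 0)"
      by (intro tendsto_mult_ennreal tendsto_const L1_shift_open U fin) auto
    then have "(L1_shift ?w \<longlongrightarrow> 0) (at 0)" by (simp add: w[abs_def])
    moreover have "L1_shift (\<lambda>x. indicator A x *\<^sub>R c) v \<le> L1_shift ?w v + ennreal e" for v
    proof -
      have "(\<integral>\<^sup>+y. ennreal \<bar>indicator A y *\<^sub>R c - ?w y\<bar> \<partial>lborel) = (\<integral>\<^sup>+y. ennreal \<bar>c\<bar> * indicator (U - A) y \<partial>lborel)"
        using U(2) by (intro nn_integral_cong) (auto simp: indicator_def)
      also have "\<dots> = ennreal \<bar>c\<bar> * emeasure lborel (U - A)"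
        by (subst nn_integral_cmult_indicator) auto
      also have "\<dots> \<le> ennreal \<bar>c\<bar> * ennreal d"
        using U(3) by (intro mult_left_mono) auto
      also have "\<dots> = ennreal (\<bar>c\<bar> * d)" using d by (simp add: ennreal_mult)
      also have "\<dots> \<le> ennreal (e / 2)"
        using \<open>e > 0\<close> by (intro ennreal_leI) (simp add: d_def field_simps)
      finally have "2 * (\<integral>\<^sup>+y. ennreal \<bar>indicator A y *\<^sub>R c - ?w y\<bar> \<partial>lborel) \<le> 2 * ennreal (e / 2)"
        by (intro mult_left_mono) auto
      also have "\<dots> = ennreal e" using \<open>e > 0\<close> by (simp add: mult_2 flip: ennreal_plus)
      finally show ?thesis
        by (intro order_trans[OF L1_shift_triangle[of _ ?w]] add_left_mono) (auto simp: base)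
    qed
    ultimately show "\<exists>G. (G \<longlongrightarrow> 0) (at 0) \<and> (\<forall>\<^sub>F v in at 0. L1_shift (\<lambda>x. indicator A x *\<^sub>R c) v \<le> G v + ennreal e)"
      by (blast intro: always_eventually)
  qed
next
  case (add u w)
  have [measurable]: "u \<in> borel_measurable borel" "w \<in> borel_measurable borel"
    using add borel_measurable_integrable by fastforce+
  have "L1_shift (\<lambda>x. u x + w x) v \<le> L1_shift u v + L1_shift w v" for v
  proof -
    have "L1_shift (\<lambda>x. u x + w x) v \<le> (\<integral>\<^sup>+y. ennreal \<bar>u (y + v) - u y\<bar> + ennreal \<bar>w (y + v) - w y\<bar> \<partial>lborel)"
      unfolding L1_shift_def by (intro nn_integral_mono) (auto simp flip: ennreal_plus)
    then show ?thesis unfolding L1_shift_def by (simp add: nn_integral_add)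
  qed
  moreover have "((\<lambda>v. L1_shift u v + L1_shift w v) \<longlongrightarrow> 0) (at 0)"
    using tendsto_add[OF add.IH] by simp
  ultimately show ?case
    by (intro tendsto_0_ennreal_approx exI[of _ "\<lambda>v. L1_shift u v + L1_shift w v"])
       (auto intro!: always_eventually intro: add_increasing2)
next
  case (lim u s)
  have [measurable]: "u \<in> borel_measurable borel" "\<And>i. s i \<in> borel_measurable borel"
    using borel_measurable_integrable[OF \<open>integrable lborel u\<close>]
      borel_measurable_integrable[OF lim.hyps(1)] by simp_all
  have "(\<lambda>i. \<integral>\<^sup>+y. ennreal \<bar>u y - s i y\<bar> \<partial>lborel) \<longlonglongrightarrow> (\<integral>\<^sup>+y. 0 \<partial>(lborel :: (real ^ 'n) measure))"
  proof (rule nn_integral_dominated_convergence[where w = "\<lambda>y. ennreal (3 * \<bar>u y\<bar>)"])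
    show "(\<integral>\<^sup>+y. ennreal (3 * \<bar>u y\<bar>) \<partial>lborel) < \<infinity>"
      using \<open>integrable lborel u\<close>
      by (simp add: integrable_iff_bounded ennreal_mult nn_integral_cmult ennreal_mult_less_top)
    show "AE y in lborel. (\<lambda>i. ennreal \<bar>u y - s i y\<bar>) \<longlonglongrightarrow> 0"
    proof (intro AE_I2)
      fix y
      have "(\<lambda>i. s i y) \<longlonglongrightarrow> u y" using lim.hyps(2)[of y] by simp
      then have "(\<lambda>i. \<bar>u y - s i y\<bar>) \<longlonglongrightarrow> \<bar>u y - u y\<bar>"
        by (intro tendsto_intros)
      then show "(\<lambda>i. ennreal \<bar>u y - s i y\<bar>) \<longlonglongrightarrow> 0"
        using tendsto_ennrealI by force
    qed
    show "AE y in lborel. ennreal \<bar>u y - s i y\<bar> \<le> ennreal (3 * \<bar>u y\<bar>)" for i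
    proof (intro AE_I2 ennreal_leI)
      fix y
      have "\<bar>s i y\<bar> \<le> 2 * \<bar>u y\<bar>" using lim.hyps(3)[of y i] by simp
      then show "\<bar>u y - s i y\<bar> \<le> 3 * \<bar>u y\<bar>" by linarith
    qed
  qed auto
  then have conv: "(\<lambda>i. \<integral>\<^sup>+y. ennreal \<bar>u y - s i y\<bar> \<partial>lborel) \<longlonglongrightarrow> 0" by simp
  show ?case
  proof (rule tendsto_0_ennreal_approx)
    fix e :: real assume "e > 0"
    then have "eventually (\<lambda>i. (\<integral>\<^sup>+y. ennreal \<bar>u y - s i y\<bar> \<partial>lborel) < ennreal (e / 2)) sequentially"
      by (intro order_tendstoD(2)[OF conv]) auto
    then obtain i where i: "(\<integral>\<^sup>+y. ennreal \<bar>u y - s i y\<bar> \<partial>lborel) < ennreal (e / 2)"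
      by (auto simp: eventually_sequentially)
    then have "2 * (\<integral>\<^sup>+y. ennreal \<bar>u y - s i y\<bar> \<partial>lborel) \<le> 2 * ennreal (e / 2)"
      by (intro mult_left_mono) auto
    also have "\<dots> = ennreal e" using \<open>e > 0\<close> by (simp add: mult_2 flip: ennreal_plus)
    finally have "L1_shift u v \<le> L1_shift (s i) v + ennreal e" for v
      by (intro order_trans[OF L1_shift_triangle[of _ "s i"]] add_left_mono) auto
    with lim.IH show "\<exists>G. (G \<longlongrightarrow> 0) (at 0) \<and> (\<forall>\<^sub>F v in at 0. L1_shift u v \<le> G v + ennreal e)"
      by (blast intro: always_eventually)
  qed
qed

lemma powr_le_mult:
  fixes x a p :: real
  assumes "0 \<le> x" "x \<le> a" "1 \<le> p"
  shows "x powr p \<le> a powr (p - 1) * x"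
proof (cases "x = 0")
  case False
  then have "x powr p = x powr (p - 1) * x"
    using assms(1) by (simp add: powr_mult_base mult.commute)
  also have "\<dots> \<le> a powr (p - 1) * x"
    using assms by (intro mult_right_mono powr_mono2) auto
  finally show ?thesis .
qed simp

text \<open>Each of \<open>(a - b)\<^sup>p\<close> and \<open>b\<^sup>p\<close> is at most \<open>a\<^bsup>p-1\<^esup>\<close> times its base, and the bases add up to
\<open>a\<close>.\<close>

lemma powr_diff_superadditive:
  fixes a b p :: real
  assumes "0 \<le> b" "b \<le> a" "1 \<le> p"
  shows "(a - b) powr p \<le> a powr p - b powr p"
proof (cases "a = 0")
  case False
  have "(a - b) powr p + b powr p \<le> a powr (p - 1) * (a - b) + a powr (p - 1) * b"
    using assms by (intro add_mono powr_le_mult) auto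
  also have "\<dots> = a powr p"
    using False assms by (simp add: algebra_simps powr_mult_base)
  finally show ?thesis by simp
qed (use assms in simp)

lemma powr_add_le:
  fixes a b p :: real
  assumes "0 \<le> a" "0 \<le> b" "0 \<le> p"
  shows "(a + b) powr p \<le> 2 powr p * (a powr p + b powr p)"
proof -
  have "(a + b) powr p \<le> (2 * max a b) powr p"
    using assms by (intro powr_mono2) auto
  also have "\<dots> = 2 powr p * (max a b) powr p"
    using assms by (simp add: powr_mult)
  also have "\<dots> \<le> 2 powr p * (a powr p + b powr p)"
    by (intro mult_left_mono) (auto simp: max_def)
  finally show ?thesis .
qed

text \<open>The map \<open>g \<mapsto> signed_powr p \<circ> g\<close> turns p-integrable functions into integrable ones. Since it
does not contract p-th powers of distances by more than a constant factor, continuity of translations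
in the p-th mean follows from the case \<open>p = 1\<close>.\<close>

definition signed_powr :: "real \<Rightarrow> real \<Rightarrow> real"
  where "signed_powr p a = sgn a * \<bar>a\<bar> powr p"

lemma powr_diff_le_signed_powr:
  assumes "1 \<le> p"
  shows "\<bar>a - b\<bar> powr p \<le> 2 powr p * \<bar>signed_powr p a - signed_powr p b\<bar>"
proof -
  have two: "1 \<le> 2 powr p" using assms by (simp add: ge_one_powr_ge_zero)
  have same: "\<bar>x - y\<bar> powr p \<le> 2 powr p * \<bar>x powr p - y powr p\<bar>" if "0 \<le> y" "y \<le> x" for x y
  proof -
    have "\<bar>x - y\<bar> powr p \<le> 1 * \<bar>x powr p - y powr p\<bar>"
      using powr_diff_superadditive[OF that assms] that by simp
    also have "\<dots> \<le> 2 powr p * \<bar>x powr p - y powr p\<bar>"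
      by (intro mult_right_mono two) simp
    finally show ?thesis .
  qed
  consider "0 \<le> a" "0 \<le> b" | "a \<le> 0" "b \<le> 0" | "0 \<le> a" "b \<le> 0" | "a \<le> 0" "0 \<le> b"
    by linarith
  then show ?thesis
  proof cases
    case 1
    then show ?thesis
      using same[of b a] same[of a b]
      by (cases a b rule: le_cases) (auto simp: signed_powr_def sgn_if abs_minus_commute)
  next
    case 2
    then show ?thesis
      using same[of "- b" "- a"] same[of "- a" "- b"]
      by (cases a b rule: le_cases) (auto simp: signed_powr_def sgn_if abs_minus_commute)
  next
    case 3
    then show ?thesis
      using powr_add_le[of a "- b" p] assms by (auto simp: signed_powr_def sgn_if)
  next
    case 4
    moreover have "\<bar>- ((- a) powr p) - b powr p\<bar> = b powr p + (- a) powr p"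
      using powr_ge_zero[of "- a" p] powr_ge_zero[of b p] by linarith
    ultimately show ?thesis
      using powr_add_le[of "- a" b p] assms
      by (cases "a = 0"; cases "b = 0") (auto simp: signed_powr_def sgn_if add.commute)
  qed
qed

definition Lp_shift :: "real \<Rightarrow> (real ^ 'n::finite \<Rightarrow> real) \<Rightarrow> real ^ 'n \<Rightarrow> ennreal"
  where "Lp_shift p g v = (\<integral>\<^sup>+y. ennreal (\<bar>g (y + v) - g y\<bar> powr p) \<partial>lborel)"

lemma Lp_shift_tendsto_0:
  fixes g :: "real ^ 'n::finite \<Rightarrow> real"
  assumes [measurable]: "g \<in> borel_measurable borel"
    and "integrable lborel (\<lambda>x. \<bar>g x\<bar> powr p)" "1 \<le> p"
  shows "(Lp_shift p g \<longlongrightarrow> 0) (at 0)"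
proof -
  let ?u = "\<lambda>y. signed_powr p (g y)"
  have [measurable]: "?u \<in> borel_measurable borel"
    unfolding signed_powr_def by measurable
  have "integrable lborel ?u"
    by (rule Bochner_Integration.integrable_bound[OF assms(2)])
       (auto simp: signed_powr_def abs_mult abs_sgn_eq)
  then have "((\<lambda>v. ennreal (2 powr p) * L1_shift ?u v) \<longlongrightarrow> ennreal (2 powr p) * 0) (at 0)"
    by (intro tendsto_mult_ennreal tendsto_const L1_shift_tendsto_0) auto
  moreover have "Lp_shift p g v \<le> ennreal (2 powr p) * L1_shift ?u v" for v
    unfolding Lp_shift_def L1_shift_def
    by (subst nn_integral_cmult[symmetric])
       (auto intro!: nn_integral_mono simp: powr_diff_le_signed_powr[OF assms(3)] simp flip: ennreal_mult)
  ultimately show ?thesis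
    by (intro tendsto_0_ennreal_approx exI[of _ "\<lambda>v. ennreal (2 powr p) * L1_shift ?u v"])
       (auto intro!: always_eventually intro: add_increasing2)
qed

lemma Lp_shift_le:
  fixes g :: "real ^ 'n::finite \<Rightarrow> real"
  assumes [measurable]: "g \<in> borel_measurable borel" and "0 \<le> p"
  shows "Lp_shift p g v \<le> ennreal (2 powr p) * (2 * (\<integral>\<^sup>+y. ennreal (\<bar>g y\<bar> powr p) \<partial>lborel))"
proof -
  have "Lp_shift p g v \<le> (\<integral>\<^sup>+y. ennreal (2 powr p) * (ennreal (\<bar>g (y + v)\<bar> powr p) + ennreal (\<bar>g y\<bar> powr p)) \<partial>lborel)"
    unfolding Lp_shift_def
  proof (intro nn_integral_mono)
    fix y
    have "\<bar>g (y + v) - g y\<bar> powr p \<le> (\<bar>g (y + v)\<bar> + \<bar>g y\<bar>) powr p"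
      using assms(2) by (intro powr_mono2) auto
    also have "\<dots> \<le> 2 powr p * (\<bar>g (y + v)\<bar> powr p + \<bar>g y\<bar> powr p)"
      using assms(2) by (intro powr_add_le) auto
    finally show "ennreal (\<bar>g (y + v) - g y\<bar> powr p) \<le>
        ennreal (2 powr p) * (ennreal (\<bar>g (y + v)\<bar> powr p) + ennreal (\<bar>g y\<bar> powr p))"
      by (simp flip: ennreal_plus ennreal_mult)
  qed
  also have "\<dots> = ennreal (2 powr p) * ((\<integral>\<^sup>+y. ennreal (\<bar>g (y + v)\<bar> powr p) \<partial>lborel) + (\<integral>\<^sup>+y. ennreal (\<bar>g y\<bar> powr p) \<partial>lborel))"
    by (simp add: nn_integral_cmult nn_integral_add)
  also have "(\<integral>\<^sup>+y. ennreal (\<bar>g (y + v)\<bar> powr p) \<partial>lborel) = (\<integral>\<^sup>+y. ennreal (\<bar>g y\<bar> powr p) \<partial>lborel)"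
    by (rule nn_integral_translate[of "\<lambda>y. ennreal (\<bar>g y\<bar> powr p)"]) measurable
  finally show ?thesis by (simp add: mult_2)
qed

section \<open>Convexity of the p-th power\<close>

lemma powr_add_convex_le:
  fixes x y p \<theta> :: real
  assumes "0 \<le> x" "0 \<le> y" "1 \<le> p" "0 < \<theta>" "\<theta> < 1"
  shows "(x + y) powr p \<le> (1 - \<theta>) powr (1 - p) * x powr p + \<theta> powr (1 - p) * y powr p"
proof -
  have c: "c * (z / c) powr p = c powr (1 - p) * z powr p" if "0 < c" "0 \<le> z" for c z :: real
    using that by (simp add: powr_divide powr_diff)
  consider "x = 0" | "y = 0" | "0 < x" "0 < y" using assms by linarith
  then show ?thesis
  proof cases
    case 1
    have "1 * y powr p \<le> \<theta> powr (1 - p) * y powr p"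
      using assms powr_mono2'[of "1 - p" \<theta> 1] by (intro mult_right_mono) auto
    with 1 show ?thesis using assms by simp
  next
    case 2
    have "1 * x powr p \<le> (1 - \<theta>) powr (1 - p) * x powr p"
      using assms powr_mono2'[of "1 - p" "1 - \<theta>" 1] by (intro mult_right_mono) auto
    with 2 show ?thesis using assms by simp
  next
    case 3
    have "((1 - \<theta>) *\<^sub>R (x / (1 - \<theta>)) + \<theta> *\<^sub>R (y / \<theta>)) powr p
        \<le> (1 - \<theta>) * (x / (1 - \<theta>)) powr p + \<theta> * (y / \<theta>) powr p"
      using 3 assms by (intro convex_onD[OF powr_convex[OF assms(3)]]) auto
    then show ?thesis
      using assms by (simp add: c)
  qed
qed

text \<open>Convexity of the p-th power with weights \<open>1 - \<theta>\<close> and \<open>\<theta>\<close>, where \<open>\<theta>\<close> is chosen such that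
\<open>(1 - \<theta>)\<^bsup>1-p\<^esup> = 1 + \<eta>\<close>.\<close>

lemma powr_perturbation:
  fixes p \<eta> :: real
  assumes "1 < p" "0 < \<eta>"
  obtains C where "0 < C" "\<And>a b. \<bar>a\<bar> powr p \<le> (1 + \<eta>) * \<bar>b\<bar> powr p + C * \<bar>a - b\<bar> powr p"
proof -
  define \<theta> where "\<theta> = 1 - (1 + \<eta>) powr (- 1 / (p - 1))"
  have "(1 + \<eta>) powr (- 1 / (p - 1)) < (1 + \<eta>) powr 0"
    using assms by (intro powr_less_mono) (auto simp: divide_neg_pos)
  then have \<theta>: "0 < \<theta>" "\<theta> < 1" using assms by (auto simp: \<theta>_def)
  have eq: "(1 - \<theta>) powr (1 - p) = 1 + \<eta>"
  proof -
    have "- 1 / (p - 1) * (1 - p) = 1" using assms by (simp add: field_simps)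
    moreover have "1 - \<theta> = (1 + \<eta>) powr (- 1 / (p - 1))" by (simp add: \<theta>_def)
    ultimately show ?thesis using assms by (simp only: powr_powr) simp
  qed
  show thesis
  proof (rule that[of "\<theta> powr (1 - p)"])
    fix a b :: real
    have "\<bar>a\<bar> powr p \<le> (\<bar>b\<bar> + \<bar>a - b\<bar>) powr p"
      using assms by (intro powr_mono2) auto
    also have "\<dots> \<le> (1 + \<eta>) * \<bar>b\<bar> powr p + \<theta> powr (1 - p) * \<bar>a - b\<bar> powr p"
      using powr_add_convex_le[of "\<bar>b\<bar>" "\<bar>a - b\<bar>" p \<theta>] assms \<theta> by (simp add: eq)
    finally show "\<bar>a\<bar> powr p \<le> (1 + \<eta>) * \<bar>b\<bar> powr p + \<theta> powr (1 - p) * \<bar>a - b\<bar> powr p" .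
  qed (use \<theta> in auto)
qed

text \<open>Jensen's inequality on the unit interval. With \<open>A\<close> the mean of \<open>\<bar>X\<bar>\<close>, Young's inequality gives
\<open>\<bar>X\<bar> A\<^bsup>p-1\<^esup> \<le> \<bar>X\<bar>\<^sup>p / p + A\<^sup>p / q\<close>; integrating, and absorbing \<open>A\<^sup>p / q\<close> on the left, yields the claim.
Stated with nonnegative integrals on the right, it also covers functions \<open>X\<close> that are not integrable.\<close>

lemma powr_average_le:
  fixes X :: "real \<Rightarrow> real"
  assumes [measurable]: "X \<in> borel_measurable borel" and p: "1 < p"
  shows "ennreal (\<bar>\<integral>t. indicator {0..1} t * X t \<partial>lborel\<bar> powr p)
    \<le> (\<integral>\<^sup>+t. indicator {0..1} t * ennreal (\<bar>X t\<bar> powr p) \<partial>lborel)" (is "_ \<le> ?R")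
proof (cases "integrable lborel (\<lambda>t. indicator {0..1} t * X t) \<and> ?R < \<infinity>")
  case True
  define A where "A = (\<integral>t. \<bar>indicator {0..1} t * X t\<bar> \<partial>lborel)"
  have iX: "integrable lborel (\<lambda>t. \<bar>indicator {0..1} t * X t\<bar>)" using True by auto
  have eq: "ennreal (indicator {0..1} t * \<bar>X t\<bar> powr p) = indicator {0..1} t * ennreal (\<bar>X t\<bar> powr p)" for t :: real
    by (auto simp: indicator_def)
  have iXp: "integrable lborel (\<lambda>t. indicator {0..1} t * \<bar>X t\<bar> powr p)"
    using True by (intro integrableI_bounded) (auto simp: abs_mult eq)
  have R: "?R = ennreal (\<integral>t. indicator {0..1} t * \<bar>X t\<bar> powr p \<partial>lborel)"
    by (subst nn_integral_eq_integral[symmetric, OF iXp]) (auto simp: eq)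
  have "A powr p \<le> (\<integral>t. indicator {0..1} t * \<bar>X t\<bar> powr p \<partial>lborel)" (is "_ \<le> ?I")
  proof (cases "A > 0")
    case True
    define q where "q = p / (p - 1)"
    have q: "1 < q" "1 / p + 1 / q = 1" "(p - 1) * q = p" using p by (auto simp: q_def field_simps)
    have "A powr p = A * A powr (p - 1)" using True by (simp add: powr_mult_base)
    also have "\<dots> = (\<integral>t. \<bar>indicator {0..1} t * X t\<bar> * A powr (p - 1) \<partial>lborel)"
      by (simp add: A_def)
    also have "\<dots> \<le> (\<integral>t. 1 / p * (indicator {0..1} t * \<bar>X t\<bar> powr p) + 1 / q * (indicator {0..1} t * A powr p) \<partial>lborel)"
    proof (rule integral_mono)
      show "integrable lborel (\<lambda>t. \<bar>indicator {0..1} t * X t\<bar> * A powr (p - 1))"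
        using iX by (rule integrable_mult_left)
      have "integrable lborel (\<lambda>t::real. indicator {0..1} t * A powr p)"
        by (intro integrable_mult_left) simp
      then show "integrable lborel (\<lambda>t. 1 / p * (indicator {0..1} t * \<bar>X t\<bar> powr p) + 1 / q * (indicator {0..1} t * A powr p))"
        by (intro Bochner_Integration.integrable_add integrable_mult_right iXp)
      fix t
      show "\<bar>indicator {0..1} t * X t\<bar> * A powr (p - 1) \<le>
          1 / p * (indicator {0..1} t * \<bar>X t\<bar> powr p) + 1 / q * (indicator {0..1} t * A powr p)"
        using Youngs_inequality[OF p q(1,2), of "\<bar>X t\<bar>" "A powr (p - 1)"] q(3)
        by (auto simp: indicator_def powr_powr)
    qed
    also have "\<dots> = 1 / p * ?I + 1 / q * A powr p"
      using iXp by (subst Bochner_Integration.integral_add) (auto intro!: integrable_mult_right integrable_mult_left)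
    also have "1 / q = 1 - 1 / p" using q(2) by simp
    finally have "1 / p * A powr p \<le> 1 / p * ?I" by (simp add: algebra_simps)
    then show ?thesis using p by (simp add: divide_le_cancel)
  next
    case False
    then have "A = 0" unfolding A_def by (simp add: order_antisym)
    then show ?thesis by (auto intro!: integral_nonneg_AE)
  qed
  moreover have "\<bar>\<integral>t. indicator {0..1} t * X t \<partial>lborel\<bar> powr p \<le> A powr p"
    unfolding A_def using p by (intro powr_mono2 integral_abs_bound) auto
  ultimately show ?thesis unfolding R by (intro ennreal_leI) linarith
next
  case False
  then consider "\<not> integrable lborel (\<lambda>t. indicator {0..1} t * X t)" | "?R = \<infinity>"
    using top.not_eq_extremum by (metis infinity_ennreal_def)
  then show ?thesis
  proof cases
    case 1
    then have "(\<integral>t. indicator {0..1} t * X t \<partial>lborel) = 0" by (rule not_integrable_integral_eq)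
    then show ?thesis by simp
  next
    case 2
    show ?thesis unfolding 2 by simp
  qed
qed

section \<open>The gauge of a symmetric convex body and its polar coordinates\<close>

locale symmetric_convex_body =
  fixes K :: "(real ^ 'n::finite) set"
  assumes bounded_K: "bounded K" and convex_K: "convex K" and symmetric_K: "uminus ` K = K"
    and interior_K: "interior K \<noteq> {}"
begin

lemma zero_in_interior: "0 \<in> interior K"
proof -
  obtain x where x: "x \<in> interior K" using interior_K by blast
  then have "- x \<in> interior K"
    using interior_negations[of K] symmetric_K by (metis imageI)
  with x convex_interior[OF convex_K]
  have "(1 / 2) *\<^sub>R x + (1 / 2) *\<^sub>R (- x) \<in> interior K"
    by (intro convexD) auto
  then show ?thesis by simp
qed

text \<open>Open gauge balls are dilates of the interior of \<open>K\<close>. Everything about the gauge that is used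
below follows from this description: homogeneity, measurability and the comparison with the Euclidean
norm.\<close>

lemma norm_of_less_iff:
  assumes "0 < r"
  shows "norm_of K x < r \<longleftrightarrow> x /\<^sub>R r \<in> interior K"
proof -
  let ?T = "{t. t > 0 \<and> x /\<^sub>R t \<in> K}"
  obtain e where e: "0 < e" "ball 0 e \<subseteq> K"
    using zero_in_interior by (auto simp: mem_interior)
  have "norm (x /\<^sub>R ((norm x + 1) / e)) < e"
  proof -
    have "norm x / (norm x + 1) < 1" by (simp add: add_nonneg_pos)
    then show ?thesis using e mult_strict_left_mono[of "norm x / (norm x + 1)" 1 e]
      by (simp add: mult.commute divide_inverse)
  qed
  then have "x /\<^sub>R ((norm x + 1) / e) \<in> K" using e by (auto simp: dist_norm)
  moreover have "(norm x + 1) / e > 0" using e by (simp add: add_nonneg_pos)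
  ultimately have "?T \<noteq> {}" by blast
  moreover have "bdd_below ?T" by (rule bdd_belowI[of _ 0]) auto
  ultimately have "norm_of K x < r \<longleftrightarrow> (\<exists>t\<in>?T. t < r)"
    unfolding norm_of_def by (rule cInf_less_iff)
  also have "\<dots> \<longleftrightarrow> x /\<^sub>R r \<in> interior K"
  proof
    assume "\<exists>t\<in>?T. t < r"
    then obtain t where t: "0 < t" "t < r" "x /\<^sub>R t \<in> K" by auto
    have "x /\<^sub>R t - (1 - t / r) *\<^sub>R (x /\<^sub>R t - 0) \<in> interior K"
      using t by (intro mem_interior_convex_shrink convex_K zero_in_interior) auto
    also have "x /\<^sub>R t - (1 - t / r) *\<^sub>R (x /\<^sub>R t - 0) = x /\<^sub>R r"
      using t by (simp add: algebra_simps divide_simps flip: scaleR_left_diff_distrib)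
    finally show "x /\<^sub>R r \<in> interior K" .
  next
    assume "x /\<^sub>R r \<in> interior K"
    then obtain e where e: "0 < e" "ball (x /\<^sub>R r) e \<subseteq> K"
      by (auto simp: mem_interior)
    define d where "d = e / (norm (x /\<^sub>R r) + 1)"
    have d: "0 < d" using e by (simp add: d_def add_nonneg_pos)
    have "norm (d *\<^sub>R (x /\<^sub>R r)) < e"
    proof -
      have "norm (x /\<^sub>R r) / (norm (x /\<^sub>R r) + 1) < 1" by (simp add: add_nonneg_pos)
      then have "e * (norm (x /\<^sub>R r) / (norm (x /\<^sub>R r) + 1)) < e * 1"
        using e by (intro mult_strict_left_mono)
      moreover have "norm (d *\<^sub>R (x /\<^sub>R r)) = d * norm (x /\<^sub>R r)"
        using d by (simp only: norm_scaleR abs_of_pos)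
      ultimately show ?thesis by (simp only: d_def times_divide_eq_left times_divide_eq_right mult_1_right)
    qed
    then have "x /\<^sub>R r + d *\<^sub>R (x /\<^sub>R r) \<in> K"
      using e(2) by (auto simp: dist_norm)
    moreover have "x /\<^sub>R r + d *\<^sub>R (x /\<^sub>R r) = x /\<^sub>R (r / (1 + d))"
      using assms d by (simp add: divide_inverse algebra_simps)
    ultimately have "r / (1 + d) \<in> ?T" using assms d by simp
    moreover have "r / (1 + d) < r" using assms d by (simp add: field_simps)
    ultimately show "\<exists>t\<in>?T. t < r" by blast
  qed
  finally show ?thesis .
qed

lemma norm_of_nonneg: "0 \<le> norm_of K x"
proof -
  have "\<exists>t. t > 0 \<and> x /\<^sub>R t \<in> K"
  proof -
    have "norm_of K x < \<bar>norm_of K x\<bar> + 1" by simp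
    then have "x /\<^sub>R (\<bar>norm_of K x\<bar> + 1) \<in> interior K"
      by (subst (asm) norm_of_less_iff) auto
    then show ?thesis
      using interior_subset by (intro exI[of _ "\<bar>norm_of K x\<bar> + 1"]) auto
  qed
  then show ?thesis
    unfolding norm_of_def by (intro cInf_greatest) auto
qed

lemma norm_of_scale:
  assumes "0 < c"
  shows "norm_of K (c *\<^sub>R x) = c * norm_of K x"
proof -
  have iff: "norm_of K (c *\<^sub>R x) < r \<longleftrightarrow> c * norm_of K x < r" if "0 < r" for r
  proof -
    have "(c *\<^sub>R x) /\<^sub>R r = x /\<^sub>R (r / c)" using assms by (simp add: divide_inverse mult.commute)
    then have "norm_of K (c *\<^sub>R x) < r \<longleftrightarrow> norm_of K x < r / c"
      using norm_of_less_iff[OF that] divide_pos_pos[OF that assms] norm_of_less_iff[of "r / c"] that assms by metis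
    then show ?thesis using assms by (simp add: field_simps)
  qed
  have "0 \<le> c * norm_of K x" using assms norm_of_nonneg by simp
  with iff[of "c * norm_of K x"] iff[of "norm_of K (c *\<^sub>R x)"] norm_of_nonneg[of "c *\<^sub>R x"]
  show ?thesis by (meson less_irrefl less_linear order.strict_trans1)
qed

lemma norm_le_norm_of:
  obtains B where "0 < B" "\<And>x. norm x \<le> B * norm_of K x"
proof -
  obtain B where B: "0 < B" "\<And>x. x \<in> K \<Longrightarrow> norm x \<le> B"
    using bounded_K bounded_pos by metis
  show thesis
  proof (rule that[OF B(1)])
    fix x
    show "norm x \<le> B * norm_of K x"
    proof (rule field_le_epsilon)
      fix e :: real assume "0 < e"
      let ?r = "norm_of K x + e / B"
      have r: "0 < ?r" using norm_of_nonneg[of x] \<open>0 < e\<close> B(1) by (simp add: add_nonneg_pos)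
      then have "x /\<^sub>R ?r \<in> K"
        using norm_of_less_iff[OF r, of x] \<open>0 < e\<close> B(1) interior_subset by auto
      then have "norm x / ?r \<le> B" using B(2)[of "x /\<^sub>R ?r"] r by (simp add: divide_inverse mult.commute)
      then have "norm x \<le> B * ?r" using r by (simp add: pos_divide_le_eq)
      also have "B * ?r = B * norm_of K x + e" using B(1) by (simp add: distrib_left)
      finally show "norm x \<le> B * norm_of K x + e" .
    qed
  qed
qed

lemma norm_of_eq_0_iff: "norm_of K x = 0 \<longleftrightarrow> x = 0"
proof
  assume "norm_of K x = 0"
  then show "x = 0" using norm_le_norm_of by (metis mult_zero_right norm_le_zero_iff)
next
  assume "x = 0"
  have "norm_of K 0 < r" if "0 < r" for r
    using norm_of_less_iff[OF that, of 0] zero_in_interior by simp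
  then show "norm_of K x = 0"
    using norm_of_nonneg[of 0] \<open>x = 0\<close> by (metis less_irrefl order_le_less)
qed

lemma norm_of_borel [measurable]: "norm_of K \<in> borel_measurable borel"
proof (rule borel_measurableI_less)
  fix r :: real
  show "{x \<in> space borel. norm_of K x < r} \<in> sets borel"
  proof (cases "0 < r")
    case True
    have "{x \<in> space borel. norm_of K x < r} = (\<lambda>x. x /\<^sub>R r) -` interior K"
      using norm_of_less_iff[OF True] by auto
    also have "\<dots> \<in> sets borel"
      by (intro borel_open continuous_open_vimage continuous_intros) auto
    finally show ?thesis .
  next
    case False
    then have "{x \<in> space borel. norm_of K x < r} = {}"
      using norm_of_nonneg by (auto intro: order.trans simp: not_less)
    then show ?thesis by simp
  qed
qed

lemma norm_of_less_1: "{x. norm_of K x < 1} = interior K"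
  using norm_of_less_iff[of 1] by auto

lemma emeasure_interior_K_finite: "emeasure lborel (interior K) < \<infinity>"
  using bounded_K emeasure_bounded_finite bounded_interior by blast

text \<open>The boundary of a convex set is a null set, so it is immaterial which part of it belongs to
\<open>K\<close>.\<close>

lemma AE_indicator_K: "AE x in lborel. x \<in> K \<longleftrightarrow> norm_of K x < 1"
proof -
  have "frontier K \<in> null_sets lborel"
    using negligible_convex_frontier[OF convex_K]
    by (auto simp: negligible_iff_null_sets null_sets_completion_iff)
  then have "AE x in lborel. x \<notin> frontier K" by (rule AE_not_in)
  then show ?thesis
  proof eventually_elim
    case (elim x)
    then show ?case
      using norm_of_less_1 interior_subset[of K] closure_subset[of K] by (auto simp: frontier_def)
  qed
qed

end

lemma nn_integral_scale:
  fixes G :: "real ^ 'n::finite \<Rightarrow> ennreal"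
  assumes [measurable]: "G \<in> borel_measurable borel" and "0 < c"
  shows "(\<integral>\<^sup>+x. G x \<partial>lborel) = ennreal (c ^ CARD('n)) * (\<integral>\<^sup>+x. G (c *\<^sub>R x) \<partial>lborel)"
  using assms(2)
  by (subst lborel_affine[of c 0])
     (auto simp: nn_integral_density nn_integral_distr nn_integral_cmult)

lemma nn_integral_power_lessThan:
  fixes k :: nat
  assumes "0 < r" "0 < k"
  shows "(\<integral>\<^sup>+t. indicator {0..} t * ennreal (real k * t ^ (k - 1)) * indicator {..<r} t \<partial>lborel) = ennreal (r ^ k)"
proof -
  have "(\<integral>\<^sup>+t. indicator {0..} t * ennreal (real k * t ^ (k - 1)) * indicator {..<r} t \<partial>lborel)
      = (\<integral>\<^sup>+t. ennreal (real k * t ^ (k - 1)) * indicator {0..r} t \<partial>lborel)"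
    by (intro nn_integral_cong_AE, use AE_lborel_singleton[of r] in eventually_elim)
       (auto simp: indicator_def)
  also have "\<dots> = ennreal (r ^ k - 0 ^ k)"
    using assms by (intro nn_integral_FTC_Icc) (auto intro!: derivative_eq_intros)
  finally show ?thesis using assms by (simp add: zero_power)
qed

context symmetric_convex_body
begin

text \<open>By scaling, the image of the measure \<open>F(h) dh\<close> under the gauge gives the interval below \<open>r\<close> the
mass \<open>c r\<^sup>N\<close>, where \<open>c\<close> is the mass of the unit ball. The measure with density \<open>c N r\<^bsup>N-1\<^esup>\<close> on the
half-line does the same, and such intervals generate the Borel sets.\<close>

lemma polar_integral:
  fixes F :: "real ^ 'n \<Rightarrow> ennreal"
  assumes [measurable]: "F \<in> borel_measurable borel" "w \<in> borel_measurable borel"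
    and hom: "\<And>c x. 0 < c \<Longrightarrow> F (c *\<^sub>R x) = F x"
    and fin: "(\<integral>\<^sup>+x. F x * indicator (interior K) x \<partial>lborel) < \<infinity>"
  shows "(\<integral>\<^sup>+x. F x * w (norm_of K x) \<partial>lborel) =
    ennreal (real CARD('n)) * (\<integral>\<^sup>+x. F x * indicator (interior K) x \<partial>lborel) *
      (\<integral>\<^sup>+r. indicator {0..} r * (ennreal (r ^ (CARD('n) - 1)) * w r) \<partial>lborel)"
proof -
  let ?c = "\<integral>\<^sup>+x. F x * indicator (interior K) x \<partial>lborel"
  define k where "k = CARD('n)"
  have k: "0 < k" by (simp add: k_def)
  let ?d = "\<lambda>r. indicator {0..} r * ennreal (real k * r ^ (k - 1))"
  have ball: "(\<integral>\<^sup>+x. F x * indicator {..<r} (norm_of K x) \<partial>lborel) = ?c * ennreal (r ^ k)" if "0 < r" for r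
  proof -
    have "(\<integral>\<^sup>+x. F x * indicator {..<r} (norm_of K x) \<partial>lborel)
        = ennreal (r ^ k) * (\<integral>\<^sup>+x. F (r *\<^sub>R x) * indicator {..<r} (norm_of K (r *\<^sub>R x)) \<partial>lborel)"
      unfolding k_def using that by (intro nn_integral_scale) auto
    also have "(\<lambda>x. F (r *\<^sub>R x) * indicator {..<r} (norm_of K (r *\<^sub>R x))) = (\<lambda>x. F x * indicator (interior K) x)"
      using that by (auto simp: fun_eq_iff hom norm_of_scale indicator_def simp flip: norm_of_less_1)
    finally show ?thesis by (simp add: mult.commute)
  qed
  have "distr (density lborel F) borel (norm_of K) = density lborel (\<lambda>r. ?c * ?d r)" (is "?M = ?N")
  proof (rule measure_eqI_generator_eq[where E = "range lessThan" and \<Omega> = UNIV and A = "\<lambda>n. {..<real n}"])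
    show "Int_stable (range lessThan :: real set set)"
    proof (rule Int_stableI)
      fix A B :: "real set" assume "A \<in> range lessThan" "B \<in> range lessThan"
      then obtain a b where "A = {..<a}" "B = {..<b}" by auto
      then have "A \<inter> B = {..<min a b}" by auto
      then show "A \<inter> B \<in> range lessThan" by blast
    qed
    have V: "norm_of K -` {..<r} \<in> sets borel" for r
      using measurable_sets[OF norm_of_borel, of "{..<r}"] by simp
    have M: "emeasure ?M {..<r} = (\<integral>\<^sup>+x. F x * indicator {..<r} (norm_of K x) \<partial>lborel)" for r
      by (simp add: emeasure_distr emeasure_density V) (auto intro!: nn_integral_cong split: split_indicator)
    have N: "emeasure ?N {..<r} = ?c * (\<integral>\<^sup>+t. ?d t * indicator {..<r} t \<partial>lborel)" for r
      by (subst emeasure_density) (auto simp: nn_integral_cmult mult.assoc)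
    have neg: "emeasure ?M {..<r} = 0" "emeasure ?N {..<r} = 0" if "\<not> 0 < r" for r
    proof -
      have "indicator {..<r} (norm_of K x) = (0::ennreal)" for x
        using that norm_of_nonneg[of x] by (auto simp: indicator_def)
      then show "emeasure ?M {..<r} = 0" by (simp add: M)
      have "(\<integral>\<^sup>+t. ?d t * indicator {..<r} t \<partial>lborel) = (\<integral>\<^sup>+t. 0 \<partial>(lborel :: real measure))"
        using that by (intro nn_integral_cong) (auto simp: indicator_def)
      then show "emeasure ?N {..<r} = 0" unfolding N by simp
    qed
    fix X :: "real set" assume "X \<in> range lessThan"
    then obtain r where X: "X = {..<r}" by auto
    show "emeasure ?M X = emeasure ?N X"
    proof (cases "0 < r")
      case True
      then show ?thesis unfolding X M N ball[OF True] nn_integral_power_lessThan[OF True k] by simp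
    next
      case False
      show ?thesis unfolding X neg[OF False] ..
    qed
  next
    show "(\<Union>n. {..<real n}) = UNIV" using reals_Archimedean2 by blast
    show "emeasure ?M {..<real n} \<noteq> \<infinity>" for n
    proof (cases "n = 0")
      case True
      then have "norm_of K -` {..<real n} = {}"
        by (auto simp: leD[OF norm_of_nonneg])
      then show ?thesis by (simp add: emeasure_distr)
    next
      case False
      have "emeasure ?M {..<real n} = (\<integral>\<^sup>+x. F x * indicator {..<real n} (norm_of K x) \<partial>lborel)"
        using measurable_sets[OF norm_of_borel, of "{..<real n}"]
        by (simp add: emeasure_distr emeasure_density) (auto intro!: nn_integral_cong split: split_indicator)
      with ball[of "real n"] fin False show ?thesis by (auto simp: ennreal_mult_eq_top_iff)
    qed
  qed (auto simp: borel_Iio)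
  then have eq: "(\<integral>\<^sup>+r. w r \<partial>?M) = (\<integral>\<^sup>+r. w r \<partial>?N)" by simp
  have "(\<integral>\<^sup>+x. F x * w (norm_of K x) \<partial>lborel) = (\<integral>\<^sup>+r. w r \<partial>?M)"
    by (simp add: nn_integral_distr nn_integral_density)
  also have "\<dots> = (\<integral>\<^sup>+r. ?c * ?d r * w r \<partial>lborel)"
    unfolding eq by (simp add: nn_integral_density)
  also have "\<dots> = (\<integral>\<^sup>+r. ?c * (ennreal (real k) * (indicator {0..} r * (ennreal (r ^ (k - 1)) * w r))) \<partial>lborel)"
    by (intro nn_integral_cong) (auto simp: indicator_def ennreal_mult mult_ac)
  also have "\<dots> = ?c * (ennreal (real k) * (\<integral>\<^sup>+r. indicator {0..} r * (ennreal (r ^ (k - 1)) * w r) \<partial>lborel))"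
    by (simp add: nn_integral_cmult)
  also have "\<dots> = ennreal (real k) * ?c * (\<integral>\<^sup>+r. indicator {0..} r * (ennreal (r ^ (k - 1)) * w r) \<partial>lborel)"
    by (simp only: mult_ac)
  finally show ?thesis by (simp add: k_def)
qed

end

section \<open>The remainder for a fixed increment, in the p-th mean\<close>

lemma powr_sum_le:
  fixes a :: "'i \<Rightarrow> real"
  assumes "finite S" "\<And>i. i \<in> S \<Longrightarrow> 0 \<le> a i" "0 \<le> p"
  shows "(\<Sum>i\<in>S. a i) powr p \<le> real (card S) powr p * (\<Sum>i\<in>S. a i powr p)"
proof (cases "S = {}")
  case False
  then have "Max (a ` S) \<in> a ` S" using assms(1) by (intro Max_in) auto
  then obtain j where j: "j \<in> S" "a j = Max (a ` S)" by auto
  then have le: "a i \<le> a j" if "i \<in> S" for i using assms(1) that by simp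
  have "(\<Sum>i\<in>S. a i) powr p \<le> (real (card S) * a j) powr p"
    using assms le by (intro powr_mono2 sum_bounded_above sum_nonneg) auto
  also have "\<dots> = real (card S) powr p * a j powr p"
    using assms j by (simp add: powr_mult)
  also have "\<dots> \<le> real (card S) powr p * (\<Sum>i\<in>S. a i powr p)"
    using assms j by (intro mult_left_mono member_le_sum) auto
  finally show ?thesis .
qed simp

abbreviation tuples :: "nat \<Rightarrow> 'n::finite list set"
  where "tuples k \<equiv> {is. length is = k}"

text \<open>The exponent is applied to \<open>norm h ^ k\<close> as a whole because a merged exponent \<open>k p\<close> would give
the wrong value at \<open>k = 0\<close>, \<open>h = 0\<close>, where \<open>0 powr 0 = 0\<close>.\<close>

lemma dir_form_powr_le:
  fixes g :: "('n::finite \<Rightarrow> nat) \<Rightarrow> real ^ 'n \<Rightarrow> real"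
  assumes "0 \<le> p"
  shows "\<bar>dir_form g k y h\<bar> powr p \<le> (norm h ^ k) powr p *
    (real (card (tuples k :: 'n list set)) powr p * (\<Sum>is\<in>tuples k. \<bar>g (count_list is) y\<bar> powr p))"
proof -
  have "\<bar>dir_form g k y h\<bar> \<le> (\<Sum>is\<in>tuples k. norm h ^ k * \<bar>g (count_list is) y\<bar>)"
    unfolding dir_form_def
  proof (rule order_trans[OF sum_abs sum_mono])
    fix "is" :: "'n list"
    have "(\<Prod>j<k. \<bar>h $ (is ! j)\<bar>) \<le> (\<Prod>j<k. norm h)"
      by (intro prod_mono) (auto simp: component_le_norm_cart)
    then show "\<bar>(\<Prod>j<k. h $ (is ! j)) * g (count_list is) y\<bar> \<le> norm h ^ k * \<bar>g (count_list is) y\<bar>"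
      by (simp add: abs_mult abs_prod mult_right_mono)
  qed
  then have "\<bar>dir_form g k y h\<bar> powr p \<le> (norm h ^ k * (\<Sum>is\<in>tuples k. \<bar>g (count_list is) y\<bar>)) powr p"
    using assms by (intro powr_mono2) (auto simp: sum_distrib_left)
  also have "\<dots> = (norm h ^ k) powr p * (\<Sum>is\<in>tuples k. \<bar>g (count_list is) y\<bar>) powr p"
    by (simp add: powr_mult sum_nonneg)
  also have "\<dots> \<le> (norm h ^ k) powr p * (real (card (tuples k :: 'n list set)) powr p * (\<Sum>is\<in>tuples k. \<bar>g (count_list is) y\<bar> powr p))"
    using assms by (intro mult_left_mono powr_sum_le) (auto simp: finite_tuples)
  finally show ?thesis .
qed

lemma borel_measurable_vec_nth [measurable]: "(\<lambda>x. x $ i :: real) \<in> borel_measurable borel"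
  by (intro borel_measurable_continuous_onI continuous_intros)

lemma taylor_weight_integral:
  assumes "0 < k"
  shows "has_bochner_integral lborel (taylor_weight k) (1 / fact k)"
proof -
  have "has_bochner_integral lborel (\<lambda>t::real. (1 - t) ^ (k - 1) / fact (k - 1) * indicator {0..1} t)
      (- ((1 - 1) ^ k / fact k) - - ((1 - 0) ^ k / fact k))"
  proof (rule has_bochner_integral_FTC_Icc_nonneg[where F = "\<lambda>t. - ((1 - t) ^ k / fact k)"])
    fix t :: real
    have "fact k = real k * fact (k - 1)" using assms by (simp add: fact_reduce)
    then show "DERIV (\<lambda>t. - ((1 - t) ^ k / fact k)) t :> (1 - t) ^ (k - 1) / fact (k - 1)"
      using assms by (auto intro!: derivative_eq_intros simp: field_simps)
  qed auto
  moreover have "taylor_weight k = (\<lambda>t. (1 - t) ^ (k - 1) / fact (k - 1) * indicator {0..1} t)"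
    by (auto simp: taylor_weight_def)
  ultimately show ?thesis using assms by (simp add: zero_power)
qed

text \<open>The p-integrable derivatives are those of top order, with which the remainder is compared.\<close>

locale sobolev_derivatives = weak_derivatives m g
  for m :: nat and g :: "('n::finite \<Rightarrow> nat) \<Rightarrow> real ^ 'n \<Rightarrow> real" +
  fixes p :: real
  assumes m_pos: "0 < m" and p_gt_1: "1 < p"
    and g_borel [measurable]: "g \<alpha> \<in> borel_measurable borel"
    and g_Lp: "mi_size \<alpha> = m \<Longrightarrow> integrable lborel (\<lambda>x. \<bar>g \<alpha> x\<bar> powr p)"
begin

lemma dir_form_measurable [measurable (raw)]:
  assumes [measurable]: "A \<in> borel_measurable M" "B \<in> borel_measurable M"
  shows "(\<lambda>x. dir_form g k (A x) (B x)) \<in> borel_measurable M"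
proof -
  have [measurable]: "(\<lambda>x. B x $ i) \<in> borel_measurable M" for i
    using measurable_compose[OF assms(2) borel_measurable_vec_nth] .
  have [measurable]: "(\<lambda>x. g \<alpha> (A x)) \<in> borel_measurable M" for \<alpha>
    using measurable_compose[OF assms(1) g_borel] .
  show ?thesis unfolding dir_form_def by measurable
qed

lemma remainder_measurable [measurable (raw)]:
  assumes [measurable]: "A \<in> borel_measurable M" "B \<in> borel_measurable M"
  shows "(\<lambda>x. remainder (B x) (A x)) \<in> borel_measurable M"
  unfolding remainder_def by measurable

definition top_norm :: ennreal
  where "top_norm = (\<Sum>is\<in>tuples m. \<integral>\<^sup>+y. ennreal (\<bar>g (count_list is) y\<bar> powr p) \<partial>lborel)"

definition tuple_const :: real
  where "tuple_const = real (card (tuples m :: 'n list set)) powr p"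

text \<open>The mean displacement of the derivatives of order \<open>m\<close> under the translations \<open>t h\<close>,
\<open>0 \<le> t \<le> 1\<close>, that occur in the integral remainder.\<close>

definition modulus :: "real ^ 'n \<Rightarrow> ennreal"
  where "modulus h = ennreal tuple_const *
    (\<integral>\<^sup>+t. indicator {0..1} t * (\<Sum>is\<in>tuples m. Lp_shift p (g (count_list is)) (t *\<^sub>R h)) \<partial>lborel)"

definition leading_term :: "real ^ 'n \<Rightarrow> ennreal"
  where "leading_term h = (\<integral>\<^sup>+y. ennreal (\<bar>dir_form g m y h / fact m\<bar> powr p) \<partial>lborel)"

definition taylor_error :: "real ^ 'n \<Rightarrow> ennreal"
  where "taylor_error h = (\<integral>\<^sup>+y. ennreal (\<bar>remainder h y - dir_form g m y h / fact m\<bar> powr p) \<partial>lborel)"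

lemma tuple_const_nonneg: "0 \<le> tuple_const"
  by (simp add: tuple_const_def)

lemma top_norm_finite: "top_norm < \<infinity>"
proof -
  have "(\<integral>\<^sup>+y. ennreal (\<bar>g (count_list is) y\<bar> powr p) \<partial>lborel) < \<infinity>" if "is \<in> tuples m" for "is"
    using g_Lp[of "count_list is"] that by (simp add: mi_size_count_list integrable_iff_bounded)
  then show ?thesis unfolding top_norm_def by (simp add: finite_tuples)
qed

lemma leading_term_le: "leading_term h \<le> ennreal ((norm h ^ m) powr p) * (ennreal tuple_const * top_norm)"
proof -
  have "leading_term h \<le> (\<integral>\<^sup>+y. ennreal ((norm h ^ m) powr p) * (ennreal tuple_const * (\<Sum>is\<in>tuples m. ennreal (\<bar>g (count_list is) y\<bar> powr p))) \<partial>lborel)"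
    unfolding leading_term_def
  proof (intro nn_integral_mono)
    fix y
    have "\<bar>dir_form g m y h / fact m\<bar> \<le> \<bar>dir_form g m y h\<bar> / 1"
      unfolding abs_divide by (intro divide_left_mono) auto
    then have "\<bar>dir_form g m y h / fact m\<bar> powr p \<le> \<bar>dir_form g m y h\<bar> powr p"
      using p_gt_1 by (intro powr_mono2) auto
    also have "\<dots> \<le> (norm h ^ m) powr p * (tuple_const * (\<Sum>is\<in>tuples m. \<bar>g (count_list is) y\<bar> powr p))"
      unfolding tuple_const_def using p_gt_1 by (intro dir_form_powr_le) simp
    finally show "ennreal (\<bar>dir_form g m y h / fact m\<bar> powr p) \<le> ennreal ((norm h ^ m) powr p) * (ennreal tuple_const * (\<Sum>is\<in>tuples m. ennreal (\<bar>g (count_list is) y\<bar> powr p)))"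
      using tuple_const_nonneg by (simp add: sum_nonneg flip: ennreal_mult)
  qed
  also have "\<dots> = ennreal ((norm h ^ m) powr p) * (ennreal tuple_const * top_norm)"
    unfolding top_norm_def by (simp add: nn_integral_cmult nn_integral_sum del: sum_ennreal)
  finally show ?thesis .
qed

lemma modulus_le: "modulus h \<le> ennreal tuple_const * (ennreal (2 powr p) * (2 * top_norm))"
proof -
  have "(\<Sum>is\<in>tuples m. Lp_shift p (g (count_list is)) v) \<le> ennreal (2 powr p) * (2 * top_norm)" for v
    unfolding top_norm_def sum_distrib_left
    using p_gt_1 by (intro sum_mono Lp_shift_le) auto
  then have "(\<integral>\<^sup>+t. indicator {0..1} t * (\<Sum>is\<in>tuples m. Lp_shift p (g (count_list is)) (t *\<^sub>R h)) \<partial>lborel)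
      \<le> (\<integral>\<^sup>+t. (ennreal (2 powr p) * (2 * top_norm)) * indicator {0..1::real} t \<partial>lborel)"
    by (intro nn_integral_mono) (auto simp: indicator_def)
  also have "\<dots> = ennreal (2 powr p) * (2 * top_norm)"
    by (subst nn_integral_cmult_indicator) auto
  finally show ?thesis unfolding modulus_def by (rule mult_left_mono) simp
qed

lemma modulus_small:
  assumes "0 < (e::real)"
  shows "\<exists>\<delta>>0. \<forall>h. norm h < \<delta> \<longrightarrow> modulus h \<le> ennreal e"
proof -
  have "((\<lambda>v. ennreal tuple_const * (\<Sum>is\<in>tuples m. Lp_shift p (g (count_list is)) v)) \<longlongrightarrow>
      ennreal tuple_const * (\<Sum>is\<in>(tuples m :: 'n list set). 0)) (at 0)"
    using p_gt_1 by (intro tendsto_mult_ennreal tendsto_const tendsto_sum Lp_shift_tendsto_0 g_Lp)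
      (auto simp: mi_size_count_list)
  then have "\<forall>\<^sub>F v in at 0. ennreal tuple_const * (\<Sum>is\<in>tuples m. Lp_shift p (g (count_list is)) v) < ennreal e"
    using assms by (intro order_tendstoD(2)) auto
  then obtain \<delta> where \<delta>: "0 < \<delta>" "\<And>v. v \<noteq> 0 \<Longrightarrow> norm v < \<delta> \<Longrightarrow>
      ennreal tuple_const * (\<Sum>is\<in>tuples m. Lp_shift p (g (count_list is)) v) < ennreal e"
    by (auto simp: eventually_at)
  have zero: "Lp_shift p (g \<alpha>) 0 = 0" for \<alpha> by (simp add: Lp_shift_def)
  have le: "ennreal tuple_const * (\<Sum>is\<in>tuples m. Lp_shift p (g (count_list is)) v) \<le> ennreal e" if "norm v < \<delta>" for v
    using \<delta>(2)[of v] that by (cases "v = 0") (auto simp: zero)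
  show ?thesis
  proof (intro exI[of _ \<delta>] conjI allI impI \<delta>(1))
    fix h :: "real ^ 'n" assume h: "norm h < \<delta>"
    have "modulus h = (\<integral>\<^sup>+t. indicator {0..1} t * (ennreal tuple_const * (\<Sum>is\<in>tuples m. Lp_shift p (g (count_list is)) (t *\<^sub>R h))) \<partial>lborel)"
      unfolding modulus_def Lp_shift_def
      by (subst nn_integral_cmult[symmetric]) (measurable, simp add: mult.left_commute)
    also have "\<dots> \<le> (\<integral>\<^sup>+t. ennreal e * indicator {0..1::real} t \<partial>lborel)"
    proof (intro nn_integral_mono)
      fix t :: real
      show "indicator {0..1} t * (ennreal tuple_const * (\<Sum>is\<in>tuples m. Lp_shift p (g (count_list is)) (t *\<^sub>R h))) \<le> ennreal e * indicator {0..1} t"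
      proof (cases "t \<in> {0..1}")
        case True
        then have "norm (t *\<^sub>R h) < \<delta>"
          using h mult_left_le_one_le[of "norm h" t] by (simp add: abs_of_nonneg)
        then show ?thesis using True le by simp
      qed simp
    qed
    also have "\<dots> = ennreal e" by (subst nn_integral_cmult_indicator) auto
    finally show "modulus h \<le> ennreal e" .
  qed
qed

text \<open>Since the kernel has integral \<open>1 / m!\<close>, the difference \<open>R - D / m!\<close> is the average, against the
kernel, of \<open>D(h, y + t h) - D(h, y)\<close>. Jensen's inequality and Tonelli's theorem turn this into the
p-th mean of translation differences.\<close>

lemma taylor_error_le: "taylor_error h \<le> ennreal ((norm h ^ m) powr p) * modulus h"
proof -
  let ?w = "taylor_weight m"
  let ?q = "\<lambda>y. dir_form g m y h"
  \<comment> \<open>Local integrability of \<open>?q\<close> on each of countably many boxes that exhaust the space.\<close>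
  have int: "AE y in lborel. integrable lborel (\<lambda>t. ?w t * ?q (y + t *\<^sub>R h))"
  proof -
    let ?b = "\<lambda>n::nat. box (- (real n *\<^sub>R One)) (real n *\<^sub>R One) :: (real ^ 'n) set"
    have "AE y in lborel. integrable lborel (\<lambda>t. ?w t * (?q (y + t *\<^sub>R h) * indicator (?b n) y))" for n
    proof -
      have "integrable (lborel \<Otimes>\<^sub>M lborel) (\<lambda>(t, y). ?w t * (?q (y + t *\<^sub>R h) * indicator (?b n) y))"
      proof (rule integrable_translates_left[where C = 1 and a = "- (real n *\<^sub>R One)" and b = "real n *\<^sub>R One"])
        show "loc_int ?q" by (rule loc_int_dir_form) simp
        show "indicator (?b n) x = 0" if "x \<notin> cbox (- (real n *\<^sub>R One)) (real n *\<^sub>R One)" for x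
          using that box_subset_cbox[of "- (real n *\<^sub>R One)" "real n *\<^sub>R One"] by (auto simp: indicator_def)
      qed (auto simp: taylor_weight_bound)
      from lborel_pair.AE_integrable_snd[OF this] show ?thesis .
    qed
    then have "AE y in lborel. \<forall>n. integrable lborel (\<lambda>t. ?w t * (?q (y + t *\<^sub>R h) * indicator (?b n) y))"
      by (simp add: AE_all_countable)
    then show ?thesis
    proof eventually_elim
      case (elim y)
      have "y \<in> (\<Union>n. ?b n)" by (simp add: UN_box_eq_UNIV)
      then obtain n where "y \<in> ?b n" by blast
      with elim[rule_format, of n] show ?case by simp
    qed
  qed
  have "AE y in lborel. ennreal (\<bar>remainder h y - ?q y / fact m\<bar> powr p) \<le>
      (\<integral>\<^sup>+t. indicator {0..1} t * ennreal (\<bar>?q (y + t *\<^sub>R h) - ?q y\<bar> powr p) \<partial>lborel)"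
    using remainder_representation[OF m_pos, of h] int
  proof eventually_elim
    case (elim y)
    let ?X = "\<lambda>t. (1 - t) ^ (m - 1) / fact (m - 1) * (?q (y + t *\<^sub>R h) - ?q y)"
    note hb = taylor_weight_integral[OF m_pos]
    have "remainder h y - ?q y / fact m = (\<integral>t. ?w t * ?q (y + t *\<^sub>R h) \<partial>lborel) - (\<integral>t. ?w t * ?q y \<partial>lborel)"
      using elim(1) has_bochner_integral_integral_eq[OF hb] by simp
    also have "\<dots> = (\<integral>t. ?w t * ?q (y + t *\<^sub>R h) - ?w t * ?q y \<partial>lborel)"
      using elim(2) integrable.intros[OF hb] by (intro Bochner_Integration.integral_diff[symmetric]) auto
    also have "\<dots> = (\<integral>t. indicator {0..1} t * ?X t \<partial>lborel)"
      by (intro Bochner_Integration.integral_cong) (auto simp: taylor_weight_def algebra_simps)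
    finally have "ennreal (\<bar>remainder h y - ?q y / fact m\<bar> powr p) \<le> (\<integral>\<^sup>+t. indicator {0..1} t * ennreal (\<bar>?X t\<bar> powr p) \<partial>lborel)"
      using powr_average_le[of ?X p] p_gt_1 by simp
    also have "\<dots> \<le> (\<integral>\<^sup>+t. indicator {0..1} t * ennreal (\<bar>?q (y + t *\<^sub>R h) - ?q y\<bar> powr p) \<partial>lborel)"
    proof (intro nn_integral_mono)
      fix t :: real
      show "indicator {0..1} t * ennreal (\<bar>?X t\<bar> powr p) \<le> indicator {0..1} t * ennreal (\<bar>?q (y + t *\<^sub>R h) - ?q y\<bar> powr p)"
      proof (cases "t \<in> {0..1}")
        case True
        then have "\<bar>(1 - t) ^ (m - 1) / fact (m - 1)\<bar> \<le> 1"
          using taylor_weight_bound[of m t] by (simp add: taylor_weight_def)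
        then have "\<bar>?X t\<bar> \<le> 1 * \<bar>?q (y + t *\<^sub>R h) - ?q y\<bar>"
          unfolding abs_mult by (intro mult_right_mono) auto
        then show ?thesis
          using True p_gt_1 by (auto intro!: ennreal_leI powr_mono2)
      qed simp
    qed
    finally show ?case .
  qed
  then have "taylor_error h \<le> (\<integral>\<^sup>+y. (\<integral>\<^sup>+t. indicator {0..1} t * ennreal (\<bar>?q (y + t *\<^sub>R h) - ?q y\<bar> powr p) \<partial>lborel) \<partial>lborel)"
    unfolding taylor_error_def by (rule nn_integral_mono_AE)
  also have "\<dots> = (\<integral>\<^sup>+t. (\<integral>\<^sup>+y. indicator {0..1} t * ennreal (\<bar>?q (y + t *\<^sub>R h) - ?q y\<bar> powr p) \<partial>lborel) \<partial>lborel)"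
    by (rule lborel_pair.Fubini') measurable
  also have "\<dots> \<le> (\<integral>\<^sup>+t. ennreal ((norm h ^ m) powr p) * (ennreal tuple_const *
      (indicator {0..1} t * (\<Sum>is\<in>tuples m. Lp_shift p (g (count_list is)) (t *\<^sub>R h)))) \<partial>lborel)"
  proof (intro nn_integral_mono)
    fix t :: real
    let ?g' = "\<lambda>\<alpha> y. g \<alpha> (y + t *\<^sub>R h) - g \<alpha> y"
    have diff: "?q (y + t *\<^sub>R h) - ?q y = dir_form ?g' m y h" for y
      by (simp add: dir_form_def sum_subtractf algebra_simps)
    have "(\<integral>\<^sup>+y. indicator {0..1} t * ennreal (\<bar>?q (y + t *\<^sub>R h) - ?q y\<bar> powr p) \<partial>lborel) \<le>
      (\<integral>\<^sup>+y. ennreal ((norm h ^ m) powr p) * (ennreal tuple_const * (indicator {0..1} t * (\<Sum>is\<in>tuples m. ennreal (\<bar>?g' (count_list is) y\<bar> powr p)))) \<partial>lborel)"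
    proof (intro nn_integral_mono)
      fix y
      have "\<bar>dir_form ?g' m y h\<bar> powr p \<le> (norm h ^ m) powr p * (tuple_const * (\<Sum>is\<in>tuples m. \<bar>?g' (count_list is) y\<bar> powr p))"
        unfolding tuple_const_def using p_gt_1 by (intro dir_form_powr_le) simp
      then have "ennreal (\<bar>dir_form ?g' m y h\<bar> powr p) \<le> ennreal ((norm h ^ m) powr p) * (ennreal tuple_const * (\<Sum>is\<in>tuples m. ennreal (\<bar>?g' (count_list is) y\<bar> powr p)))"
        using tuple_const_nonneg by (simp add: sum_nonneg flip: ennreal_mult)
      then show "indicator {0..1} t * ennreal (\<bar>?q (y + t *\<^sub>R h) - ?q y\<bar> powr p) \<le>
        ennreal ((norm h ^ m) powr p) * (ennreal tuple_const * (indicator {0..1} t * (\<Sum>is\<in>tuples m. ennreal (\<bar>?g' (count_list is) y\<bar> powr p))))"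
        unfolding diff by (auto simp: indicator_def)
    qed
    also have "\<dots> = ennreal ((norm h ^ m) powr p) * (ennreal tuple_const *
      (indicator {0..1} t * (\<Sum>is\<in>tuples m. Lp_shift p (g (count_list is)) (t *\<^sub>R h))))"
      unfolding Lp_shift_def by (simp add: nn_integral_cmult nn_integral_sum del: sum_ennreal)
    finally show "(\<integral>\<^sup>+y. indicator {0..1} t * ennreal (\<bar>?q (y + t *\<^sub>R h) - ?q y\<bar> powr p) \<partial>lborel) \<le>
      ennreal ((norm h ^ m) powr p) * (ennreal tuple_const *
      (indicator {0..1} t * (\<Sum>is\<in>tuples m. Lp_shift p (g (count_list is)) (t *\<^sub>R h))))" .
  qed
  also have "\<dots> = ennreal ((norm h ^ m) powr p) * modulus h"
    unfolding modulus_def Lp_shift_def by (simp add: nn_integral_cmult)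
  finally show ?thesis .
qed

end

section \<open>Energies against a radial weight\<close>

text \<open>Multiplicative errors \<open>1 + \<eta>\<close> are harmless in the limit because \<open>(1 + \<eta>) a\<close> tends to \<open>a\<close> as
\<open>\<eta> \<rightarrow> 0\<close>.\<close>

lemma tendsto_of_approximate_equality:
  fixes V Err :: "'a \<Rightarrow> ennreal"
  assumes approx: "\<And>\<eta>. 0 < \<eta> \<Longrightarrow> \<exists>C. (\<forall>\<^sub>F x in A. V x \<le> ennreal (1 + \<eta>) * L + ennreal C * Err x) \<and>
      (\<forall>\<^sub>F x in A. L \<le> ennreal (1 + \<eta>) * V x + ennreal C * Err x)"
    and Err: "(Err \<longlongrightarrow> 0) A"
  shows "(V \<longlongrightarrow> L) A"
proof -
  have near: "((\<lambda>\<eta>. ennreal (1 + \<eta>) * a) \<longlongrightarrow> a) (at_right 0)" for a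
  proof -
    have "((\<lambda>\<eta>::real. ennreal (1 + \<eta>) * a) \<longlongrightarrow> ennreal (1 + 0) * a) (at_right 0)"
      by (intro tendsto_mult_ennreal tendsto_ennrealI tendsto_intros) auto
    then show ?thesis by simp
  qed
  have pos: "\<forall>\<^sub>F \<eta> in at_right (0::real). 0 < \<eta>"
    by (rule eventually_at_right_less)
  have lim: "((\<lambda>x. b + ennreal C * Err x) \<longlongrightarrow> b) A" for b C
  proof -
    have "((\<lambda>x. b + ennreal C * Err x) \<longlongrightarrow> b + ennreal C * 0) A"
      by (intro tendsto_add tendsto_mult_ennreal tendsto_const Err) auto
    then show ?thesis by simp
  qed
  show ?thesis
  proof (rule order_tendstoI)
    fix a assume "a < L"
    have "\<forall>\<^sub>F \<eta> in at_right 0. ennreal (1 + \<eta>) * a < L"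
      by (rule order_tendstoD(2)[OF near \<open>a < L\<close>])
    then obtain \<eta> where \<eta>: "0 < \<eta>" "ennreal (1 + \<eta>) * a < L"
      using eventually_happens'[OF trivial_limit_at_right_real eventually_conj[OF pos]] by blast
    obtain C where C: "\<forall>\<^sub>F x in A. L \<le> ennreal (1 + \<eta>) * V x + ennreal C * Err x"
      using approx[OF \<eta>(1)] by blast
    have "\<forall>\<^sub>F x in A. ennreal (1 + \<eta>) * a + ennreal C * Err x < L"
      by (rule order_tendstoD(2)[OF lim \<eta>(2)])
    then show "\<forall>\<^sub>F x in A. a < V x"
      using C
    proof eventually_elim
      case (elim x)
      show ?case
      proof (rule ccontr)
        assume "\<not> a < V x"
        then have "ennreal (1 + \<eta>) * V x + ennreal C * Err x \<le> ennreal (1 + \<eta>) * a + ennreal C * Err x"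
          by (intro add_right_mono mult_left_mono) auto
        with elim show False by (meson leD order_trans)
      qed
    qed
  next
    fix a assume "L < a"
    have "\<forall>\<^sub>F \<eta> in at_right 0. ennreal (1 + \<eta>) * L < a"
      by (rule order_tendstoD(2)[OF near \<open>L < a\<close>])
    then obtain \<eta> where \<eta>: "0 < \<eta>" "ennreal (1 + \<eta>) * L < a"
      using eventually_happens'[OF trivial_limit_at_right_real eventually_conj[OF pos]] by blast
    obtain C where C: "\<forall>\<^sub>F x in A. V x \<le> ennreal (1 + \<eta>) * L + ennreal C * Err x"
      using approx[OF \<eta>(1)] by blast
    have "\<forall>\<^sub>F x in A. ennreal (1 + \<eta>) * L + ennreal C * Err x < a"
      by (rule order_tendstoD(2)[OF lim \<eta>(2)])
    then show "\<forall>\<^sub>F x in A. V x < a"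
      using C by eventually_elim (rule le_less_trans)
  qed
qed

locale anisotropic_energy = sobolev_derivatives m g p + symmetric_convex_body K
  for m :: nat and g :: "('n::finite \<Rightarrow> nat) \<Rightarrow> real ^ 'n \<Rightarrow> real" and p :: real
    and K :: "(real ^ 'n) set"
begin

definition weight :: "(real \<Rightarrow> real) \<Rightarrow> real ^ 'n \<Rightarrow> ennreal"
  where "weight w h = ennreal (w (norm_of K h) / norm_of K h powr (real m * p))"

definition energy :: "(real \<Rightarrow> real) \<Rightarrow> ennreal"
  where "energy w = (\<integral>\<^sup>+h. weight w h * (\<integral>\<^sup>+y. ennreal (\<bar>remainder h y\<bar> powr p) \<partial>lborel) \<partial>lborel)"

definition error_energy :: "(real \<Rightarrow> real) \<Rightarrow> ennreal"
  where "error_energy w = (\<integral>\<^sup>+h. weight w h * taylor_error h \<partial>lborel)"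

text \<open>The leading term divided by the power of the gauge that has the same homogeneity.\<close>

definition profile :: "real ^ 'n \<Rightarrow> ennreal"
  where "profile h = leading_term h * ennreal (1 / norm_of K h powr (real m * p))"

text \<open>The integral of the profile over the unit sphere of the gauge, in the measure of polar
coordinates; this is the limit of the energies.\<close>

definition sphere_mean :: ennreal
  where "sphere_mean = ennreal (real CARD('n)) * (\<integral>\<^sup>+h. profile h * indicator (interior K) h \<partial>lborel)"

lemma weight_borel [measurable]:
  assumes [measurable]: "w \<in> borel_measurable borel"
  shows "weight w \<in> borel_measurable borel"
  unfolding weight_def by measurable

lemma leading_term_borel [measurable]: "leading_term \<in> borel_measurable borel"
  unfolding leading_term_def by measurable

lemma taylor_error_borel [measurable]: "taylor_error \<in> borel_measurable borel"
  unfolding taylor_error_def by measurable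

lemma profile_borel [measurable]: "profile \<in> borel_measurable borel"
  unfolding profile_def by measurable

text \<open>At \<open>h = 0\<close> the quotient is 0 by the conventions for \<open>powr\<close> and division.\<close>

lemma power_norm_ratio:
  obtains B where "0 \<le> B" "\<And>h. (norm h ^ m) powr p / norm_of K h powr (real m * p) \<le> B"
proof -
  obtain B where B: "0 < B" "\<And>x. norm x \<le> B * norm_of K x" using norm_le_norm_of by blast
  show thesis
  proof (rule that)
    fix h :: "real ^ 'n"
    show "(norm h ^ m) powr p / norm_of K h powr (real m * p) \<le> B powr (real m * p)"
    proof (cases "h = 0")
      case True
      then show ?thesis using norm_of_eq_0_iff[of 0] by simp
    next
      case False
      then have N: "0 < norm_of K h" using norm_of_nonneg[of h] norm_of_eq_0_iff[of h] by linarith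
      have "(norm h ^ m) powr p = norm h powr (real m * p)"
        using False by (simp add: powr_realpow[symmetric] powr_powr)
      also have "\<dots> \<le> (B * norm_of K h) powr (real m * p)"
        using B p_gt_1 by (intro powr_mono2) auto
      also have "\<dots> = B powr (real m * p) * norm_of K h powr (real m * p)"
        using B N by (simp add: powr_mult)
      finally show ?thesis using N by (simp add: divide_le_eq)
    qed
  qed simp
qed

lemma profile_scale:
  assumes "0 < c"
  shows "profile (c *\<^sub>R h) = profile h"
proof -
  have "leading_term (c *\<^sub>R h) = ennreal (c powr (real m * p)) * leading_term h"
  proof -
    have "\<bar>dir_form g m y (c *\<^sub>R h) / fact m\<bar> powr p = c powr (real m * p) * \<bar>dir_form g m y h / fact m\<bar> powr p" for y
    proof -
      have "\<bar>dir_form g m y (c *\<^sub>R h) / fact m\<bar> = c ^ m * \<bar>dir_form g m y h / fact m\<bar>"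
        using assms by (simp add: dir_form_scale abs_mult)
      then have "\<bar>dir_form g m y (c *\<^sub>R h) / fact m\<bar> powr p = (c ^ m) powr p * \<bar>dir_form g m y h / fact m\<bar> powr p"
        using assms by (simp only: powr_mult zero_le_power less_imp_le abs_ge_zero)
      also have "(c ^ m) powr p = c powr (real m * p)"
        using assms by (simp add: powr_realpow[symmetric] powr_powr)
      finally show ?thesis .
    qed
    then show ?thesis
      unfolding leading_term_def by (simp add: ennreal_mult nn_integral_cmult)
  qed
  moreover have "ennreal (1 / norm_of K h powr (real m * p)) =
      ennreal (c powr (real m * p)) * ennreal (1 / norm_of K (c *\<^sub>R h) powr (real m * p))"
    using assms norm_of_nonneg[of h]
    by (simp add: norm_of_scale powr_mult flip: ennreal_mult)
  ultimately show ?thesis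
    unfolding profile_def by (simp add: mult_ac)
qed

lemma profile_bounded:
  obtains C where "\<And>h. profile h \<le> ennreal C"
proof -
  obtain B where B: "0 \<le> B" "\<And>h. (norm h ^ m) powr p / norm_of K h powr (real m * p) \<le> B"
    using power_norm_ratio by blast
  let ?T = "ennreal tuple_const * top_norm"
  have "profile h \<le> ennreal B * ?T" for h
  proof -
    have "profile h \<le> (ennreal ((norm h ^ m) powr p) * ?T) * ennreal (1 / norm_of K h powr (real m * p))"
      unfolding profile_def by (intro mult_right_mono leading_term_le) simp
    also have "\<dots> = ennreal ((norm h ^ m) powr p / norm_of K h powr (real m * p)) * ?T"
    proof -
      have "ennreal ((norm h ^ m) powr p / norm_of K h powr (real m * p)) =
          ennreal ((norm h ^ m) powr p) * ennreal (1 / norm_of K h powr (real m * p))"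
        by (simp flip: ennreal_mult)
      then show ?thesis by (simp only: mult_ac)
    qed
    also have "\<dots> \<le> ennreal B * ?T"
      by (intro mult_right_mono ennreal_leI B) simp
    finally show ?thesis .
  qed
  moreover have "ennreal B * ?T < \<infinity>"
    using top_norm_finite by (simp add: ennreal_mult_less_top)
  then obtain C where "ennreal B * ?T = ennreal C"
    by (metis ennreal_enn2real infinity_ennreal_def)
  ultimately show thesis using that by metis
qed

lemma profile_integral_finite: "(\<integral>\<^sup>+h. profile h * indicator (interior K) h \<partial>lborel) < \<infinity>"
proof -
  obtain C where C: "\<And>h. profile h \<le> ennreal C" using profile_bounded by blast
  have "(\<integral>\<^sup>+h. profile h * indicator (interior K) h \<partial>lborel) \<le> (\<integral>\<^sup>+h. ennreal C * indicator (interior K) h \<partial>lborel)"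
    by (intro nn_integral_mono mult_right_mono C) simp
  also have "\<dots> = ennreal C * emeasure lborel (interior K)"
    by (intro nn_integral_cmult_indicator) simp
  also have "\<dots> < \<infinity>" using emeasure_interior_K_finite by (simp add: ennreal_mult_less_top)
  finally show ?thesis .
qed

definition radial_mass :: "(real \<Rightarrow> real) \<Rightarrow> ennreal"
  where "radial_mass w = (\<integral>\<^sup>+r. indicator {0..} r * (ennreal (r ^ (CARD('n) - 1)) * ennreal (w r)) \<partial>lborel)"

lemma leading_energy:
  assumes [measurable]: "w \<in> borel_measurable borel" and w: "\<And>r. 0 \<le> w r"
  shows "(\<integral>\<^sup>+h. weight w h * leading_term h \<partial>lborel) = sphere_mean * radial_mass w"
proof -
  have "weight w h = ennreal (1 / norm_of K h powr (real m * p)) * ennreal (w (norm_of K h))" for h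
    unfolding weight_def using w by (simp flip: ennreal_mult)
  then have "(\<integral>\<^sup>+h. weight w h * leading_term h \<partial>lborel) = (\<integral>\<^sup>+h. profile h * ennreal (w (norm_of K h)) \<partial>lborel)"
    by (simp add: profile_def mult_ac)
  also have "\<dots> = sphere_mean * radial_mass w"
    unfolding sphere_mean_def radial_mass_def
    by (rule polar_integral[OF profile_borel _ profile_scale profile_integral_finite]) measurable
  finally show ?thesis .
qed

lemma radial_mass_norm:
  assumes [measurable]: "w \<in> borel_measurable borel"
  shows "(\<integral>\<^sup>+h. ennreal (w (norm_of K h)) \<partial>lborel) =
    ennreal (real CARD('n)) * emeasure lborel (interior K) * radial_mass w"
  using polar_integral[of "\<lambda>_. 1" "\<lambda>r. ennreal (w r)"] emeasure_interior_K_finite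
  by (simp add: radial_mass_def)

text \<open>The pointwise inequality \<open>pert\<close>, integrated twice: once with the remainder in the role of \<open>a\<close>
and the leading term in that of \<open>b\<close>, and once with the roles exchanged.\<close>

lemma energy_comparison:
  assumes [measurable]: "w \<in> borel_measurable borel" and w: "\<And>r. 0 \<le> w r"
    and mass: "radial_mass w = 1" and C: "0 < C"
    and pert: "\<And>a b. \<bar>a\<bar> powr p \<le> (1 + \<eta>) * \<bar>b\<bar> powr p + C * \<bar>a - b\<bar> powr p" and \<eta>: "0 < \<eta>"
  shows "energy w \<le> ennreal (1 + \<eta>) * sphere_mean + ennreal C * error_energy w"
    and "sphere_mean \<le> ennreal (1 + \<eta>) * energy w + ennreal C * error_energy w"
proof -
  have main: "(\<integral>\<^sup>+h. weight w h * (\<integral>\<^sup>+y. ennreal (\<bar>a h y\<bar> powr p) \<partial>lborel) \<partial>lborel) \<le>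
      ennreal (1 + \<eta>) * (\<integral>\<^sup>+h. weight w h * (\<integral>\<^sup>+y. ennreal (\<bar>b h y\<bar> powr p) \<partial>lborel) \<partial>lborel)
      + ennreal C * (\<integral>\<^sup>+h. weight w h * (\<integral>\<^sup>+y. ennreal (\<bar>a h y - b h y\<bar> powr p) \<partial>lborel) \<partial>lborel)"
    if [measurable]: "(\<lambda>(h, y). a h y) \<in> borel_measurable (borel \<Otimes>\<^sub>M borel)"
      "(\<lambda>(h, y). b h y) \<in> borel_measurable (borel \<Otimes>\<^sub>M borel)" for a b :: "real ^ 'n \<Rightarrow> real ^ 'n \<Rightarrow> real"
  proof -
    have "(\<integral>\<^sup>+y. ennreal (\<bar>a h y\<bar> powr p) \<partial>lborel) \<le>
        ennreal (1 + \<eta>) * (\<integral>\<^sup>+y. ennreal (\<bar>b h y\<bar> powr p) \<partial>lborel)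
        + ennreal C * (\<integral>\<^sup>+y. ennreal (\<bar>a h y - b h y\<bar> powr p) \<partial>lborel)" (is "?A h \<le> ennreal (1 + \<eta>) * ?B h + ennreal C * ?E h") for h
    proof -
      have "(\<integral>\<^sup>+y. ennreal (\<bar>a h y\<bar> powr p) \<partial>lborel) \<le>
        (\<integral>\<^sup>+y. ennreal (1 + \<eta>) * ennreal (\<bar>b h y\<bar> powr p) + ennreal C * ennreal (\<bar>a h y - b h y\<bar> powr p) \<partial>lborel)"
        using pert C \<eta> by (intro nn_integral_mono) (auto simp flip: ennreal_mult ennreal_plus)
      then show ?thesis by (simp add: nn_integral_add nn_integral_cmult)
    qed
    then have "weight w h * ?A h \<le> weight w h * (ennreal (1 + \<eta>) * ?B h + ennreal C * ?E h)" for h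
      by (rule mult_left_mono) simp
    also have "weight w h * (ennreal (1 + \<eta>) * ?B h + ennreal C * ?E h) =
        ennreal (1 + \<eta>) * (weight w h * ?B h) + ennreal C * (weight w h * ?E h)" for h
      by (simp only: distrib_left mult.left_commute)
    finally have "(\<integral>\<^sup>+h. weight w h * ?A h \<partial>lborel) \<le>
        (\<integral>\<^sup>+h. ennreal (1 + \<eta>) * (weight w h * ?B h) + ennreal C * (weight w h * ?E h) \<partial>lborel)"
      by (rule nn_integral_mono)
    also have "\<dots> = ennreal (1 + \<eta>) * (\<integral>\<^sup>+h. weight w h * ?B h \<partial>lborel)
        + ennreal C * (\<integral>\<^sup>+h. weight w h * ?E h \<partial>lborel)"
      by (simp add: nn_integral_add nn_integral_cmult)
    finally show ?thesis .
  qed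
  have lead: "(\<integral>\<^sup>+h. weight w h * (\<integral>\<^sup>+y. ennreal (\<bar>dir_form g m y h / fact m\<bar> powr p) \<partial>lborel) \<partial>lborel) = sphere_mean"
    using leading_energy[OF assms(1) w] mass unfolding leading_term_def by simp
  show "energy w \<le> ennreal (1 + \<eta>) * sphere_mean + ennreal C * error_energy w"
    unfolding energy_def error_energy_def taylor_error_def lead[symmetric] by (rule main) measurable
  have swap: "\<bar>remainder h y - dir_form g m y h / fact m\<bar> = \<bar>dir_form g m y h / fact m - remainder h y\<bar>" for h y
    by (rule abs_minus_commute)
  show "sphere_mean \<le> ennreal (1 + \<eta>) * energy w + ennreal C * error_energy w"
    unfolding energy_def error_energy_def taylor_error_def lead[symmetric] swap by (rule main) measurable
qed

end

section \<open>Concentration of the weights\<close>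

context anisotropic_energy
begin

definition ball_const :: ennreal
  where "ball_const = ennreal (real CARD('n)) * emeasure lborel (interior K)"

lemma ball_const_finite: "ball_const < \<infinity>"
  using emeasure_interior_K_finite by (simp add: ball_const_def ennreal_mult_less_top)

text \<open>Small increments contribute little because the modulus is small there, large ones because they
carry little weight.\<close>

lemma error_energy_le:
  assumes [measurable]: "w \<in> borel_measurable borel" and w: "\<And>r. 0 \<le> w r"
    and B: "0 \<le> B" "\<And>h. (norm h ^ m) powr p / norm_of K h powr (real m * p) \<le> B"
    and small: "\<And>h. norm_of K h < \<delta> \<Longrightarrow> modulus h \<le> ennreal e"
    and bound: "\<And>h. modulus h \<le> W"
  shows "error_energy w \<le> ennreal B * ennreal e * (ball_const * radial_mass w)
    + ennreal B * W * (ball_const * radial_mass (\<lambda>r. indicator {\<delta>..} r * w r))"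
proof -
  have pw: "weight w h * taylor_error h \<le> ennreal B * ennreal e * ennreal (w (norm_of K h))
      + ennreal B * W * ennreal (indicator {\<delta>..} (norm_of K h) * w (norm_of K h))" for h
  proof -
    let ?N = "norm_of K h powr (real m * p)"
    have "weight w h * taylor_error h \<le> ennreal (w (norm_of K h) / ?N) * (ennreal ((norm h ^ m) powr p) * modulus h)"
      unfolding weight_def by (intro mult_left_mono taylor_error_le) simp
    also have "\<dots> = ennreal ((norm h ^ m) powr p / ?N) * modulus h * ennreal (w (norm_of K h))"
    proof -
      have "ennreal (w (norm_of K h) / ?N) * ennreal ((norm h ^ m) powr p)
          = ennreal ((norm h ^ m) powr p / ?N) * ennreal (w (norm_of K h))"
        using w by (simp add: mult.commute flip: ennreal_mult)
      then show ?thesis by (simp only: mult.assoc[symmetric]) (simp only: mult_ac)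
    qed
    also have "\<dots> \<le> ennreal B * modulus h * ennreal (w (norm_of K h))"
      by (intro mult_right_mono ennreal_leI B) simp_all
    also have "\<dots> \<le> ennreal B * ennreal e * ennreal (w (norm_of K h))
      + ennreal B * W * ennreal (indicator {\<delta>..} (norm_of K h) * w (norm_of K h))"
    proof (cases "norm_of K h < \<delta>")
      case True
      have "ennreal B * modulus h * ennreal (w (norm_of K h)) \<le> ennreal B * ennreal e * ennreal (w (norm_of K h))"
        by (intro mult_right_mono mult_left_mono small True) simp_all
      then show ?thesis by (rule add_increasing2[rotated]) simp
    next
      case False
      have "ennreal B * modulus h * ennreal (w (norm_of K h)) \<le> ennreal B * W * ennreal (w (norm_of K h))"
        by (intro mult_right_mono mult_left_mono bound) simp_all
      then show ?thesis using False by (intro add_increasing) simp_all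
    qed
    finally show ?thesis .
  qed
  have "error_energy w \<le> (\<integral>\<^sup>+h. ennreal B * ennreal e * ennreal (w (norm_of K h))
      + ennreal B * W * ennreal (indicator {\<delta>..} (norm_of K h) * w (norm_of K h)) \<partial>lborel)"
    unfolding error_energy_def by (intro nn_integral_mono pw)
  also have "\<dots> = ennreal B * ennreal e * (\<integral>\<^sup>+h. ennreal (w (norm_of K h)) \<partial>lborel)
      + ennreal B * W * (\<integral>\<^sup>+h. ennreal (indicator {\<delta>..} (norm_of K h) * w (norm_of K h)) \<partial>lborel)"
    by (subst nn_integral_add) (simp_all add: nn_integral_cmult)
  also have "(\<integral>\<^sup>+h. ennreal (w (norm_of K h)) \<partial>lborel) = ball_const * radial_mass w"
    unfolding ball_const_def by (rule radial_mass_norm) measurable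
  also have "(\<integral>\<^sup>+h. ennreal (indicator {\<delta>..} (norm_of K h) * w (norm_of K h)) \<partial>lborel)
      = ball_const * radial_mass (\<lambda>r. indicator {\<delta>..} r * w r)"
    unfolding ball_const_def using radial_mass_norm[of "\<lambda>r. indicator {\<delta>..} r * w r"] by simp
  finally show ?thesis .
qed

lemma error_energy_tendsto_0:
  fixes w :: "'e \<Rightarrow> real \<Rightarrow> real"
  assumes [measurable]: "\<And>x. w x \<in> borel_measurable borel" and w: "\<And>x r. 0 \<le> w x r"
    and mass: "\<forall>\<^sub>F x in A. radial_mass (w x) = 1"
    and tail: "\<And>\<delta>. 0 < \<delta> \<Longrightarrow> ((\<lambda>x. radial_mass (\<lambda>r. indicator {\<delta>..} r * w x r)) \<longlongrightarrow> 0) A"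
  shows "((\<lambda>x. error_energy (w x)) \<longlongrightarrow> 0) A"
proof (rule tendsto_0_ennreal_approx)
  fix e :: real assume "0 < e"
  obtain B where B: "0 \<le> B" "\<And>h. (norm h ^ m) powr p / norm_of K h powr (real m * p) \<le> B"
    using power_norm_ratio by blast
  obtain k where k: "0 \<le> k" "ball_const = ennreal k"
    using ball_const_finite by (cases ball_const) auto
  let ?W = "ennreal tuple_const * (ennreal (2 powr p) * (2 * top_norm))"
  \<comment> \<open>Chosen such that \<open>B * e' * k \<le> e\<close> also when \<open>B * k = 0\<close>.\<close>
  define e' where "e' = e / (B * k + 1)"
  have e': "0 < e'" using \<open>0 < e\<close> B(1) k(1) by (simp add: e'_def add_nonneg_pos)
  obtain \<delta>0 where \<delta>0: "0 < \<delta>0" "\<And>h. norm h < \<delta>0 \<Longrightarrow> modulus h \<le> ennreal e'"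
    using modulus_small[OF e'] by blast
  obtain b where b: "0 < b" "\<And>x. norm x \<le> b * norm_of K x" using norm_le_norm_of by blast
  define \<delta> where "\<delta> = \<delta>0 / b"
  have \<delta>: "0 < \<delta>" using \<delta>0 b by (simp add: \<delta>_def)
  have small: "modulus h \<le> ennreal e'" if "norm_of K h < \<delta>" for h
  proof (rule \<delta>0(2))
    have "norm h \<le> b * norm_of K h" by (rule b)
    also have "\<dots> < b * \<delta>" using that b by simp
    finally show "norm h < \<delta>0" using b by (simp add: \<delta>_def)
  qed
  let ?G = "\<lambda>x. ennreal B * ?W * (ball_const * radial_mass (\<lambda>r. indicator {\<delta>..} r * w x r))"
  have "(?G \<longlongrightarrow> ennreal B * ?W * (ball_const * 0)) A"
    using top_norm_finite ball_const_finite
    by (intro tendsto_mult_ennreal tendsto_const tail \<delta>) (auto simp: ennreal_mult_eq_top_iff)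
  then have "(?G \<longlongrightarrow> 0) A" by simp
  moreover have "\<forall>\<^sub>F x in A. error_energy (w x) \<le> ?G x + ennreal e"
    using mass
  proof eventually_elim
    case (elim x)
    have "error_energy (w x) \<le> ennreal B * ennreal e' * (ball_const * radial_mass (w x)) + ?G x"
      by (rule error_energy_le[OF _ w B small modulus_le]) measurable
    also have "ennreal B * ennreal e' * (ball_const * radial_mass (w x)) = ennreal (B * e' * k)"
      using B(1) e' k by (simp add: elim ennreal_mult)
    also have "\<dots> \<le> ennreal e"
    proof (rule ennreal_leI)
      have "0 \<le> B * k" using B(1) k(1) by (rule mult_nonneg_nonneg)
      then have "B * k / (B * k + 1) \<le> 1" by (simp add: divide_le_eq)
      then have "e * (B * k / (B * k + 1)) \<le> e * 1" using \<open>0 < e\<close> by (intro mult_left_mono) auto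
      then show "B * e' * k \<le> e" by (simp add: e'_def mult_ac)
    qed
    finally show ?case by (simp add: add.commute)
  qed
  ultimately show "\<exists>G. (G \<longlongrightarrow> 0) A \<and> (\<forall>\<^sub>F x in A. error_energy (w x) \<le> G x + ennreal e)"
    by blast
qed

lemma energy_tendsto:
  fixes w :: "'e \<Rightarrow> real \<Rightarrow> real"
  assumes "\<And>x. w x \<in> borel_measurable borel" and "\<And>x r. 0 \<le> w x r"
    and mass: "\<forall>\<^sub>F x in A. radial_mass (w x) = 1"
    and "\<And>\<delta>. 0 < \<delta> \<Longrightarrow> ((\<lambda>x. radial_mass (\<lambda>r. indicator {\<delta>..} r * w x r)) \<longlongrightarrow> 0) A"
  shows "((\<lambda>x. energy (w x)) \<longlongrightarrow> sphere_mean) A"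
proof (rule tendsto_of_approximate_equality)
  show "((\<lambda>x. error_energy (w x)) \<longlongrightarrow> 0) A"
    using assms by (rule error_energy_tendsto_0)
  fix \<eta> :: real assume \<eta>: "0 < \<eta>"
  obtain C where C: "0 < C" "\<And>a b. \<bar>a\<bar> powr p \<le> (1 + \<eta>) * \<bar>b\<bar> powr p + C * \<bar>a - b\<bar> powr p"
    using powr_perturbation[OF p_gt_1 \<eta>] by blast
  note comp = energy_comparison[OF assms(1,2) _ C \<eta>]
  show "\<exists>C. (\<forall>\<^sub>F x in A. energy (w x) \<le> ennreal (1 + \<eta>) * sphere_mean + ennreal C * error_energy (w x)) \<and>
      (\<forall>\<^sub>F x in A. sphere_mean \<le> ennreal (1 + \<eta>) * energy (w x) + ennreal C * error_energy (w x))"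
    using mass by (intro exI[of _ C] conjI; elim eventually_mono) (auto intro: comp)
qed

text \<open>Polar coordinates for the weight \<open>r\<^bsup>mp\<^esup>\<close> on the unit interval recover the integral of the
leading term over the interior of \<open>K\<close>; the radial factor is the integral of \<open>r\<^bsup>N-1+mp\<^esup>\<close>, that is
\<open>1 / (N + mp)\<close>.\<close>

lemma sphere_mean_eq:
  "ennreal ((real CARD('n) + real m * p) / fact m powr p) *
    (\<integral>\<^sup>+h. indicator (interior K) h * (\<integral>\<^sup>+y. ennreal (\<bar>dir_form g m y h\<bar> powr p) \<partial>lborel) \<partial>lborel) = sphere_mean"
proof -
  let ?N = "real CARD('n)"
  let ?a = "real m * p"
  have pos: "0 < ?N + ?a" using p_gt_1 by (simp add: add_pos_nonneg)
  define w where "w r = indicator {..<1} r * r powr ?a" for r :: real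
  have [measurable]: "w \<in> borel_measurable borel" unfolding w_def by measurable
  have w: "0 \<le> w r" for r by (simp add: w_def)
  have "radial_mass w = (\<integral>\<^sup>+r. ennreal (r powr (?N - 1 + ?a)) * indicator {0..1} r \<partial>lborel)"
    unfolding radial_mass_def
  proof (intro nn_integral_cong_AE, use AE_lborel_singleton[of 0] AE_lborel_singleton[of 1] in eventually_elim)
    case (elim r)
    have "r ^ (CARD('n) - 1) = r powr (?N - 1)" if "0 < r"
      using that by (simp add: powr_realpow[symmetric])
    then show ?case
      using elim by (auto simp: w_def indicator_def powr_add simp flip: ennreal_mult)
  qed
  also have "\<dots> = ennreal (1 powr (?N - 1 + ?a + 1) / (?N - 1 + ?a + 1))"
    using pos by (intro nn_integral_has_integral_lebesgue' has_integral_powr_from_0) auto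
  finally have rad: "radial_mass w = ennreal (1 / (?N + ?a))" by simp
  have zero: "leading_term 0 = 0" using leading_term_le[of 0] m_pos p_gt_1 by (simp add: zero_power)
  have "weight w h * leading_term h = indicator (interior K) h * leading_term h" for h
  proof (cases "h = 0")
    case False
    then have "0 < norm_of K h" using norm_of_nonneg[of h] norm_of_eq_0_iff[of h] by linarith
    then show ?thesis
      by (auto simp: weight_def w_def indicator_def simp flip: norm_of_less_1)
  qed (simp add: zero)
  then have "(\<integral>\<^sup>+h. indicator (interior K) h * leading_term h \<partial>lborel) = sphere_mean * ennreal (1 / (?N + ?a))"
    using leading_energy[of w] w by (simp add: rad)
  then have eq: "ennreal (?N + ?a) * (\<integral>\<^sup>+h. indicator (interior K) h * leading_term h \<partial>lborel) = sphere_mean"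
    using pos by (simp add: mult.left_commute[of _ sphere_mean] flip: ennreal_mult)
  have lead: "leading_term h = ennreal (1 / fact m powr p) * (\<integral>\<^sup>+y. ennreal (\<bar>dir_form g m y h\<bar> powr p) \<partial>lborel)" for h
    unfolding leading_term_def
    by (subst nn_integral_cmult[symmetric])
       (auto intro!: nn_integral_cong simp: powr_divide abs_divide simp flip: ennreal_mult)
  have "(\<integral>\<^sup>+h. indicator (interior K) h * leading_term h \<partial>lborel) = ennreal (1 / fact m powr p) *
      (\<integral>\<^sup>+h. indicator (interior K) h * (\<integral>\<^sup>+y. ennreal (\<bar>dir_form g m y h\<bar> powr p) \<partial>lborel) \<partial>lborel)"
    unfolding lead by (subst nn_integral_cmult[symmetric]) (auto simp: mult.left_commute)
  moreover have "ennreal ((?N + ?a) / fact m powr p) = ennreal (?N + ?a) * ennreal (1 / fact m powr p)"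
    using pos by (simp flip: ennreal_mult)
  ultimately show ?thesis using eq by (simp add: mult.assoc)
qed

end

section \<open>Multi-indices and tuples\<close>

lemma prod_tuple_eq_mi_power: "(\<Prod>k<length is. h $ (is ! k)) = mi_power h (count_list is)"
proof (induction "is")
  case (Cons a xs)
  have "mi_power h (count_list (a # xs)) = (\<Prod>i\<in>UNIV. (if i = a then h $ a else 1) * h $ i ^ count_list xs i)"
    unfolding mi_power_def by (intro prod.cong) auto
  also have "\<dots> = h $ a * mi_power h (count_list xs)"
    unfolding mi_power_def prod.distrib by simp
  finally show ?case
    unfolding length_Cons prod.lessThan_Suc_shift using Cons by (simp del: count_list.simps)
qed (simp add: mi_power_def)

text \<open>Tuples with prescribed multiplicities are the permutations of one multiset, and their number is
the multinomial coefficient \<open>\<bar>\<alpha>\<bar>! / \<alpha>!\<close>.\<close>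

lemma card_tuples_count:
  fixes \<alpha> :: "'n::finite \<Rightarrow> nat"
  shows "real (card {is. count_list is = \<alpha>}) * mi_fact \<alpha> = fact (mi_size \<alpha>)"
proof -
  obtain xs where xs: "count_list xs = \<alpha>" using ex_count_list_eq by blast
  have set: "{is. count_list is = \<alpha>} = permutations_of_multiset (mset xs)"
    unfolding permutations_of_multiset_def xs[symmetric]
    by (auto simp: multiset_eq_iff fun_eq_iff count_mset)
  have "(\<Prod>x\<in>set_mset (mset xs). fact (count (mset xs) x)) = (\<Prod>i\<in>UNIV. fact (\<alpha> i) :: nat)"
    by (rule prod.mono_neutral_cong_left) (auto simp: count_mset xs[symmetric] count_list_0_iff)
  then have "card (permutations_of_multiset (mset xs)) * (\<Prod>i\<in>UNIV. fact (\<alpha> i)) = fact (length xs)"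
    using card_permutations_of_multiset_aux[of "mset xs"] by simp
  then have "real (card (permutations_of_multiset (mset xs)) * (\<Prod>i\<in>UNIV. fact (\<alpha> i))) = real (fact (length xs))"
    by simp
  then show ?thesis
    unfolding set mi_fact_def using mi_size_count_list[of xs] xs by simp
qed

lemma sum_tuples_eq_sum_mi:
  fixes G :: "('n::finite \<Rightarrow> nat) \<Rightarrow> real ^ 'n \<Rightarrow> real"
  shows "1 / fact j * dir_form G j y h = (\<Sum>\<alpha> | mi_size \<alpha> = j. G \<alpha> y * mi_power h \<alpha> / mi_fact \<alpha>)"
proof -
  have fin: "finite {\<alpha> :: 'n \<Rightarrow> nat. mi_size \<alpha> = j}"
    by (rule finite_subset[OF _ finite_mi_size_le[of j]]) auto
  have "dir_form G j y h = (\<Sum>is\<in>tuples j. mi_power h (count_list is) * G (count_list is) y)"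
    unfolding dir_form_def using prod_tuple_eq_mi_power[of h] by (intro sum.cong) auto
  also have "\<dots> = (\<Sum>\<alpha>\<in>{\<alpha>. mi_size \<alpha> = j}. \<Sum>is\<in>{is \<in> tuples j. count_list is = \<alpha>}. mi_power h (count_list is) * G (count_list is) y)"
    by (rule sum.group[symmetric, OF finite_tuples fin]) (auto simp: mi_size_count_list)
  also have "\<dots> = (\<Sum>\<alpha>\<in>{\<alpha>. mi_size \<alpha> = j}. fact j * (G \<alpha> y * mi_power h \<alpha> / mi_fact \<alpha>))"
  proof (intro sum.cong refl)
    fix \<alpha> :: "'n \<Rightarrow> nat" assume "\<alpha> \<in> {\<alpha>. mi_size \<alpha> = j}"
    then have j: "mi_size \<alpha> = j" by simp
    have "{is \<in> tuples j. count_list is = \<alpha>} = {is. count_list is = \<alpha>}"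
      by (auto simp: mi_size_count_list j[symmetric])
    moreover have "mi_fact \<alpha> \<noteq> 0" by (simp add: mi_fact_def)
    ultimately show "(\<Sum>is\<in>{is \<in> tuples j. count_list is = \<alpha>}. mi_power h (count_list is) * G (count_list is) y)
        = fact j * (G \<alpha> y * mi_power h \<alpha> / mi_fact \<alpha>)"
      using card_tuples_count[of \<alpha>] by (simp add: j field_simps flip: \<open>mi_size \<alpha> = j\<close>)
  qed
  also have "\<dots> = fact j * (\<Sum>\<alpha> | mi_size \<alpha> = j. G \<alpha> y * mi_power h \<alpha> / mi_fact \<alpha>)"
    by (simp only: sum_distrib_left)
  finally show ?thesis by simp
qed

text \<open>Taylor polynomials by tuples and by multi-indices agree: the multinomial coefficients cancel
\<open>1 / j!\<close> against \<open>1 / \<alpha>!\<close>.\<close>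

lemma sum_dir_form_eq_taylor:
  fixes G :: "('n::finite \<Rightarrow> nat) \<Rightarrow> real ^ 'n \<Rightarrow> real"
  assumes "0 < m"
  shows "(\<Sum>j<m. 1 / fact j * dir_form G j y h) =
    (\<Sum>\<alpha> | mi_size \<alpha> \<le> m - 1. G \<alpha> y * mi_power h \<alpha> / mi_fact \<alpha>)"
proof -
  let ?F = "\<lambda>\<alpha>. G \<alpha> y * mi_power h \<alpha> / mi_fact \<alpha>"
  have "(\<Sum>\<alpha> | mi_size \<alpha> \<le> m - 1. ?F \<alpha>) = (\<Sum>j<m. \<Sum>\<alpha>\<in>{\<alpha> \<in> {\<alpha>. mi_size \<alpha> \<le> m - 1}. mi_size \<alpha> = j}. ?F \<alpha>)"
    using assms by (intro sum.group[symmetric] finite_mi_size_le) auto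
  also have "\<dots> = (\<Sum>j<m. \<Sum>\<alpha> | mi_size \<alpha> = j. ?F \<alpha>)"
    by (intro sum.cong refl) auto
  finally show ?thesis by (simp only: sum_tuples_eq_sum_mi)
qed

section \<open>Borel representatives of weak derivatives\<close>

lemma locally_integrable_measurable:
  fixes f :: "real ^ 'n::finite \<Rightarrow> real"
  assumes "locally_integrable f"
  shows "f \<in> borel_measurable lebesgue"
proof (rule borel_measurable_LIMSEQ_real)
  let ?C = "\<lambda>n::nat. cbox (- (real n *\<^sub>R One)) (real n *\<^sub>R One) :: (real ^ 'n) set"
  show "(\<lambda>x. indicator (?C k) x * f x) \<in> borel_measurable lebesgue" for k
    using assms by (intro borel_measurable_integrable) (simp add: locally_integrable_def set_integrable_def)
  fix x :: "real ^ 'n"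
  have "x \<in> (\<Union>n. box (- (real n *\<^sub>R One)) (real n *\<^sub>R One))" by (simp add: UN_box_eq_UNIV)
  then obtain n where n: "x \<in> box (- (real n *\<^sub>R One)) (real n *\<^sub>R One)" by blast
  have "x \<in> ?C k" if "k \<ge> n" for k
  proof -
    have "- real k \<le> x \<bullet> i \<and> x \<bullet> i \<le> real k" if "i \<in> Basis" for i
      using n that \<open>k \<ge> n\<close> by (fastforce simp: mem_box)
    then show ?thesis by (simp add: mem_box)
  qed
  then show "(\<lambda>k. indicator (?C k) x * f x) \<longlonglongrightarrow> f x"
    by (intro tendsto_eventually eventually_sequentiallyI[of n]) simp
qed

lemma locally_integrable_borel_representative:
  fixes f :: "real ^ 'n::finite \<Rightarrow> real"
  assumes "locally_integrable f"
  obtains f' where "loc_int f'" "AE x in lborel. f x = f' x"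
proof -
  have int: "integrable lebesgue (\<lambda>x. indicator (cbox a b) x * f x)" for a b
    using assms by (simp add: locally_integrable_def set_integrable_def)
  have "f \<in> borel_measurable lebesgue" by (rule locally_integrable_measurable[OF assms])
  then obtain f' where f': "f' \<in> borel_measurable lborel" "AE x in lborel. f x = f' x"
    using completion_ex_borel_measurable_real by blast
  then have [measurable]: "f' \<in> borel_measurable borel" by simp
  have "integrable lborel (\<lambda>x. indicator (cbox a b) x * f' x)" for a b
  proof -
    have "AE x in lebesgue. indicator (cbox a b) x * f x = indicator (cbox a b) x * f' x"
      using AE_completion[OF f'(2)] by eventually_elim simp
    moreover have m: "(\<lambda>x. indicator (cbox a b) x * f' x) \<in> borel_measurable lborel" by measurable
    ultimately have "integrable lebesgue (\<lambda>x. indicator (cbox a b) x * f' x)"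
      using int[of a b] integrable_cong_AE[OF borel_measurable_integrable[OF int[of a b]] measurable_completion[OF m]]
      by blast
    then show ?thesis using integrable_completion[OF m] by blast
  qed
  then have "loc_int f'" by (simp add: loc_int_def)
  with f'(2) that show thesis by blast
qed

lemma lebesgue_integral_eq_borel:
  fixes f f' \<phi> :: "real ^ 'n::finite \<Rightarrow> real"
  assumes [measurable]: "f' \<in> borel_measurable borel" "\<phi> \<in> borel_measurable borel"
    and f: "f \<in> borel_measurable lebesgue" and eq: "AE x in lborel. f x = f' x"
  shows "(LINT x|lebesgue. f x * \<phi> x) = (\<integral>x. f' x * \<phi> x \<partial>lborel)"
proof -
  have ae: "AE x in lebesgue. f x * \<phi> x = f' x * \<phi> x"
    using AE_completion[OF eq] by eventually_elim simp
  have m: "(\<lambda>x. f' x * \<phi> x) \<in> borel_measurable lborel" by measurable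
  have "\<phi> \<in> borel_measurable lebesgue" by (rule measurable_completion) simp
  with f have "(\<lambda>x. f x * \<phi> x) \<in> borel_measurable lebesgue" by (rule borel_measurable_times)
  then have "(LINT x|lebesgue. f x * \<phi> x) = (LINT x|lebesgue. f' x * \<phi> x)"
    using measurable_completion[OF m] ae by (rule integral_cong_AE)
  also have "\<dots> = (\<integral>x. f' x * \<phi> x \<partial>lborel)" by (rule integral_completion[OF m])
  finally show ?thesis .
qed

lemma has_weak_deriv_tensor:
  assumes wd: "has_weak_deriv \<alpha> f h" and f': "loc_int f'" "AE x in lborel. f x = f' x"
    and h': "loc_int h'" "AE x in lborel. h x = h' x" and u: "tensor_test u a b"
  shows "(\<integral>x. f' x * tensor_deriv \<alpha> u x \<partial>lborel) = (- 1) ^ mi_size \<alpha> * (\<integral>x. h' x * tensor u x \<partial>lborel)"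
proof -
  have [measurable]: "tensor_deriv \<alpha> u \<in> borel_measurable borel" "tensor u \<in> borel_measurable borel"
    using tensor_deriv_borel[OF u] tensor_deriv_borel[OF u, of "\<lambda>_. 0"] by (auto simp: tensor_deriv_0)
  have "(LINT x|lebesgue. f x * mixed_partial \<alpha> (tensor u) x) = (- 1) ^ mi_size \<alpha> * (LINT x|lebesgue. h x * tensor u x)"
    using wd tensor_test_imp_test_function[OF u] by (simp add: has_weak_deriv_def)
  moreover have mf: "f \<in> borel_measurable lebesgue" and mh: "h \<in> borel_measurable lebesgue"
    using wd by (auto simp: has_weak_deriv_def intro: locally_integrable_measurable)
  moreover have "mixed_partial \<alpha> (tensor u) = tensor_deriv \<alpha> u"
    using u by (intro mixed_partial_tensor) (simp add: tensor_test_def)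
  ultimately show ?thesis
    using lebesgue_integral_eq_borel[OF loc_int_borel[OF f'(1)] _ mf f'(2), of "tensor_deriv \<alpha> u"]
      lebesgue_integral_eq_borel[OF loc_int_borel[OF h'(1)] _ mh h'(2), of "tensor u"] by simp
qed

text \<open>Two weak derivatives give the same value on all tensor test functions.\<close>

lemma weak_deriv_unique:
  fixes f h1 h2 :: "real ^ 'n::finite \<Rightarrow> real"
  assumes "has_weak_deriv \<alpha> f h1" "has_weak_deriv \<alpha> f h2"
  shows "AE x in lborel. h1 x = h2 x"
proof -
  have "locally_integrable f" "locally_integrable h1" "locally_integrable h2"
    using assms by (auto simp: has_weak_deriv_def)
  note loc = this
  obtain f' where f': "loc_int f'" "AE x in lborel. f x = f' x"
    using locally_integrable_borel_representative[OF loc(1)] .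
  obtain k1 where k1: "loc_int k1" "AE x in lborel. h1 x = k1 x"
    using locally_integrable_borel_representative[OF loc(2)] .
  obtain k2 where k2: "loc_int k2" "AE x in lborel. h2 x = k2 x"
    using locally_integrable_borel_representative[OF loc(3)] .
  have "AE x in lborel. k1 x + - 1 * k2 x = 0"
  proof (rule AE_zero_if_tensor_tests_vanish)
    show "loc_int (\<lambda>x. k1 x + - 1 * k2 x)" using k1(1) k2(1) by (intro loc_int_add loc_int_cmult)
    fix u and a b :: "real ^ 'n" assume u: "tensor_test u a b"
    have i: "integrable lborel (\<lambda>x. k x * tensor u x)" if "loc_int k" for k
      using integrable_tensor_deriv[OF that u, of "\<lambda>_. 0"] by (simp add: tensor_deriv_0)
    have "(- 1) ^ mi_size \<alpha> * (\<integral>x. k1 x * tensor u x \<partial>lborel) = (- 1) ^ mi_size \<alpha> * (\<integral>x. k2 x * tensor u x \<partial>lborel)"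
      using has_weak_deriv_tensor[OF assms(1) f' k1 u] has_weak_deriv_tensor[OF assms(2) f' k2 u] by simp
    then show "(\<integral>x. (k1 x + - 1 * k2 x) * tensor u x \<partial>lborel) = 0"
      using Bochner_Integration.integral_diff[OF i[OF k1(1)] i[OF k2(1)]] by (simp add: left_diff_distrib)
  qed
  with k1(2) k2(2) show ?thesis by eventually_elim simp
qed

text \<open>The derivative selected by \<open>weak_deriv\<close> coincides almost everywhere with the p-integrable one
that the Sobolev space provides, and for the zero multi-index with \<open>f\<close>. Multi-indices of size larger
than \<open>m\<close>, for which there may be no weak derivative, are assigned the zero function.\<close>

lemma sobolev_representatives:
  fixes f :: "real ^ 'n::finite \<Rightarrow> real"
  assumes f: "f \<in> sobolev_space m p" and "0 < m" "1 < p"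
  obtains g where "sobolev_derivatives m g p" "AE x in lborel. f x = g (\<lambda>_. 0) x"
    "\<And>\<alpha>. mi_size \<alpha> \<le> m \<Longrightarrow> AE x in lborel. weak_deriv \<alpha> f x = g \<alpha> x"
proof -
  have wd: "has_weak_deriv \<alpha> f (weak_deriv \<alpha> f)" if "mi_size \<alpha> \<le> m" for \<alpha>
  proof -
    have "\<exists>h. has_weak_deriv \<alpha> f h" using f that by (auto simp: sobolev_space_def)
    then show ?thesis unfolding weak_deriv_def by (rule someI_ex)
  qed
  have "\<exists>g. loc_int g \<and> (mi_size \<alpha> \<le> m \<longrightarrow> (AE x in lborel. weak_deriv \<alpha> f x = g x))" for \<alpha>
  proof (cases "mi_size \<alpha> \<le> m")
    case True
    then have "locally_integrable (weak_deriv \<alpha> f)" using wd by (simp add: has_weak_deriv_def)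
    then obtain h where "loc_int h" "AE x in lborel. weak_deriv \<alpha> f x = h x"
      by (rule locally_integrable_borel_representative)
    then show ?thesis by blast
  next
    case False
    then show ?thesis by (intro exI[of _ "\<lambda>_. 0"]) (simp add: loc_int_def)
  qed
  then obtain g where g: "\<And>\<alpha>. loc_int (g \<alpha>)"
    "\<And>\<alpha>. mi_size \<alpha> \<le> m \<Longrightarrow> AE x in lborel. weak_deriv \<alpha> f x = g \<alpha> x"
    using choice[of "\<lambda>\<alpha> g. loc_int g \<and> (mi_size \<alpha> \<le> m \<longrightarrow> (AE x in lborel. weak_deriv \<alpha> f x = g x))"] by blast
  have wd0: "has_weak_deriv (\<lambda>_. 0) f (weak_deriv (\<lambda>_. 0) f)" using wd by (simp add: mi_size_0)
  have loc_f: "locally_integrable f" using wd0 by (simp add: has_weak_deriv_def)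
  have "has_weak_deriv (\<lambda>_. 0) f f"
  proof -
    have "mixed_partial (\<lambda>_. 0) \<phi> = \<phi>" for \<phi> :: "real ^ 'n \<Rightarrow> real"
    proof -
      have "count_list (SOME is. count_list is = (\<lambda>_::'n. 0)) = (\<lambda>_. 0)"
        by (rule someI_ex[OF ex_count_list_eq])
      then have "length (SOME is. count_list is = (\<lambda>_::'n. 0)) = 0"
        using mi_size_count_list[of "SOME is. count_list is = (\<lambda>_::'n. 0)"] by (simp add: mi_size_0)
      then show ?thesis by (simp add: mixed_partial_def)
    qed
    with loc_f show ?thesis by (simp add: has_weak_deriv_def mi_size_0)
  qed
  then have "AE x in lborel. f x = weak_deriv (\<lambda>_. 0) f x" by (rule weak_deriv_unique[OF _ wd0])
  moreover have "AE x in lborel. weak_deriv (\<lambda>_. 0) f x = g (\<lambda>_. 0) x" by (rule g(2)) (simp add: mi_size_0)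
  ultimately have f0: "AE x in lborel. f x = g (\<lambda>_. 0) x" by eventually_elim simp
  have "sobolev_derivatives m g p"
  proof
    show "(\<integral>x. g (\<lambda>_. 0) x * tensor_deriv \<alpha> u x \<partial>lborel) = (- 1) ^ mi_size \<alpha> * (\<integral>x. g \<alpha> x * tensor u x \<partial>lborel)"
      if "mi_size \<alpha> \<le> m" "tensor_test u a b" for \<alpha> u a b
      using that by (intro has_weak_deriv_tensor[OF wd _ f0 _ g(2)] g(1))
    show "integrable lborel (\<lambda>x. \<bar>g \<alpha> x\<bar> powr p)" if \<alpha>: "mi_size \<alpha> = m" for \<alpha>
    proof -
      obtain q where q: "q \<in> Lp_space p" "has_weak_deriv \<alpha> f q"
        using f \<alpha> by (auto simp: sobolev_space_def)
      have "AE x in lborel. q x = weak_deriv \<alpha> f x" using q(2) wd \<alpha> by (intro weak_deriv_unique) auto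
      moreover have "AE x in lborel. weak_deriv \<alpha> f x = g \<alpha> x" using \<alpha> by (intro g(2)) simp
      ultimately have "AE x in lborel. \<bar>q x\<bar> powr p = \<bar>g \<alpha> x\<bar> powr p" by eventually_elim simp
      then have ae: "AE x in lebesgue. \<bar>q x\<bar> powr p = \<bar>g \<alpha> x\<bar> powr p" by (rule AE_completion)
      have [measurable]: "g \<alpha> \<in> borel_measurable borel" by (rule loc_int_borel[OF g(1)])
      have m: "(\<lambda>x. \<bar>g \<alpha> x\<bar> powr p) \<in> borel_measurable lborel" by measurable
      have "integrable lebesgue (\<lambda>x. \<bar>q x\<bar> powr p)" using q(1) by (simp add: Lp_space_def)
      then have "integrable lebesgue (\<lambda>x. \<bar>g \<alpha> x\<bar> powr p)"
        using integrable_cong_AE[OF borel_measurable_integrable measurable_completion[OF m] ae] by blast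
      then show ?thesis using integrable_completion[OF m] by blast
    qed
  next
    show "g \<alpha> \<in> borel_measurable borel" for \<alpha> by (rule loc_int_borel[OF g(1)])
  qed (use g(1) assms(2,3) in simp_all)
  with f0 g(2) that show thesis by blast
qed

section \<open>The double integral as an energy\<close>

lemma half_line_borel_representative:
  fixes \<rho> :: "real \<Rightarrow> real"
  assumes "\<rho> \<in> borel_measurable (lebesgue_on {0..})" and nonneg: "\<And>r. 0 \<le> r \<Longrightarrow> 0 \<le> \<rho> r"
  obtains w where "w \<in> borel_measurable borel" "\<And>r. 0 \<le> w r" "AE r in lborel. 0 \<le> r \<longrightarrow> \<rho> r = w r"
proof -
  have "(\<lambda>r. indicator {0..} r *\<^sub>R \<rho> r) \<in> borel_measurable lebesgue"
    using assms(1) by (subst (asm) borel_measurable_restrict_space_iff) auto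
  then obtain v where v: "v \<in> borel_measurable lborel" "AE r in lborel. indicator {0..} r *\<^sub>R \<rho> r = v r"
    using completion_ex_borel_measurable_real by blast
  show thesis
  proof (rule that[of "\<lambda>r. max 0 (v r)"])
    show "(\<lambda>r. max 0 (v r)) \<in> borel_measurable borel" using v(1) by simp
    show "AE r in lborel. 0 \<le> r \<longrightarrow> \<rho> r = max 0 (v r)"
      using v(2)
    proof eventually_elim
      case (elim r)
      show ?case
      proof
        assume r: "0 \<le> r"
        then have "v r = \<rho> r" using elim by simp
        with nonneg[OF r] show "\<rho> r = max 0 (v r)" by simp
      qed
    qed
  qed simp
qed

context anisotropic_energy
begin

lemma radial_mass_lebesgue:
  assumes ae: "AE r in lborel. 0 \<le> r \<longrightarrow> \<rho> r = w r" and w: "\<And>r. 0 \<le> w r" and "0 \<le> \<delta>"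
  shows "radial_mass (\<lambda>r. indicator {\<delta>..} r * w r) =
    (\<integral>\<^sup>+r\<in>{\<delta>..}. ennreal (r ^ (CARD('n) - 1) * \<rho> r) \<partial>lebesgue)"
  unfolding radial_mass_def nn_integral_completion
  by (intro nn_integral_cong_AE, use ae in eventually_elim)
     (use w \<open>0 \<le> \<delta>\<close> in \<open>auto simp: indicator_def ennreal_mult\<close>)

text \<open>In polar coordinates a set of radii of length 0 carries no volume.\<close>

lemma AE_radial:
  assumes ae: "AE r in lborel. 0 \<le> r \<longrightarrow> \<rho> r = w r"
  shows "AE x in lborel. \<rho> (norm_of K (x - y)) = w (norm_of K (x - y))"
proof -
  obtain Z where Z: "Z \<in> null_sets lborel" "\<And>r. 0 \<le> r \<Longrightarrow> r \<notin> Z \<Longrightarrow> \<rho> r = w r"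
    using ae unfolding eventually_ae_filter by (auto simp: subset_eq)
  then have [measurable]: "Z \<in> sets borel" by auto
  have aeZ: "AE r in lborel. r \<notin> Z" using Z(1) by (rule AE_not_in)
  have "(\<integral>\<^sup>+x. indicator Z (norm_of K (x - y)) \<partial>lborel) = (\<integral>\<^sup>+x. ennreal (indicator Z (norm_of K x)) \<partial>lborel)"
    using nn_integral_translate[of "\<lambda>x. indicator Z (norm_of K x)" "- y"] by (simp add: ennreal_indicator)
  also have "\<dots> = ball_const * radial_mass (indicator Z)"
    unfolding ball_const_def by (rule radial_mass_norm) measurable
  also have "radial_mass (indicator Z) = 0"
    unfolding radial_mass_def
    by (subst nn_integral_0_iff_AE, measurable, use aeZ in eventually_elim) simp
  finally have "(\<integral>\<^sup>+x. indicator Z (norm_of K (x - y)) \<partial>lborel) = 0" by simp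
  then have "AE x in lborel. indicator Z (norm_of K (x - y)) = (0::ennreal)"
    by (subst (asm) nn_integral_0_iff_AE) measurable
  then show ?thesis
    by eventually_elim (use Z(2) norm_of_nonneg in \<open>auto simp: indicator_def split: if_splits\<close>)
qed

text \<open>For almost every \<open>y\<close> the inner integrand agrees for almost every \<open>x\<close> with a Borel function of
\<open>x - y\<close> and \<open>y\<close>; only after this replacement does Tonelli's theorem allow the integration in \<open>y\<close> to be
done first.\<close>

lemma double_integral_eq_energy:
  assumes f: "AE x in lborel. f x = g (\<lambda>_. 0) x"
    and wd: "\<And>\<alpha>. mi_size \<alpha> \<le> m \<Longrightarrow> AE x in lborel. weak_deriv \<alpha> f x = g \<alpha> x"
    and [measurable]: "w \<in> borel_measurable borel" and ae: "AE r in lborel. 0 \<le> r \<longrightarrow> \<rho> r = w r"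
    and w: "\<And>r. 0 \<le> w r"
  shows "(\<integral>\<^sup>+y. (\<integral>\<^sup>+x. ennreal
              (\<bar>taylor_remainder (m - 1) f x y\<bar> powr p / norm_of K (x - y) powr (real m * p)
                 * \<rho> (norm_of K (x - y))) \<partial>lebesgue) \<partial>lebesgue) = energy w"
proof -
  have "AE y in lborel. \<forall>\<alpha>\<in>{\<alpha>. mi_size \<alpha> \<le> m - 1}. weak_deriv \<alpha> f y = g \<alpha> y"
    using wd by (intro AE_finite_allI finite_mi_size_le) auto
  then have "AE y in lborel. (\<integral>\<^sup>+x. ennreal
              (\<bar>taylor_remainder (m - 1) f x y\<bar> powr p / norm_of K (x - y) powr (real m * p)
                 * \<rho> (norm_of K (x - y))) \<partial>lborel) =
      (\<integral>\<^sup>+h. weight w h * ennreal (\<bar>remainder h y\<bar> powr p) \<partial>lborel)"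
  proof eventually_elim
    case (elim y)
    have taylor: "taylor_poly (m - 1) f y x = (\<Sum>j<m. 1 / fact j * dir_form g j y (x - y))" for x
      unfolding sum_dir_form_eq_taylor[OF m_pos] taylor_poly_def using elim by (intro sum.cong) auto
    have "(\<integral>\<^sup>+x. ennreal
              (\<bar>taylor_remainder (m - 1) f x y\<bar> powr p / norm_of K (x - y) powr (real m * p)
                 * \<rho> (norm_of K (x - y))) \<partial>lborel) =
        (\<integral>\<^sup>+x. weight w (x - y) * ennreal (\<bar>remainder (x - y) y\<bar> powr p) \<partial>lborel)"
    proof (intro nn_integral_cong_AE, use f AE_radial[OF ae, of y] in eventually_elim)
      case (elim x)
      have "taylor_remainder (m - 1) f x y = remainder (x - y) y"
        unfolding taylor_remainder_def remainder_def taylor using elim by simp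
      then show ?case
        using w by (simp add: weight_def elim mult.commute flip: ennreal_mult)
    qed
    also have "\<dots> = (\<integral>\<^sup>+h. weight w h * ennreal (\<bar>remainder h y\<bar> powr p) \<partial>lborel)"
      using nn_integral_translate[of "\<lambda>h. weight w h * ennreal (\<bar>remainder h y\<bar> powr p)" "- y"] by simp
    finally show ?case .
  qed
  then have "(\<integral>\<^sup>+y. (\<integral>\<^sup>+x. ennreal
              (\<bar>taylor_remainder (m - 1) f x y\<bar> powr p / norm_of K (x - y) powr (real m * p)
                 * \<rho> (norm_of K (x - y))) \<partial>lebesgue) \<partial>lebesgue) =
      (\<integral>\<^sup>+y. (\<integral>\<^sup>+h. weight w h * ennreal (\<bar>remainder h y\<bar> powr p) \<partial>lborel) \<partial>lborel)"
    unfolding nn_integral_completion by (rule nn_integral_cong_AE)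
  also have "\<dots> = (\<integral>\<^sup>+h. (\<integral>\<^sup>+y. weight w h * ennreal (\<bar>remainder h y\<bar> powr p) \<partial>lborel) \<partial>lborel)"
    by (rule lborel_pair.Fubini') measurable
  also have "\<dots> = energy w"
    unfolding energy_def by (simp add: nn_integral_cmult)
  finally show ?thesis .
qed

lemma double_integral_leading:
  assumes wd: "\<And>\<alpha>. mi_size \<alpha> \<le> m \<Longrightarrow> AE x in lborel. weak_deriv \<alpha> f x = g \<alpha> x"
  shows "(\<integral>\<^sup>+x. (\<integral>\<^sup>+y\<in>K. ennreal (\<bar>weak_Dm m f x y\<bar> powr p) \<partial>lebesgue) \<partial>lebesgue) =
    (\<integral>\<^sup>+h. indicator (interior K) h * (\<integral>\<^sup>+y. ennreal (\<bar>dir_form g m y h\<bar> powr p) \<partial>lborel) \<partial>lborel)"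
proof -
  have [measurable]: "interior K \<in> sets borel" by simp
  have "AE x in lborel. \<forall>is\<in>tuples m. weak_deriv (count_list is) f x = g (count_list is) x"
    using wd by (intro AE_finite_allI finite_tuples) (simp add: mi_size_count_list)
  then have "(\<integral>\<^sup>+x. (\<integral>\<^sup>+y\<in>K. ennreal (\<bar>weak_Dm m f x y\<bar> powr p) \<partial>lborel) \<partial>lborel) =
      (\<integral>\<^sup>+x. (\<integral>\<^sup>+y. indicator (interior K) y * ennreal (\<bar>dir_form g m x y\<bar> powr p) \<partial>lborel) \<partial>lborel)"
  proof (intro nn_integral_cong_AE, eventually_elim)
    case (elim x)
    then have "weak_Dm m f x y = dir_form g m x y" for y
      unfolding weak_Dm_def dir_form_def by (intro sum.cong) auto
    then show ?case
      by (intro nn_integral_cong_AE, use AE_indicator_K in eventually_elim)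
         (auto simp: indicator_def simp flip: norm_of_less_1)
  qed
  also have "\<dots> = (\<integral>\<^sup>+h. (\<integral>\<^sup>+y. indicator (interior K) h * ennreal (\<bar>dir_form g m y h\<bar> powr p) \<partial>lborel) \<partial>lborel)"
    by (rule lborel_pair.Fubini') measurable
  finally show ?thesis
    unfolding nn_integral_completion by (simp add: nn_integral_cmult)
qed

end

theorem theorem1p4:
  fixes K :: "(real ^ 'n::finite) set"
    and \<rho> :: "real \<Rightarrow> real \<Rightarrow> real"
    and f :: "real ^ 'n \<Rightarrow> real"
    and m :: nat and p :: real
  assumes "m \<ge> 1" and "p > 1"
    and "bounded K" and "convex K" and "uminus ` K = K" and "0 \<in> K" and "interior K \<noteq> {}"
    and "\<forall>\<epsilon>>0. \<rho> \<epsilon> \<in> borel_measurable (lebesgue_on {0..})"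
    and "\<forall>\<epsilon>>0. \<forall>r\<ge>0. \<rho> \<epsilon> r \<ge> 0"
    and "\<forall>\<epsilon>>0. (\<integral>\<^sup>+r\<in>{0..}. ennreal (r ^ (CARD('n) - 1) * \<rho> \<epsilon> r) \<partial>lebesgue) = 1"
    and "\<forall>\<delta>>0. ((\<lambda>\<epsilon>. \<integral>\<^sup>+r\<in>{\<delta>..}. ennreal (r ^ (CARD('n) - 1) * \<rho> \<epsilon> r) \<partial>lebesgue)
            \<longlongrightarrow> 0) (at_right 0)"
    and "f \<in> sobolev_space m p"
  shows "((\<lambda>\<epsilon>. \<integral>\<^sup>+y. (\<integral>\<^sup>+x. ennreal
              (\<bar>taylor_remainder (m - 1) f x y\<bar> powr p / norm_of K (x - y) powr (real m * p)
                 * \<rho> \<epsilon> (norm_of K (x - y))) \<partial>lebesgue) \<partial>lebesgue)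
          \<longlongrightarrow>
          ennreal ((real CARD('n) + real m * p) / fact m powr p)
            * (\<integral>\<^sup>+x. (\<integral>\<^sup>+y\<in>K. ennreal (\<bar>weak_Dm m f x y\<bar> powr p) \<partial>lebesgue) \<partial>lebesgue))
         (at_right 0)"
proof -
  have m: "0 < m" using assms(1) by simp
  obtain g where sob: "sobolev_derivatives m g p" and f: "AE x in lborel. f x = g (\<lambda>_. 0) x"
    and wd: "\<And>\<alpha>. mi_size \<alpha> \<le> m \<Longrightarrow> AE x in lborel. weak_deriv \<alpha> f x = g \<alpha> x"
    using sobolev_representatives[OF assms(12) m assms(2)] by blast
  interpret sobolev_derivatives m g p by (rule sob)
  interpret symmetric_convex_body K by unfold_locales (use assms(3-7) in auto)
  interpret anisotropic_energy m g p K ..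
  have "\<exists>w. w \<in> borel_measurable borel \<and> (\<forall>r. 0 \<le> w r) \<and>
      (0 < \<epsilon> \<longrightarrow> (AE r in lborel. 0 \<le> r \<longrightarrow> \<rho> \<epsilon> r = w r))" for \<epsilon>
  proof (cases "0 < \<epsilon>")
    case True
    with assms(8,9) obtain w where "w \<in> borel_measurable borel" "\<And>r. 0 \<le> w r"
      "AE r in lborel. 0 \<le> r \<longrightarrow> \<rho> \<epsilon> r = w r"
      using half_line_borel_representative[of "\<rho> \<epsilon>"] by blast
    then show ?thesis by blast
  next
    case False
    then show ?thesis by (intro exI[of _ "\<lambda>_. 0"]) simp
  qed
  then obtain w where "\<forall>\<epsilon>. w \<epsilon> \<in> borel_measurable borel \<and> (\<forall>r. 0 \<le> w \<epsilon> r) \<and>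
      (0 < \<epsilon> \<longrightarrow> (AE r in lborel. 0 \<le> r \<longrightarrow> \<rho> \<epsilon> r = w \<epsilon> r))"
    by (rule choice[OF allI, THEN exE])
  then have w: "\<And>\<epsilon>. w \<epsilon> \<in> borel_measurable borel" "\<And>\<epsilon> r. 0 \<le> w \<epsilon> r"
    and ae: "\<And>\<epsilon>. 0 < \<epsilon> \<Longrightarrow> AE r in lborel. 0 \<le> r \<longrightarrow> \<rho> \<epsilon> r = w \<epsilon> r"
    by simp_all
  have pos: "\<forall>\<^sub>F \<epsilon> in at_right (0::real). 0 < \<epsilon>" by (rule eventually_at_right_less)
  have "((\<lambda>\<epsilon>. energy (w \<epsilon>)) \<longlongrightarrow> sphere_mean) (at_right 0)"
  proof (rule energy_tendsto)
    show "\<forall>\<^sub>F \<epsilon> in at_right 0. radial_mass (w \<epsilon>) = 1"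
      using pos
    proof eventually_elim
      case (elim \<epsilon>)
      have "radial_mass (w \<epsilon>) = radial_mass (\<lambda>r. indicator {0..} r * w \<epsilon> r)"
        unfolding radial_mass_def by (intro nn_integral_cong) (auto simp: indicator_def)
      also have "\<dots> = (\<integral>\<^sup>+r\<in>{0..}. ennreal (r ^ (CARD('n) - 1) * \<rho> \<epsilon> r) \<partial>lebesgue)"
        by (rule radial_mass_lebesgue[OF ae[OF elim] w(2)]) simp
      finally show ?case using assms(10) elim by simp
    qed
    fix \<delta> :: real assume \<delta>: "0 < \<delta>"
    have eq: "\<forall>\<^sub>F \<epsilon> in at_right 0. (\<integral>\<^sup>+r\<in>{\<delta>..}. ennreal (r ^ (CARD('n) - 1) * \<rho> \<epsilon> r) \<partial>lebesgue) =
        radial_mass (\<lambda>r. indicator {\<delta>..} r * w \<epsilon> r)"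
      using pos
    proof eventually_elim
      case (elim \<epsilon>)
      show ?case by (rule radial_mass_lebesgue[OF ae[OF elim] w(2) less_imp_le[OF \<delta>], symmetric])
    qed
    show "((\<lambda>\<epsilon>. radial_mass (\<lambda>r. indicator {\<delta>..} r * w \<epsilon> r)) \<longlongrightarrow> 0) (at_right 0)"
      by (rule Lim_transform_eventually[OF assms(11)[rule_format, OF \<delta>] eq])
  qed (use w in auto)
  moreover have "\<forall>\<^sub>F \<epsilon> in at_right 0. energy (w \<epsilon>) = (\<integral>\<^sup>+y. (\<integral>\<^sup>+x. ennreal
              (\<bar>taylor_remainder (m - 1) f x y\<bar> powr p / norm_of K (x - y) powr (real m * p)
                 * \<rho> \<epsilon> (norm_of K (x - y))) \<partial>lebesgue) \<partial>lebesgue)"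
    using pos by eventually_elim (rule double_integral_eq_energy[OF f wd w(1) ae w(2), symmetric])
  moreover have "sphere_mean = ennreal ((real CARD('n) + real m * p) / fact m powr p)
      * (\<integral>\<^sup>+x. (\<integral>\<^sup>+y\<in>K. ennreal (\<bar>weak_Dm m f x y\<bar> powr p) \<partial>lebesgue) \<partial>lebesgue)"
    by (subst double_integral_leading, erule wd, rule sphere_mean_eq[symmetric])
  ultimately show ?thesis
    using Lim_transform_eventually by simp
qed

end
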